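(* Let $V:\mathbb{R}^3\to\mathbb{R}$ be a potential such that $V(H_{\mathbf A}+1)^{-1}$ is compact and $$V(x,y,z)\ge\langle(x,y)\rangle^{-\alpha}\,v_\perp(z),\qquad (x,y,z)\in\mathbb{R}^3,$$ with $\alpha>0$ and $v_\perp:\mathbb{R}\to\mathbb{R}$ a function. Suppose that $\alpha$ and $v_\perp$ satisfy one of the following two assumptions: (i) $\alpha<\frac12$ and $v_\perp\in L^1(\mathbb{R})$ is such that $\int_{\mathbb{R}}v_\perp(z)\,dz>0$; (ii) there are constants $C>0$ and $\gamma>0$ with $v_\perp(z)\ge C\langle z\rangle^{-\gamma}$ for all $z\in\mathbb{R}$, and $\alpha+\frac{\gamma}{2}<1$. Then $H_{\mathbf A}-V$ has infinitely many negative eigenvalues, which accumulate at $0$.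
   Context: $\langle x\rangle:=(1+|x|^2)^{1/2}$. With $r=\sqrt{x^2+y^2}$ and $D_j=-i\partial_j$, the operator $$H_{\mathbf A}=(-i\nabla-\mathbf A)^2=D_x^2+D_y^2+(D_z-\log r)^2,\qquad \mathbf A(x,y,z)=(0,0,\log r),$$ is initially defined on $C_0^\infty(\mathbb{R}^3)$ and then self-adjoint in $L^2(\mathbb{R}^3)$; its spectrum is $[0,+\infty)$. $V$ denotes both the real-valued function and the corresponding multiplication operator; when $V(H_{\mathbf A}+1)^{-1}$ is compact, $H_{\mathbf A}-V$ is self-adjoint with essential spectrum $[0,+\infty)$. *)

theory Defs
  imports "HOL-Analysis.Analysis"
begin

definition square_integrable :: "(real ^ 3 \<Rightarrow> complex) \<Rightarrow> bool" where
  "square_integrable f \<longleftrightarrow>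
     f \<in> borel_measurable lebesgue \<and> integrable lebesgue (\<lambda>p. (cmod (f p))\<^sup>2)"

definition L2_rel :: "(real ^ 3 \<Rightarrow> complex) \<Rightarrow> (real ^ 3 \<Rightarrow> complex) \<Rightarrow> bool" where
  "L2_rel f g \<longleftrightarrow>
     square_integrable f \<and> square_integrable g \<and> (AE p in lebesgue. f p = g p)"

lemma square_integrable_measurable [measurable_dest]:
  "square_integrable f \<Longrightarrow> f \<in> borel_measurable lebesgue"
  by (simp add: square_integrable_def)

lemma square_integrable_0: "square_integrable (\<lambda>p. 0)"
  by (simp add: square_integrable_def)

lemma square_integrable_add:
  assumes "square_integrable f" "square_integrable g"
  shows "square_integrable (\<lambda>p. f p + g p)"
proof -
  note [measurable] = assms[THEN square_integrable_measurable]
  have *: "(cmod (a + b))\<^sup>2 \<le> 2 * (cmod a)\<^sup>2 + 2 * (cmod b)\<^sup>2" for a b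
  proof -
    have "(cmod (a + b))\<^sup>2 \<le> (cmod a + cmod b)\<^sup>2"
      by (intro power_mono norm_triangle_ineq) auto
    also have "\<dots> \<le> 2 * (cmod a)\<^sup>2 + 2 * (cmod b)\<^sup>2"
      using sum_squares_bound[of "cmod a" "cmod b"] by (simp add: power2_sum)
    finally show ?thesis .
  qed
  have "integrable lebesgue (\<lambda>p. 2 * (cmod (f p))\<^sup>2 + 2 * (cmod (g p))\<^sup>2)"
    using assms by (auto simp: square_integrable_def)
  then have "integrable lebesgue (\<lambda>p. (cmod (f p + g p))\<^sup>2)"
    by (rule Bochner_Integration.integrable_bound) (use * in auto)
  then show ?thesis
    by (simp add: square_integrable_def)
qed

lemma square_integrable_scaleR:
  assumes "square_integrable f"
  shows "square_integrable (\<lambda>p. c *\<^sub>R f p)"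
  using assms by (auto simp: square_integrable_def power_mult_distrib)

lemma square_integrable_uminus:
  "square_integrable f \<Longrightarrow> square_integrable (\<lambda>p. - f p)"
  using square_integrable_scaleR[of f "-1"] by simp

lemma square_integrable_diff:
  "square_integrable f \<Longrightarrow> square_integrable g \<Longrightarrow> square_integrable (\<lambda>p. f p - g p)"
  using square_integrable_add[OF _ square_integrable_uminus, of f g] by simp

lemma integrable_inner_square_integrable:
  assumes "square_integrable f" "square_integrable g"
  shows "integrable lebesgue (\<lambda>p. f p \<bullet> g p)"
proof -
  note [measurable] = assms[THEN square_integrable_measurable]
  have *: "\<bar>a \<bullet> b\<bar> \<le> (cmod a)\<^sup>2 + (cmod b)\<^sup>2" for a b
  proof -
    have "2 * \<bar>a \<bullet> b\<bar> \<le> 2 * (cmod a * cmod b)"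
      using Cauchy_Schwarz_ineq2[of a b] by simp
    also have "\<dots> \<le> (cmod a)\<^sup>2 + (cmod b)\<^sup>2"
      using sum_squares_bound[of "cmod a" "cmod b"] by simp
    finally show ?thesis by (smt (verit) zero_le_power2)
  qed
  have "integrable lebesgue (\<lambda>p. (cmod (f p))\<^sup>2 + (cmod (g p))\<^sup>2)"
    using assms by (auto simp: square_integrable_def)
  then show ?thesis
    by (rule Bochner_Integration.integrable_bound) (use * in auto)
qed

quotient_type L2 = "real ^ 3 \<Rightarrow> complex" / partial: L2_rel
proof (rule part_equivpI)
  show "\<exists>f. L2_rel f f"
    using square_integrable_0 by (auto simp: L2_rel_def)
  show "symp L2_rel"
    by (auto simp: symp_def L2_rel_def)
  show "transp L2_rel"
    by (auto simp: transp_def L2_rel_def elim: eventually_elim2)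
qed

text \<open>
  The real inner product below is the real part of the usual sesquilinear one; it induces the
  usual norm and topology.
\<close>

instantiation L2 :: real_inner
begin

lift_definition zero_L2 :: L2 is "\<lambda>p. 0"
  by (auto simp: L2_rel_def square_integrable_0)

lift_definition plus_L2 :: "L2 \<Rightarrow> L2 \<Rightarrow> L2" is "\<lambda>f g p. f p + g p"
  by (auto simp: L2_rel_def square_integrable_add)

lift_definition minus_L2 :: "L2 \<Rightarrow> L2 \<Rightarrow> L2" is "\<lambda>f g p. f p - g p"
  by (auto simp: L2_rel_def square_integrable_diff)

lift_definition uminus_L2 :: "L2 \<Rightarrow> L2" is "\<lambda>f p. - f p"
  by (auto simp: L2_rel_def square_integrable_uminus)

lift_definition scaleR_L2 :: "real \<Rightarrow> L2 \<Rightarrow> L2" is "\<lambda>c f p. c *\<^sub>R f p"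
  by (auto simp: L2_rel_def square_integrable_scaleR)

lift_definition inner_L2 :: "L2 \<Rightarrow> L2 \<Rightarrow> real" is "\<lambda>f g. \<integral>p. f p \<bullet> g p \<partial>lebesgue"
proof -
  fix f f' g g' :: "real ^ 3 \<Rightarrow> complex"
  assume *: "L2_rel f f'" "L2_rel g g'"
  then have [measurable]: "f \<in> borel_measurable lebesgue" "f' \<in> borel_measurable lebesgue"
      "g \<in> borel_measurable lebesgue" "g' \<in> borel_measurable lebesgue"
    by (auto simp: L2_rel_def square_integrable_def)
  show "(\<integral>p. f p \<bullet> g p \<partial>lebesgue) = (\<integral>p. f' p \<bullet> g' p \<partial>lebesgue)"
  proof (rule integral_cong_AE)
    have "AE p in lebesgue. f p = f' p" "AE p in lebesgue. g p = g' p"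
      using * by (auto simp: L2_rel_def)
    then show "AE p in lebesgue. f p \<bullet> g p = f' p \<bullet> g' p"
      by eventually_elim simp
  qed measurable
qed

definition norm_L2 :: "L2 \<Rightarrow> real" where
  "norm_L2 F = sqrt (F \<bullet> F)"

definition dist_L2 :: "L2 \<Rightarrow> L2 \<Rightarrow> real" where
  "dist_L2 F G = norm (F - G)"

definition sgn_L2 :: "L2 \<Rightarrow> L2" where
  "sgn_L2 F = inverse (norm F) *\<^sub>R F"

definition uniformity_L2 :: "(L2 \<times> L2) filter" where
  "uniformity_L2 = (INF e\<in>{0<..}. principal {(F, G). dist F G < e})"

definition open_L2 :: "L2 set \<Rightarrow> bool" where
  "open_L2 U \<longleftrightarrow> (\<forall>F\<in>U. eventually (\<lambda>(F', G). F' = F \<longrightarrow> G \<in> U) uniformity)"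

instance
proof
  fix F G H :: L2 and a b :: real
  show "F + G + H = F + (G + H)"
    by transfer (auto simp: L2_rel_def square_integrable_add add.assoc)
  show "F + G = G + F"
    by transfer (auto simp: L2_rel_def square_integrable_add add.commute)
  show "0 + F = F"
    by transfer (auto simp: L2_rel_def)
  show "- F + F = 0"
    by transfer (auto simp: L2_rel_def square_integrable_0)
  show "F - G = F + - G"
    by transfer (auto simp: L2_rel_def square_integrable_diff square_integrable_add
        square_integrable_uminus)
  show "a *\<^sub>R (F + G) = a *\<^sub>R F + a *\<^sub>R G"
    by transfer (auto simp: L2_rel_def square_integrable_add square_integrable_scaleR
        scaleR_add_right simp del: scaleR_conv_of_real)
  show "(a + b) *\<^sub>R F = a *\<^sub>R F + b *\<^sub>R F"
    by transfer (auto simp: L2_rel_def square_integrable_add square_integrable_scaleR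
        scaleR_add_left simp del: scaleR_conv_of_real)
  show "a *\<^sub>R b *\<^sub>R F = (a * b) *\<^sub>R F"
    by transfer (auto simp: L2_rel_def square_integrable_scaleR simp del: scaleR_conv_of_real)
  show "1 *\<^sub>R F = F"
    by transfer (auto simp: L2_rel_def)
  show "F \<bullet> G = G \<bullet> F"
    by transfer (simp add: inner_commute)
  show "(F + G) \<bullet> H = F \<bullet> H + G \<bullet> H"
    by transfer (simp add: L2_rel_def inner_add_left integrable_inner_square_integrable)
  show "(a *\<^sub>R F) \<bullet> G = a * (F \<bullet> G)"
    by transfer (simp add: L2_rel_def integrable_inner_square_integrable)
  show "0 \<le> F \<bullet> F"
    by transfer simp
  show "F \<bullet> F = 0 \<longleftrightarrow> F = 0"
  proof transfer
    fix f :: "real ^ 3 \<Rightarrow> complex"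
    assume f: "L2_rel f f"
    have "(\<integral>p. f p \<bullet> f p \<partial>lebesgue) = 0 \<longleftrightarrow> (AE p in lebesgue. f p \<bullet> f p = 0)"
      using f by (intro integral_nonneg_eq_0_iff_AE)
        (auto simp: L2_rel_def integrable_inner_square_integrable)
    then show "(\<integral>p. f p \<bullet> f p \<partial>lebesgue) = 0 \<longleftrightarrow> L2_rel f (\<lambda>p. 0)"
      using f by (simp add: L2_rel_def square_integrable_0)
  qed
  show "norm F = sqrt (F \<bullet> F)" by (rule norm_L2_def)
  show "dist F G = norm (F - G)" by (rule dist_L2_def)
  show "sgn F = inverse (norm F) *\<^sub>R F" by (rule sgn_L2_def)
  show "uniformity = (INF e\<in>{0<..}. principal {(F, G). dist F (G :: L2) < e})"
    by (rule uniformity_L2_def)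
  show "open U \<longleftrightarrow> (\<forall>F\<in>U. eventually (\<lambda>(F', G). F' = F \<longrightarrow> G \<in> U) uniformity)" for U :: "L2 set"
    by (rule open_L2_def)
qed

end

definition represents :: "(real ^ 3 \<Rightarrow> complex) \<Rightarrow> L2 \<Rightarrow> bool" where
  "represents f F \<longleftrightarrow> (AE p in lebesgue. f p = rep_L2 F p)"

text \<open>
  An unbounded operator is identified with its graph, so that its domain is the \<^const>\<open>Domain\<close>
  of the graph, its inverse is the converse relation, and the product \<open>S T\<close> (first \<open>T\<close>, then \<open>S\<close>,
  on its natural domain) is \<open>T O S\<close>.
\<close>

type_synonym L2_op = "(L2 \<times> L2) set"

definition op_shift :: "L2_op \<Rightarrow> real \<Rightarrow> L2_op" where
  "op_shift T c = {(F, G + c *\<^sub>R F) |F G. (F, G) \<in> T}"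

definition op_diff :: "L2_op \<Rightarrow> L2_op \<Rightarrow> L2_op" where
  "op_diff S T = {(F, G - H) |F G H. (F, G) \<in> S \<and> (F, H) \<in> T}"

text \<open>
  A compact operator is in particular defined on the whole space.  Real linearity suffices here,
  since the graphs it is applied to are complex subspaces.
\<close>

definition compact_op :: "L2_op \<Rightarrow> bool" where
  "compact_op T \<longleftrightarrow>
     (\<exists>K. T = {(F, K F) |F. True} \<and> linear K \<and> compact (closure (K ` cball 0 1)))"

definition eigenvalue :: "L2_op \<Rightarrow> real \<Rightarrow> bool" where
  "eigenvalue T \<mu> \<longleftrightarrow> (\<exists>F. F \<noteq> 0 \<and> (F, \<mu> *\<^sub>R F) \<in> T)"

text \<open>Multiplication by a real function, on its maximal domain \<open>{F \<in> L\<^sup>2. W F \<in> L\<^sup>2}\<close>.\<close>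

definition mult_op :: "(real ^ 3 \<Rightarrow> real) \<Rightarrow> L2_op" where
  "mult_op W = {(F, G). represents (\<lambda>p. of_real (W p) * rep_L2 F p) G}"

definition partial_deriv :: "3 \<Rightarrow> (real ^ 3 \<Rightarrow> complex) \<Rightarrow> real ^ 3 \<Rightarrow> complex" where
  "partial_deriv j u p = vector_derivative (\<lambda>t. u (p + t *\<^sub>R axis j 1)) (at 0)"

primrec Ck :: "nat \<Rightarrow> (real ^ 3 \<Rightarrow> complex) \<Rightarrow> bool" where
  "Ck 0 u \<longleftrightarrow> continuous_on UNIV u"
| "Ck (Suc k) u \<longleftrightarrow> u differentiable_on UNIV \<and> (\<forall>j. Ck k (partial_deriv j u))"

definition test_function :: "(real ^ 3 \<Rightarrow> complex) \<Rightarrow> bool" where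
  "test_function u \<longleftrightarrow> (\<forall>k. Ck k u) \<and> compact (closure {p. u p \<noteq> 0})"

definition magnetic_momentum ::
    "(real ^ 3 \<Rightarrow> real ^ 3) \<Rightarrow> 3 \<Rightarrow> (real ^ 3 \<Rightarrow> complex) \<Rightarrow> real ^ 3 \<Rightarrow> complex" where
  "magnetic_momentum A j u p = - \<i> * partial_deriv j u p - of_real (A p $ j) * u p"

definition magnetic_laplacian ::
    "(real ^ 3 \<Rightarrow> real ^ 3) \<Rightarrow> (real ^ 3 \<Rightarrow> complex) \<Rightarrow> real ^ 3 \<Rightarrow> complex" where
  "magnetic_laplacian A u p =
     (\<Sum>j\<in>UNIV. magnetic_momentum A j (magnetic_momentum A j u) p)"

text \<open>
  The value on the axis \<open>r = 0\<close>, where \<^term>\<open>ln 0 = (0::real)\<close>, is irrelevant: the axis is a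
  null set, and off the axis the derivatives below only involve points off the axis.
\<close>

definition A_pot :: "real ^ 3 \<Rightarrow> real ^ 3" where
  "A_pot p = vector [0, 0, ln (sqrt ((p $ 1)\<^sup>2 + (p $ 2)\<^sup>2))]"

text \<open>
  The operator is essentially self-adjoint on the test functions, so the self-adjoint operator
  is the closure of its restriction to them.
\<close>

definition H_A :: L2_op where
  "H_A = closure {(F, G). \<exists>u. test_function u \<and> represents u F \<and>
                              represents (magnetic_laplacian A_pot u) G}"

definition japanese_bracket :: "'a::real_normed_vector \<Rightarrow> real" where
  "japanese_bracket x = sqrt (1 + (norm x)\<^sup>2)"

end

theory Submission
  imports Defs
begin

text \<open>
  The compactness hypothesis makes \<open>H + 1\<close> surjective, so for the closed, symmetric and
  nonnegative operator \<open>H\<close> everything can be expressed by the bounded operators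
  \<open>R = (H + 1)\<^sup>-\<^sup>1\<close> and \<open>K = V R\<close>.  For large \<open>l\<close> the resolvent
  \<open>(H - V + l)\<^sup>-\<^sup>1\<close> is a nonnegative operator that differs from
  \<open>(H + l)\<^sup>-\<^sup>1 \<le> 1 / l\<close> by a compact one, and negative eigenvalues of \<open>H - V\<close>
  correspond to its eigenvalues above \<open>1 / l\<close>.  These accumulate at \<open>1 / l\<close> as soon as the
  form of \<open>H - V\<close> is negative on subspaces of arbitrarily large dimension, because suprema of the
  quadratic form above \<open>1 / l\<close> on orthogonal complements of eigenvectors are attained.

  Such subspaces are spanned by functions with disjoint supports.  Near \<open>r = \<rho>\<close> the potential
  \<open>(log \<rho> - log r)\<^sup>2\<close> is harmonic with ground state of width \<open>sqrt \<rho>\<close> and energy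
  of order \<open>1 / \<rho>\<close>.  So we take \<open>exp (i z log \<rho>)\<close> times a bump of width
  \<open>s = sqrt \<rho>\<close> in all three directions centred at \<open>(\<rho>, 0, 0)\<close>:  the magnetic
  energy density is \<open>O(1 / \<rho>)\<close>, whereas \<open>V\<close> contributes relatively at least a constant times
  \<open>\<rho> powr (- \<alpha> - 1 / 2)\<close> in case (i) and \<open>\<rho> powr (- \<alpha> - \<gamma> / 2)\<close> in case (ii).
\<close>

subsection \<open>Compact perturbations of bounded self-adjoint operators\<close>

text \<open>No spectral theorem and no min-max principle enters. Three obstacles shape the abstract
  part. First, compactness of V R turns into smallness only together with closability of V: this
  forces the norm of V (H + l)^-1 below 1/2 for some large l and makes H - V + l invertible. Second,
  V (H + l)^-1 is not symmetric, so a norm bound says nothing directly about forms; but it is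
  symmetric for the form of (H + l)^-1, and Reid's inequality then gives H - V + l >= 0. Third, the
  logarithm is unbounded at the axis, so the terms of the magnetic Laplacian cannot be integrated by
  parts one by one without a cutoff. On the concrete side, sqrt \<rho> is the width at which the
  kinetic cost 1 / s^2 and the magnetic cost (log \<rho> - log r)^2, of order (s / \<rho>)^2,
  balance. Linear independence of the trial functions need not be proved separately: a form that is
  strictly negative on every nontrivial combination already excludes a vanishing one.\<close>

lemma solve_contraction:
  fixes P :: "'a::banach \<Rightarrow> 'a"
  assumes "linear P" and "0 \<le> q" "q < 1" and bound: "\<And>x. norm (P x) \<le> q * norm x"
  obtains x where "x - P x = y"
proof -
  \<comment> \<open>Banach's fixed point theorem takes the place of the Neumann series for the
    inverse of identity minus \<open>P\<close>.\<close>
  have "\<exists>!x. y + P x = x"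
  proof (rule banach_fix_type[OF \<open>0 \<le> q\<close> \<open>q < 1\<close>], intro allI)
    show "dist (y + P x) (y + P z) \<le> q * dist x z" for x z
      using bound[of "x - z"] by (simp add: dist_norm linear_diff[OF \<open>linear P\<close>])
  qed
  then obtain x where "y + P x = x"
    by blast
  then have "x - P x = y"
    by (simp add: algebra_simps)
  then show ?thesis
    by (rule that)
qed

text \<open>Gaussian elimination, one equation per induction step. It serves to find, among
  combinations of n + 1 trial vectors, one orthogonal to n given eigenvectors.\<close>

lemma homogeneous_system_nontrivial:
  fixes a :: "'m \<Rightarrow> 'i \<Rightarrow> real"
  assumes "finite M" "finite I" "card M < card I"
  obtains c where "\<exists>i\<in>I. c i \<noteq> 0" "\<And>m. m \<in> M \<Longrightarrow> (\<Sum>i\<in>I. c i * a m i) = 0"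
proof -
  have "\<exists>c. (\<exists>i\<in>I. c i \<noteq> 0) \<and> (\<forall>m\<in>M. (\<Sum>i\<in>I. c i * a m i) = 0)"
    using assms
  proof (induction M arbitrary: I a rule: finite_induct)
    case empty
    then have "I \<noteq> {}" by auto
    then show ?case
      by (auto intro: exI[of _ "\<lambda>_. 1"])
  next
    case (insert m M)
    show ?case
    proof (cases "\<forall>i\<in>I. a m i = 0")
      case True
      have "card M < card I" using insert by simp
      from insert.IH[OF insert.prems(1) this] True show ?thesis
        by auto
    next
      case False
      then obtain j where j: "j \<in> I" "a m j \<noteq> 0" by blast
      \<comment> \<open>The pivot \<open>a m j\<close> allows equation \<open>m\<close> to be solved
        for the unknown \<open>j\<close>. Substituting the result into the others gives the
        coefficients \<open>a'\<close>, and \<open>- s\<close> below is the recovered value of that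
        unknown. Equation \<open>m\<close> itself becomes trivial, as \<open>a' m\<close>
        vanishes.\<close>
      define a' where "a' k i = a k i - a m i / a m j * a k j" for k i
      have "card M < card (I - {j})"
        using insert j by simp
      from insert.IH[OF _ this, of a'] insert.prems obtain c where
        c: "\<exists>i\<in>I - {j}. c i \<noteq> 0" "\<And>k. k \<in> M \<Longrightarrow> (\<Sum>i\<in>I - {j}. c i * a' k i) = 0"
        by auto
      define s where "s = (\<Sum>i\<in>I - {j}. c i * a m i) / a m j"
      define d where "d i = (if i = j then - s else c i)" for i
      have *: "(\<Sum>i\<in>I. d i * a k i) = (\<Sum>i\<in>I - {j}. c i * a' k i)" for k
      proof -
        have "(\<Sum>i\<in>I. d i * a k i) = (\<Sum>i\<in>I - {j}. c i * a k i) - s * a k j"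
          using j insert.prems by (subst sum.remove[of _ j]) (auto simp: d_def)
        also have "\<dots> = (\<Sum>i\<in>I - {j}. c i * a' k i)"
          by (simp add: a'_def s_def right_diff_distrib sum_subtractf sum_distrib_right
              sum_divide_distrib mult.assoc)
        finally show ?thesis .
      qed
      moreover have "a' m i = 0" for i
        using j by (simp add: a'_def)
      moreover have "\<exists>i\<in>I. d i \<noteq> 0"
        using c(1) by (auto simp: d_def)
      ultimately show ?thesis
        using c(2) by (intro exI[of _ d]) auto
    qed
  qed
  then show ?thesis using that by blast
qed

text \<open>The usual discriminant argument, restricted to a subspace: in the maximization below the
  form is nonnegative only on the orthogonal complement of the eigenvectors found so far.\<close>

lemma form_Cauchy_Schwarz:
  fixes Q :: "'a::real_inner \<Rightarrow> 'a"
  assumes "linear Q" and sub: "subspace W" and sym: "\<And>x y. Q x \<bullet> y = x \<bullet> Q y"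
    and nonneg: "\<And>x. x \<in> W \<Longrightarrow> 0 \<le> Q x \<bullet> x" and "x \<in> W" "y \<in> W"
  shows "(Q x \<bullet> y)\<^sup>2 \<le> (Q x \<bullet> x) * (Q y \<bullet> y)"
proof -
  have "0 \<le> Q (x + t *\<^sub>R y) \<bullet> (x + t *\<^sub>R y)" for t
    using assms by (intro nonneg subspace_add subspace_scale)
  moreover have "Q (x + t *\<^sub>R y) \<bullet> (x + t *\<^sub>R y)
      = Q x \<bullet> x + 2 * t * (Q x \<bullet> y) + t\<^sup>2 * (Q y \<bullet> y)" for t
    using sym[of x y]
    by (simp add: linear_add[OF \<open>linear Q\<close>] linear_scale[OF \<open>linear Q\<close>] inner_add power2_eq_square
        algebra_simps inner_commute)
  ultimately have *: "0 \<le> Q x \<bullet> x + 2 * t * (Q x \<bullet> y) + t\<^sup>2 * (Q y \<bullet> y)" for t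
    by metis
  show ?thesis
  proof (cases "Q y \<bullet> y = 0")
    case True
    have "Q x \<bullet> y = 0"
    proof (rule ccontr)
      assume "Q x \<bullet> y \<noteq> 0"
      \<comment> \<open>With no quadratic term the expression is affine in t, and this t gives it
        the value -1.\<close>
      with *[of "- (Q x \<bullet> x + 1) / (2 * (Q x \<bullet> y))"] True show False
        by (simp add: field_simps)
    qed
    with True show ?thesis by simp
  next
    case False
    with nonneg[OF \<open>y \<in> W\<close>] have pos: "Q y \<bullet> y > 0" by simp
    have "0 \<le> (Q x \<bullet> x + 2 * (- (Q x \<bullet> y) / (Q y \<bullet> y)) * (Q x \<bullet> y)
        + (- (Q x \<bullet> y) / (Q y \<bullet> y))\<^sup>2 * (Q y \<bullet> y)) * (Q y \<bullet> y)"
      using *[of "- (Q x \<bullet> y) / (Q y \<bullet> y)"] pos by (intro mult_nonneg_nonneg) auto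
    also have "\<dots> = (Q x \<bullet> x) * (Q y \<bullet> y) - (Q x \<bullet> y)\<^sup>2"
      using pos by (simp add: field_simps power2_eq_square)
    finally show ?thesis by simp
  qed
qed

text \<open>
  Log-convexity of the sequence \<open>s n\<close> turns a violation of the bound for the form of \<open>N\<close> into
  geometric growth faster than \<open>(q ^ n)\<^sup>2\<close>, which the norm bound on \<open>P\<close> excludes.
\<close>

lemma symmetrizable_bound:
  fixes N P :: "'a::real_inner \<Rightarrow> 'a"
  assumes "linear N" and N_sym: "\<And>x y. N x \<bullet> y = x \<bullet> N y" and N_nonneg: "\<And>x. 0 \<le> N x \<bullet> x"
    and N_bound: "\<And>x. N x \<bullet> x \<le> b * (norm x)\<^sup>2"
    and P_sym: "\<And>x y. P x \<bullet> N y = N x \<bullet> P y"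
    and "0 < q" and P_bound: "\<And>x. norm (P x) \<le> q * norm x"
  shows "P x \<bullet> N x \<le> q * (N x \<bullet> x)"
proof -
  define s where "s n = N ((P ^^ n) x) \<bullet> (P ^^ n) x" for n
  note cs = form_Cauchy_Schwarz[OF \<open>linear N\<close> subspace_UNIV N_sym N_nonneg UNIV_I UNIV_I]
  have s_nonneg: "0 \<le> s n" for n
    by (simp add: s_def N_nonneg)
  have "norm ((P ^^ n) x) \<le> q ^ n * norm x" for n
  proof (induction n)
    case (Suc n)
    have "norm ((P ^^ Suc n) x) \<le> q * norm ((P ^^ n) x)"
      by (simp add: P_bound)
    also have "\<dots> \<le> q * (q ^ n * norm x)"
      using Suc \<open>0 < q\<close> by (intro mult_left_mono) auto
    finally show ?case by (simp add: mult.assoc)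
  qed simp
  then have "(norm ((P ^^ n) x))\<^sup>2 \<le> (q ^ n * norm x)\<^sup>2" for n
    by (intro power_mono) auto
  then have s_le: "s n \<le> \<bar>b\<bar> * (q ^ n * norm x)\<^sup>2" for n
    unfolding s_def
    by (intro order_trans[OF N_bound] mult_mono) auto
  have s_convex: "(s (Suc n))\<^sup>2 \<le> s n * s (Suc (Suc n))" for n
  proof -
    \<comment> \<open>Symmetry of \<open>P\<close> for the form of \<open>N\<close> moves one factor
      \<open>P\<close> to the other side, so that the middle term pairs the iterates n and n + 2 and
      Cauchy-Schwarz applies.\<close>
    have "s (Suc n) = N ((P ^^ n) x) \<bullet> (P ^^ Suc (Suc n)) x"
      unfolding s_def using P_sym[of "(P ^^ n) x" "(P ^^ Suc n) x"] by (simp add: inner_commute)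
    then show ?thesis
      using cs[of "(P ^^ n) x" "(P ^^ Suc (Suc n)) x"] by (simp add: s_def)
  qed
  have "s 1 \<le> q\<^sup>2 * s 0"
  proof (rule ccontr)
    assume "\<not> ?thesis"
    then have less: "q\<^sup>2 * s 0 < s 1" by simp
    have s1: "0 < s 1"
      using less s_nonneg[of 0] \<open>0 < q\<close> by (smt (verit) mult_nonneg_nonneg zero_le_power2)
    have s0: "0 < s 0"
      using s_convex[of 0] s1 s_nonneg[of 0] by (cases "s 0 = 0") auto
    define t where "t = s 1 / s 0"
    have t: "q\<^sup>2 < t" using less s0 by (simp add: t_def field_simps)
    have t0: "0 < t" using s0 s1 by (simp add: t_def)
    have step: "0 < s n \<and> t * s n \<le> s (Suc n)" for n
    proof (induction n)
      case 0
      show ?case using s0 by (simp add: t_def)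
    next
      case (Suc n)
      then have pos: "0 < s (Suc n)" using t0 by (smt (verit) mult_pos_pos)
      have "(t * s n) * s (Suc n) \<le> s (Suc n) * s (Suc n)"
        using Suc pos by (intro mult_right_mono) auto
      also have "\<dots> \<le> s n * s (Suc (Suc n))"
        using s_convex[of n] by (simp add: power2_eq_square)
      finally have "s n * (t * s (Suc n)) \<le> s n * s (Suc (Suc n))"
        by (simp add: mult_ac)
      then show ?case using Suc pos by simp
    qed
    have "t ^ n * s 0 \<le> s n" for n
    proof (induction n)
      case (Suc n)
      then have "t * (t ^ n * s 0) \<le> t * s n" using t0 by simp
      also have "\<dots> \<le> s (Suc n)" using step by simp
      finally show ?case by (simp add: mult.assoc)
    qed simp
    then have "t ^ n * s 0 \<le> \<bar>b\<bar> * (norm x)\<^sup>2 * (q\<^sup>2) ^ n" for n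
      using s_le[of n] by (simp add: power_mult_distrib flip: power_mult) (smt (verit) mult.commute mult.left_commute)
    then have "(t / q\<^sup>2) ^ n \<le> \<bar>b\<bar> * (norm x)\<^sup>2 / s 0" for n
      using s0 \<open>0 < q\<close> by (simp add: power_divide field_simps)
    moreover have "1 < t / q\<^sup>2" using t \<open>0 < q\<close> by (simp add: field_simps)
    then obtain n where "\<bar>b\<bar> * (norm x)\<^sup>2 / s 0 < (t / q\<^sup>2) ^ n"
      using real_arch_pow by blast
    ultimately show False by (simp add: not_le[symmetric])
  qed
  \<comment> \<open>Cauchy-Schwarz for the form of \<open>N\<close> between \<open>x\<close> and
    \<open>P x\<close> leaves only the ratio of \<open>s 1\<close> to \<open>s 0\<close> to be
    controlled.\<close>
  have "(N x \<bullet> P x)\<^sup>2 \<le> s 0 * s 1"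
    using cs[of x "P x"] by (simp add: s_def)
  also have "\<dots> \<le> s 0 * (q\<^sup>2 * s 0)"
    using \<open>s 1 \<le> q\<^sup>2 * s 0\<close> s_nonneg by (intro mult_left_mono) auto
  also have "\<dots> = (q * s 0)\<^sup>2"
    by (simp add: power2_eq_square)
  finally have "N x \<bullet> P x \<le> q * s 0"
    using s_nonneg[of 0] \<open>0 < q\<close> by (meson abs_le_square_iff abs_ge_self order_trans abs_of_nonneg mult_nonneg_nonneg less_imp_le power2_le_imp_le)
  then show ?thesis by (simp add: s_def inner_commute)
qed

section \<open>Discrete spectrum above a threshold\<close>

text \<open>In the application \<open>B\<close> and \<open>N\<close> are the resolvents of H - V and
  of H at -l, and c = 1 / l. Since \<open>N\<close> does not exceed \<open>c\<close>, only the
  compact part \<open>C\<close> can produce spectrum of \<open>B\<close> above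
  \<open>c\<close>.\<close>

locale compact_perturbation =
  fixes B N C :: "'a::{real_inner, complete_space} \<Rightarrow> 'a" and c :: real
  assumes B_linear: "linear B" and N_linear: "linear N"
    and B_sym: "\<And>x y. B x \<bullet> y = x \<bullet> B y"
    and B_nonneg: "\<And>x. 0 \<le> B x \<bullet> x"
    and B_bound: "\<exists>b. \<forall>x. norm (B x) \<le> b * norm x"
    and B_split: "\<And>x. B x = N x + C x"
    and N_le: "\<And>x. N x \<bullet> x \<le> c * (norm x)\<^sup>2"
    and C_compact: "\<And>x. bounded (range x) \<Longrightarrow>
      \<exists>r::nat\<Rightarrow>nat. strict_mono r \<and> convergent (\<lambda>n. C (x (r n)))"
    and c_nonneg: "0 \<le> c"
begin

text \<open>For \<sigma> > c the operator \<sigma> - N is bounded below by \<sigma> - c. Applied to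
  the sequence it differs from \<open>C (x n)\<close> by a null sequence, so it converges along a
  subsequence, and the lower bound passes this on to the vectors. The values \<open>s n\<close> may
  vary because the lemma is also applied to a sequence of different eigenvalues.\<close>

lemma approximate_eigenvectors_subseq:
  fixes x :: "nat \<Rightarrow> 'a"
  assumes "bounded (range x)" and s: "s \<longlonglongrightarrow> \<sigma>" "c < \<sigma>"
    and lim: "(\<lambda>n. B (x n) - s n *\<^sub>R x n) \<longlonglongrightarrow> 0"
  obtains r :: "nat \<Rightarrow> nat" and y where "strict_mono r" "(\<lambda>n. x (r n)) \<longlonglongrightarrow> y"
proof -
  obtain r k where r: "strict_mono r" and k: "(\<lambda>n. C (x (r n))) \<longlonglongrightarrow> k"
    using C_compact[OF assms(1)] by (auto simp: convergent_def)
  obtain b where b: "\<And>n. norm (x n) \<le> b"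
    using assms(1) by (auto simp: bounded_iff)
  have "(\<lambda>n. (\<sigma> - s n) *\<^sub>R x n) \<longlonglongrightarrow> 0"
  proof (rule Lim_null_comparison)
    show "\<forall>\<^sub>F n in sequentially. norm ((\<sigma> - s n) *\<^sub>R x n) \<le> \<bar>\<sigma> - s n\<bar> * b"
      using b by (intro always_eventually allI) (simp add: mult_left_mono)
    have "(\<lambda>n. \<bar>\<sigma> - s n\<bar> * b) \<longlonglongrightarrow> \<bar>\<sigma> - \<sigma>\<bar> * b"
      by (intro tendsto_intros s)
    then show "(\<lambda>n. \<bar>\<sigma> - s n\<bar> * b) \<longlonglongrightarrow> 0" by simp
  qed
  from tendsto_diff[OF this lim]
  have "(\<lambda>n. \<sigma> *\<^sub>R x n - B (x n)) \<longlonglongrightarrow> 0"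
    by (simp add: algebra_simps)
  from tendsto_add[OF LIMSEQ_subseq_LIMSEQ[OF this r] k]
  have z: "(\<lambda>n. \<sigma> *\<^sub>R x (r n) - N (x (r n))) \<longlonglongrightarrow> k"
    by (simp add: B_split o_def algebra_simps)
  have lower: "(\<sigma> - c) * norm y \<le> norm (\<sigma> *\<^sub>R y - N y)" for y
  proof (cases "y = 0")
    case False
    have "(\<sigma> - c) * (norm y)\<^sup>2 \<le> (\<sigma> *\<^sub>R y - N y) \<bullet> y"
      using N_le[of y] by (simp add: inner_diff power2_norm_eq_inner left_diff_distrib)
    also have "\<dots> \<le> norm (\<sigma> *\<^sub>R y - N y) * norm y"
      by (rule norm_cauchy_schwarz)
    finally show ?thesis
      using False by (simp add: power2_eq_square flip: mult.assoc)
  qed simp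
  have "Cauchy (\<lambda>n. x (r n))"
  proof (rule metric_CauchyI)
    fix e :: real assume "0 < e"
    with s have "0 < (\<sigma> - c) * e" by simp
    with LIMSEQ_imp_Cauchy[OF z] obtain m where m: "\<And>i j. m \<le> i \<Longrightarrow> m \<le> j \<Longrightarrow>
        dist (\<sigma> *\<^sub>R x (r i) - N (x (r i))) (\<sigma> *\<^sub>R x (r j) - N (x (r j))) < (\<sigma> - c) * e"
      by (meson metric_CauchyD)
    have "dist (x (r i)) (x (r j)) < e" if "m \<le> i" "m \<le> j" for i j
    proof -
      have "(\<sigma> - c) * norm (x (r i) - x (r j)) < (\<sigma> - c) * e"
        using m[OF that] lower[of "x (r i) - x (r j)"]
        by (simp add: dist_norm linear_diff[OF N_linear] algebra_simps)
      then show ?thesis using s by (simp add: dist_norm)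
    qed
    then show "\<exists>m. \<forall>i\<ge>m. \<forall>j\<ge>m. dist (x (r i)) (x (r j)) < e" by blast
  qed
  then show ?thesis
    using that r Cauchy_convergent_iff convergent_def by metis
qed

text \<open>The form of \<open>B\<close> is maximized over the unit sphere of the complement of
  \<open>M\<close>, which \<open>B\<close> leaves invariant. Maximizing vectors are approximate
  eigenvectors for the supremum \<sigma>; since \<sigma> > c, a subsequence converges and the
  supremum is attained.\<close>

lemma maximizer_is_eigenvector:
  assumes "finite M" and M: "\<And>m. m \<in> M \<Longrightarrow> \<exists>\<sigma>. B m = \<sigma> *\<^sub>R m"
    and w: "\<And>m. m \<in> M \<Longrightarrow> m \<bullet> w = 0" "c * (norm w)\<^sup>2 < B w \<bullet> w"
  obtains x \<sigma> where "norm x = 1" "c < \<sigma>" "B x = \<sigma> *\<^sub>R x" "\<And>m. m \<in> M \<Longrightarrow> m \<bullet> x = 0"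
proof -
  define W where "W = {x. \<forall>m\<in>M. m \<bullet> x = 0}"
  have W: "subspace W"
    by (auto simp: W_def subspace_def inner_add_right)
  have BW: "B x \<in> W" if "x \<in> W" for x
  proof -
    have "m \<bullet> B x = 0" if "m \<in> M" for m
    proof -
      obtain \<sigma> where "B m = \<sigma> *\<^sub>R m" using M \<open>m \<in> M\<close> by blast
      then have "m \<bullet> B x = \<sigma> * (m \<bullet> x)" by (simp flip: B_sym)
      then show ?thesis using \<open>x \<in> W\<close> that by (simp add: W_def)
    qed
    then show ?thesis by (simp add: W_def)
  qed
  obtain b where b: "\<And>x. norm (B x) \<le> b * norm x"
    using B_bound by blast
  define S where "S = (\<lambda>x. B x \<bullet> x) ` {x \<in> W. norm x = 1}"
  have "w \<noteq> 0"
    using w(2) by (auto simp: linear_0[OF B_linear])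
  define e where "e = w /\<^sub>R norm w"
  have "w \<in> W" using w by (simp add: W_def)
  then have eW: "e \<in> W" "norm e = 1"
    using \<open>w \<noteq> 0\<close> W by (auto simp: e_def subspace_scale)
  have "c < B e \<bullet> e"
    using w(2) \<open>w \<noteq> 0\<close> by (simp add: e_def linear_scale[OF B_linear] field_simps power2_eq_square)
  have S_le: "s \<le> b" if "s \<in> S" for s
  proof -
    from that obtain x where x: "norm x = 1" "s = B x \<bullet> x" by (auto simp: S_def)
    with b[of x] norm_cauchy_schwarz[of "B x" x] show ?thesis by simp
  qed
  then have bdd: "bdd_above S" by (auto simp: bdd_above_def)
  have "S \<noteq> {}" using eW by (auto simp: S_def)
  define \<sigma> where "\<sigma> = Sup S"
  have "B e \<bullet> e \<le> \<sigma>"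
    unfolding \<sigma>_def using eW by (intro cSup_upper bdd) (auto simp: S_def)
  with \<open>c < B e \<bullet> e\<close> have \<sigma>: "c < \<sigma>" by simp
  have upper: "B x \<bullet> x \<le> \<sigma> * (norm x)\<^sup>2" if "x \<in> W" for x
  proof (cases "x = 0")
    case False
    have "x /\<^sub>R norm x \<in> {x \<in> W. norm x = 1}"
      using False that W by (simp add: subspace_scale)
    then have "B (x /\<^sub>R norm x) \<bullet> (x /\<^sub>R norm x) \<le> \<sigma>"
      unfolding \<sigma>_def S_def[symmetric] by (intro cSup_upper bdd) (unfold S_def, rule imageI)
    with False show ?thesis
      by (simp add: linear_scale[OF B_linear] field_simps power2_eq_square)
  qed (simp add: linear_0[OF B_linear])
  define Q where "Q x = \<sigma> *\<^sub>R x - B x" for x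
  have Q_linear: "linear Q"
    unfolding Q_def by (intro linear_compose_sub linear_scale_self B_linear)
  have Q_sym: "Q x \<bullet> y = x \<bullet> Q y" for x y
    by (simp add: Q_def inner_diff B_sym)
  have Q_nonneg: "0 \<le> Q x \<bullet> x" if "x \<in> W" for x
    using upper[OF that] by (simp add: Q_def inner_diff power2_norm_eq_inner)
  have QW: "Q x \<in> W" if "x \<in> W" for x
    unfolding Q_def using that BW W by (intro subspace_diff subspace_scale)
  have "\<exists>x. x \<in> W \<and> norm x = 1 \<and> \<sigma> - inverse (Suc n) < B x \<bullet> x" for n
  proof -
    have "\<sigma> - inverse (Suc n) < Sup S" by (simp add: \<sigma>_def)
    with less_cSup_iff[OF \<open>S \<noteq> {}\<close> bdd] show ?thesis
      by (auto simp: S_def)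
  qed
  then obtain x where x: "\<And>n. x n \<in> W" "\<And>n. norm (x n) = 1"
      "\<And>n. \<sigma> - inverse (Suc n) < B (x n) \<bullet> x n"
    by metis
  \<comment> \<open>With p = Q x, Cauchy-Schwarz for the nonnegative form of \<open>Q\<close> bounds
    |p|^4 by the small number \<open>Q x \<bullet> x\<close> times \<open>Q p \<bullet> p\<close>.
    Nonnegativity of \<open>B\<close> bounds the latter by \<sigma> |p|^2, and cancelling |p|^2
    leaves a null sequence.\<close>
  have small: "(norm (Q (x n)))\<^sup>2 \<le> \<sigma> * inverse (Suc n)" for n
  proof -
    define p where "p = Q (x n)"
    have pW: "p \<in> W" using x QW by (simp add: p_def)
    have "((norm p)\<^sup>2)\<^sup>2 = (Q (x n) \<bullet> p)\<^sup>2"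
      by (simp add: p_def power2_norm_eq_inner)
    also have "\<dots> \<le> (Q (x n) \<bullet> x n) * (Q p \<bullet> p)"
      using form_Cauchy_Schwarz[OF Q_linear W Q_sym Q_nonneg x(1) pW] .
    also have "\<dots> \<le> inverse (Suc n) * (\<sigma> * (norm p)\<^sup>2)"
    proof (rule mult_mono)
      have "x n \<bullet> x n = 1"
        using x(2)[of n] by (simp add: norm_eq_1)
      then show "Q (x n) \<bullet> x n \<le> inverse (Suc n)"
        using x(3)[of n] by (simp add: Q_def inner_diff)
      show "Q p \<bullet> p \<le> \<sigma> * (norm p)\<^sup>2"
        using B_nonneg[of p] by (simp add: Q_def inner_diff power2_norm_eq_inner)
    qed (use Q_nonneg pW in auto)
    finally have "(norm p)\<^sup>2 * (norm p)\<^sup>2 \<le> (\<sigma> * inverse (Suc n)) * (norm p)\<^sup>2"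
      by (simp add: power2_eq_square mult_ac)
    then have "(norm p)\<^sup>2 \<le> \<sigma> * inverse (Suc n)" if "p \<noteq> 0"
      by (rule mult_right_le_imp_le) (use that in simp)
    then show ?thesis
      using \<sigma> c_nonneg by (cases "p = 0") (simp_all add: p_def)
  qed
  have "(\<lambda>n. (norm (Q (x n)))\<^sup>2) \<longlonglongrightarrow> 0"
  proof (rule Lim_null_comparison)
    show "\<forall>\<^sub>F n in sequentially. norm ((norm (Q (x n)))\<^sup>2) \<le> \<sigma> * inverse (Suc n)"
      using small by simp
    show "(\<lambda>n. \<sigma> * inverse (real (Suc n))) \<longlonglongrightarrow> 0"
      using tendsto_mult_right_zero[OF LIMSEQ_inverse_real_of_nat] by simp
  qed
  then have Q0: "(\<lambda>n. Q (x n)) \<longlonglongrightarrow> 0"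
    by (simp add: tendsto_norm_zero_iff)
  from tendsto_minus[OF this] have "(\<lambda>n. B (x n) - \<sigma> *\<^sub>R x n) \<longlonglongrightarrow> 0"
    by (simp add: Q_def)
  moreover have "bounded (range x)"
    using x by (auto simp: bounded_iff)
  ultimately obtain r y where r: "strict_mono r" and y: "(\<lambda>n. x (r n)) \<longlonglongrightarrow> y"
    using approximate_eigenvectors_subseq[OF _ tendsto_const \<sigma>] by metis
  have Q_bl: "bounded_linear Q"
  proof (rule bounded_linear_intro[where K = "\<bar>\<sigma>\<bar> + b"])
    show "norm (Q x) \<le> norm x * (\<bar>\<sigma>\<bar> + b)" for x
      unfolding Q_def using norm_triangle_ineq4[of "\<sigma> *\<^sub>R x" "B x"] b[of x]
      by (simp add: algebra_simps)
  qed (simp_all add: linear_add[OF Q_linear] linear_scale[OF Q_linear])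
  have "Q y = 0"
    using LIMSEQ_unique[OF bounded_linear.tendsto[OF Q_bl y] LIMSEQ_subseq_LIMSEQ[OF Q0 r, unfolded o_def]] .
  moreover have "norm y = 1"
    using LIMSEQ_unique[OF tendsto_norm[OF y]] x by (auto simp: tendsto_const)
  moreover have "m \<bullet> y = 0" if "m \<in> M" for m
    using LIMSEQ_unique[OF tendsto_inner[OF tendsto_const y, of m]] x that
    by (auto simp: W_def)
  ultimately show ?thesis
    using that[of y \<sigma>] \<sigma> by (simp add: Q_def)
qed

text \<open>If the gap above \<open>c\<close> contained no eigenvalue, maximization on successive
  complements would yield infinitely many orthonormal eigenvectors with eigenvalues in a compact
  interval above \<open>c\<close>. Then a subsequence of the vectors would converge, which
  orthonormal vectors cannot do.\<close>

theorem eigenvalues_accumulate: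
  assumes trial: "\<And>n. \<exists>u. \<forall>a. (\<exists>i\<le>n. a i \<noteq> 0) \<longrightarrow>
      c * (norm (\<Sum>i\<le>n::nat. a i *\<^sub>R u i))\<^sup>2 < B (\<Sum>i\<le>n. a i *\<^sub>R u i) \<bullet> (\<Sum>i\<le>n. a i *\<^sub>R u i)"
    and "0 < \<epsilon>"
  obtains \<sigma> x where "c < \<sigma>" "\<sigma> < c + \<epsilon>" "x \<noteq> 0" "B x = \<sigma> *\<^sub>R x"
proof (rule ccontr)
  assume "\<not> thesis"
  then have none: "c + \<epsilon> \<le> \<sigma>" if "c < \<sigma>" "x \<noteq> 0" "B x = \<sigma> *\<^sub>R x" for \<sigma> x
    using that \<open>\<And>\<sigma> x. \<lbrakk>c < \<sigma>; \<sigma> < c + \<epsilon>; x \<noteq> 0; B x = \<sigma> *\<^sub>R x\<rbrakk> \<Longrightarrow> thesis\<close> by force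
  obtain b where b: "\<And>x. norm (B x) \<le> b * norm x"
    using B_bound by blast
  define P where "P f n x \<longleftrightarrow> norm x = 1 \<and> (\<exists>\<sigma>. c + \<epsilon> \<le> \<sigma> \<and> B x = \<sigma> *\<^sub>R x) \<and>
      (\<forall>i<n. f i \<bullet> x = 0)" for f :: "nat \<Rightarrow> 'a" and n :: nat and x
  have "\<exists>f. \<forall>n. P f n (f n)"
  proof (rule dependent_wellorder_choice)
    show "P f n x = P g n x" if "\<And>i. i < n \<Longrightarrow> f i = g i" for x f g n
      using that by (auto simp: P_def)
    fix n :: nat and f :: "nat \<Rightarrow> 'a"
    assume f: "\<And>i. i < n \<Longrightarrow> P f i (f i)"
    define M where "M = f ` {..<n}"
    obtain u where u: "\<And>a. (\<exists>i\<le>n. a i \<noteq> 0) \<Longrightarrow>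
      c * (norm (\<Sum>i\<le>n. a i *\<^sub>R u i))\<^sup>2 < B (\<Sum>i\<le>n. a i *\<^sub>R u i) \<bullet> (\<Sum>i\<le>n. a i *\<^sub>R u i)"
      using trial[of n] by blast
    \<comment> \<open>The index set \<open>{..n}\<close> has n + 1 elements, one more than the
      eigenvectors already chosen.\<close>
    have "finite M" "card M < card {..n}"
      unfolding M_def using card_image_le[of "{..<n}" f] by (simp_all add: less_Suc_eq_le)
    then obtain a where a: "\<exists>i\<le>n. a i \<noteq> 0" "\<And>m. m \<in> M \<Longrightarrow> (\<Sum>i\<le>n. a i * (m \<bullet> u i)) = 0"
      using homogeneous_system_nontrivial[of M "{..n}" "\<lambda>m i. m \<bullet> u i"] by (metis atMost_iff finite_atMost)
    have "m \<bullet> (\<Sum>i\<le>n. a i *\<^sub>R u i) = 0" if "m \<in> M" for m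
      using a(2)[OF that] by (simp add: inner_sum_right)
    moreover have "\<exists>\<sigma>. B m = \<sigma> *\<^sub>R m" if "m \<in> M" for m
      using that f by (auto simp: M_def P_def)
    ultimately obtain x \<sigma> where "norm x = 1" "c < \<sigma>" "B x = \<sigma> *\<^sub>R x" "\<And>m. m \<in> M \<Longrightarrow> m \<bullet> x = 0"
      using maximizer_is_eigenvector[OF \<open>finite M\<close> _ _ u[OF a(1)]] by metis
    moreover from this have "c + \<epsilon> \<le> \<sigma>"
      by (intro none[of \<sigma> x]) auto
    ultimately show "\<exists>x. P f n x"
      by (auto simp: P_def M_def)
  qed
  then obtain f where f: "\<And>n. P f n (f n)" by blast
  then have norm_f: "norm (f n) = 1" for n
    by (simp add: P_def)
  have "\<exists>\<sigma>. c + \<epsilon> \<le> \<sigma> \<and> B (f n) = \<sigma> *\<^sub>R f n" for n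
    using f by (simp add: P_def)
  then obtain s where s: "\<And>n. c + \<epsilon> \<le> s n" "\<And>n. B (f n) = s n *\<^sub>R f n"
    by metis
  have orth: "f i \<bullet> f j = 0" if "i < j" for i j
    using f[of j] that by (simp add: P_def)
  have "s n \<in> {c + \<epsilon>..b}" for n
    using s(1)[of n] b[of "f n"] s(2)[of n] norm_f[of n] by simp
  then obtain \<sigma> r where \<sigma>: "\<sigma> \<in> {c + \<epsilon>..b}" and r: "strict_mono r" "(s \<circ> r) \<longlonglongrightarrow> \<sigma>"
    using compact_Icc[of "c + \<epsilon>" b] unfolding compact_def by (metis (full_types))
  have "bounded (range (\<lambda>n. f (r n)))"
    using norm_f by (auto simp: bounded_iff)
  moreover have "c < \<sigma>" using \<sigma> \<open>0 < \<epsilon>\<close> by auto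
  ultimately obtain q y where q: "strict_mono q" "(\<lambda>n. f (r (q n))) \<longlonglongrightarrow> y"
    using approximate_eigenvectors_subseq[of "\<lambda>n. f (r n)" "s \<circ> r" \<sigma>] r s(2) by auto
  have "strict_mono (r \<circ> q)" using r q by (intro strict_mono_o)
  from LIMSEQ_imp_Cauchy[OF q(2)] obtain m where
    "\<And>i j. m \<le> i \<Longrightarrow> m \<le> j \<Longrightarrow> dist (f (r (q i))) (f (r (q j))) < 1"
    by (metis metric_CauchyD zero_less_one)
  then have d: "norm (f (r (q m)) - f (r (q (Suc m)))) < 1"
    by (auto simp: dist_norm)
  have "r (q m) < r (q (Suc m))"
    using \<open>strict_mono (r \<circ> q)\<close> by (auto simp: strict_mono_def)
  then have "(norm (f (r (q m)) - f (r (q (Suc m)))))\<^sup>2 = 2"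
    using norm_f orth by (simp add: power2_norm_eq_inner inner_diff inner_commute norm_eq_1)
  moreover have "(norm (f (r (q m)) - f (r (q (Suc m)))))\<^sup>2 < 1"
    using d by (simp add: power_less_one_iff abs_square_less_1)
  ultimately show False by simp
qed

end

subsection \<open>Relatively compact perturbations\<close>

text \<open>
  Here \<open>R = (H + 1)\<^sup>-\<^sup>1\<close> and \<open>K = V R\<close>, so \<open>f - R f - K f\<close> is \<open>(H - V) (R f)\<close>, and
  \<open>K_closable\<close> says that \<open>V\<close> is closable on the domain of \<open>H\<close>.
\<close>

locale relatively_compact_perturbation =
  fixes R K :: "'a::{real_inner, banach} \<Rightarrow> 'a"
  assumes R_linear: "linear R" and K_linear: "linear K"
    and R_sym: "\<And>f g. R f \<bullet> g = f \<bullet> R g"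
    and R_ge: "\<And>f. (norm (R f))\<^sup>2 \<le> R f \<bullet> f"
    and KR_sym: "\<And>f g. K f \<bullet> R g = R f \<bullet> K g"
    and K_compact: "compact (closure (K ` cball 0 1))"
    and K_closable: "\<And>g k. (\<lambda>n. R (g n)) \<longlonglongrightarrow> 0 \<Longrightarrow> (\<lambda>n. K (g n)) \<longlonglongrightarrow> k \<Longrightarrow> k = 0"
begin

lemma R_nonneg: "0 \<le> R f \<bullet> f"
  using R_ge[of f] by (smt (verit) zero_le_power2)

lemma R_le: "R f \<bullet> f \<le> (norm f)\<^sup>2"
proof -
  have "0 \<le> (norm (f - R f))\<^sup>2" by simp
  also have "\<dots> = (norm f)\<^sup>2 - 2 * (R f \<bullet> f) + (norm (R f))\<^sup>2"
    by (simp add: power2_norm_eq_inner inner_diff inner_commute)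
  finally show ?thesis using R_ge[of f] by simp
qed

lemma norm_R_le: "norm (R f) \<le> norm f"
  using R_le[of f] R_ge[of f] by (meson norm_ge_zero order_trans power2_le_imp_le)

text \<open>The vector \<open>f - R f\<close> is H (R f), so this is the contraction property of H
  (H + 1)^-1 for nonnegative H.\<close>

lemma norm_diff_R_le: "norm (f - R f) \<le> norm f"
proof (rule power2_le_imp_le)
  have "(norm (f - R f))\<^sup>2 = (norm f)\<^sup>2 - 2 * (R f \<bullet> f) + (norm (R f))\<^sup>2"
    by (simp add: power2_norm_eq_inner inner_diff inner_commute)
  then show "(norm (f - R f))\<^sup>2 \<le> (norm f)\<^sup>2"
    using R_ge[of f] R_nonneg[of f] by simp
qed simp

lemma K_subseq:
  fixes g :: "nat \<Rightarrow> 'a"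
  assumes "bounded (range g)"
  obtains r :: "nat \<Rightarrow> nat" and k where "strict_mono r" "(\<lambda>n. K (g (r n))) \<longlonglongrightarrow> k"
proof -
  obtain b where b: "0 < b" "\<And>n. norm (g n) \<le> b"
    using assms by (auto simp: bounded_pos)
  have "K (g n /\<^sub>R b) \<in> closure (K ` cball 0 1)" for n
    using b closure_subset[of "K ` cball 0 1"] by (auto simp: field_simps)
  then obtain k r where r: "strict_mono r" "((\<lambda>n. K (g n /\<^sub>R b)) \<circ> r) \<longlonglongrightarrow> k"
    using K_compact unfolding compact_def by metis
  have "(\<lambda>n. b *\<^sub>R ((\<lambda>n. K (g n /\<^sub>R b)) \<circ> r) n) \<longlonglongrightarrow> b *\<^sub>R k"
    by (intro tendsto_intros r)
  then have "(\<lambda>n. K (g (r n))) \<longlonglongrightarrow> b *\<^sub>R k"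
    using b by (simp add: linear_scale[OF K_linear])
  then show ?thesis using that r by blast
qed

text \<open>As g = (H + 1) (R g), this is (H + l) (R g). Working with g in place of R g keeps all
  operators bounded.\<close>

definition shifted :: "real \<Rightarrow> 'a \<Rightarrow> 'a" where
  "shifted l g = g + (l - 1) *\<^sub>R R g"

lemma shifted_linear: "linear (shifted l)"
  unfolding shifted_def by (intro linear_compose_add linear_ident linear_compose_scale_right R_linear)

lemma norm_shifted: "(norm (shifted l g))\<^sup>2 = (norm g)\<^sup>2 + 2 * (l - 1) * (R g \<bullet> g) + (l - 1)\<^sup>2 * (norm (R g))\<^sup>2"
proof -
  have "(norm (g + t *\<^sub>R R g))\<^sup>2 = (norm g)\<^sup>2 + 2 * t * (R g \<bullet> g) + t\<^sup>2 * (norm (R g))\<^sup>2" for t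
    unfolding power2_norm_eq_inner
    by (simp add: inner_add inner_commute[of g "R g"] power2_eq_square distrib_left)
  then show ?thesis by (simp add: shifted_def)
qed

lemma norm_le_shifted:
  assumes "1 \<le> l"
  shows "norm g \<le> norm (shifted l g)"
proof (rule power2_le_imp_le)
  show "(norm g)\<^sup>2 \<le> (norm (shifted l g))\<^sup>2"
    using assms R_nonneg[of g] by (simp add: norm_shifted)
qed simp

lemma R_le_shifted:
  assumes "1 \<le> l"
  shows "(l - 1) * norm (R g) \<le> norm (shifted l g)"
proof (rule power2_le_imp_le)
  show "((l - 1) * norm (R g))\<^sup>2 \<le> (norm (shifted l g))\<^sup>2"
    using assms R_nonneg[of g] by (simp add: norm_shifted power_mult_distrib)
qed simp

text \<open>Divided by l, \<open>shifted l\<close> becomes 1 - q (1 - R) with q = (l - 1) / l < 1.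
  As 1 - R is a contraction, a single fixed point argument reaches every l, with no stepwise
  continuation from l = 1.\<close>

lemma shifted_surj:
  assumes "1 \<le> l"
  obtains g where "shifted l g = y"
proof -
  define q where "q = (l - 1) / l"
  have q: "0 \<le> q" "q < 1" using assms by (auto simp: q_def)
  have "linear (\<lambda>x. q *\<^sub>R (x - R x))"
    by (intro linear_compose_scale_right linear_compose_sub linear_ident R_linear)
  moreover have "norm (q *\<^sub>R (x - R x)) \<le> q * norm x" for x
    using norm_diff_R_le[of x] q by (simp add: mult_left_mono)
  ultimately obtain x where x: "x - q *\<^sub>R (x - R x) = y /\<^sub>R l"
    using solve_contraction[of "\<lambda>x. q *\<^sub>R (x - R x)" q "y /\<^sub>R l"] q by blast
  have "y = l *\<^sub>R (x - q *\<^sub>R (x - R x))"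
    using assms by (simp add: x)
  also have "\<dots> = l *\<^sub>R x - (l * q) *\<^sub>R (x - R x)"
    by (simp add: scaleR_diff_right)
  also have "l * q = l - 1"
    using assms by (simp add: q_def)
  also have "l *\<^sub>R x - (l - 1) *\<^sub>R (x - R x) = shifted l x"
    by (simp add: shifted_def algebra_simps)
  finally show ?thesis using that by simp
qed

text \<open>A relatively compact closable perturbation has relative bound zero. Otherwise there are
  vectors with (H + l) (R g) of norm one, \<open>K g\<close> of norm above 1/2 and l tending to
  infinity. Then \<open>R g\<close> tends to 0 while \<open>K g\<close> has a limit along a
  subsequence, and closability forces that limit to vanish.\<close>

lemma K_small:
  obtains l where "2 \<le> l" "\<And>g. norm (K g) \<le> 1 / 2 * norm (shifted l g)"
proof (rule ccontr)
  assume "\<not> thesis"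
  then have "\<exists>g. 1 / 2 * norm (shifted (real n + 2) g) < norm (K g)" for n :: nat
    using that[of "real n + 2"] by (auto simp: not_le[symmetric])
  then obtain f where f: "\<And>n::nat. 1 / 2 * norm (shifted (real n + 2) (f n)) < norm (K (f n))"
    by metis
  define g where "g n = f n /\<^sub>R norm (shifted (real n + 2) (f n))" for n
  have "f n \<noteq> 0" for n
    using f[of n] by (auto simp: linear_0[OF K_linear])
  then have pos: "0 < norm (shifted (real n + 2) (f n))" for n
    using norm_le_shifted[of "real n + 2" "f n"] by (smt (verit) zero_less_norm_iff of_nat_0_le_iff)
  have unit: "norm (shifted (real n + 2) (g n)) = 1" for n
    using pos[of n] by (simp add: g_def linear_scale[OF shifted_linear])
  have Kg: "1 / 2 < norm (K (g n))" for n
    using f[of n] pos[of n] by (simp add: g_def linear_scale[OF K_linear] field_simps)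
  have "norm (g n) \<le> 1" for n
    using norm_le_shifted[of "real n + 2" "g n"] unit[of n] by simp
  then have "bounded (range g)"
    by (auto simp: bounded_iff)
  then obtain r k where r: "strict_mono r" "(\<lambda>n. K (g (r n))) \<longlonglongrightarrow> k"
    using K_subseq by blast
  \<comment> \<open>At l = n + 2 the factor l - 1 in \<open>R_le_shifted\<close> is n + 1, which
    gives exactly the rate \<open>inverse (real (Suc n))\<close>.\<close>
  have "(\<lambda>n. R (g n)) \<longlonglongrightarrow> 0"
  proof (rule Lim_null_comparison[OF _ LIMSEQ_inverse_real_of_nat])
    show "\<forall>\<^sub>F n in sequentially. norm (R (g n)) \<le> inverse (real (Suc n))"
      using R_le_shifted[of "real n + 2" "g n" for n] unit
      by (intro always_eventually allI) (simp add: field_simps)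
  qed
  from LIMSEQ_subseq_LIMSEQ[OF this r(1)] have "(\<lambda>n. R (g (r n))) \<longlonglongrightarrow> 0"
    by (simp add: o_def)
  from K_closable[OF this r(2)] have "k = 0" .
  moreover have "1 / 2 \<le> norm k"
    using Kg by (intro tendsto_lowerbound[OF tendsto_norm[OF r(2)]] always_eventually)
      (auto intro: less_imp_le)
  ultimately show False by simp
qed

text \<open>With B = (H - V + l)^-1, an eigenvalue \<mu> of H - V corresponds to \<sigma> = 1 / (l +
  \<mu>). Negative \<mu> close to 0 are thus eigenvalues of \<open>B\<close> slightly above 1 / l,
  which is the threshold for the unperturbed resolvent.\<close>

theorem negative_eigenvalues_accumulate:
  assumes trial: "\<And>n. \<exists>f. \<forall>a. (\<exists>i\<le>n. a i \<noteq> 0) \<longrightarrow>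
      (\<exists>F. F = (\<Sum>i\<le>n::nat. a i *\<^sub>R f i) \<and> (F - R F - K F) \<bullet> R F < 0)"
    and "0 < \<delta>"
  obtains \<mu> F where "- \<delta> < \<mu>" "\<mu> < 0" "R F \<noteq> 0" "F - R F - K F = \<mu> *\<^sub>R R F"
proof -
  obtain l where l: "2 \<le> l" and K_half: "\<And>g. norm (K g) \<le> 1 / 2 * norm (shifted l g)"
    using K_small by blast
  define S where "S = shifted l"
  have S_linear: "linear S" by (simp add: S_def shifted_linear)
  have S_ge: "norm g \<le> norm (S g)" for g
    using l by (simp add: S_def norm_le_shifted)
  have "\<exists>g. S g = w" for w
    using l shifted_surj[of l w] by (auto simp: S_def)
  then obtain Si where S_Si: "\<And>w. S (Si w) = w"
    by metis
  have S_inj: "g = h" if "S g = S h" for g h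
    using S_ge[of "g - h"] that by (simp add: linear_diff[OF S_linear])
  have Si_linear: "linear Si"
    by (rule linearI; rule S_inj)
      (simp_all add: linear_add[OF S_linear] linear_scale[OF S_linear] S_Si)
  have Si_le: "norm (Si w) \<le> norm w" for w
    using S_ge[of "Si w"] by (simp add: S_Si)

  \<comment> \<open>This is (H - V + l) (R g).\<close>
  define L where "L g = S g - K g" for g
  have L_linear: "linear L"
    unfolding L_def by (intro linear_compose_sub S_linear K_linear)
  have L_ge: "1 / 2 * norm g \<le> norm (L g)" for g
    using K_half[of g] S_ge[of g] norm_triangle_ineq2[of "S g" "K g"] by (simp add: L_def S_def)
  have KSi: "norm (K (Si w)) \<le> 1 / 2 * norm w" for w
    using K_half[of "Si w"] by (simp add: S_Si flip: S_def)
  have KSi_linear: "linear (\<lambda>w. K (Si w))"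
    using linear_compose[OF Si_linear K_linear] by (simp add: o_def)
  \<comment> \<open>Substituting g = Si J turns the equation into one for identity minus V (H +
    l)^-1, whose perturbing term has norm at most 1/2.\<close>
  have "\<exists>g. L g = w" for w
  proof -
    obtain J where "J - K (Si J) = w"
      by (rule solve_contraction[OF KSi_linear _ _ KSi]) auto
    then have "L (Si J) = w" by (simp add: L_def S_Si)
    then show ?thesis by blast
  qed
  then obtain Li where L_Li: "\<And>w. L (Li w) = w"
    by metis
  have L_inj: "g = h" if "L g = L h" for g h
    using L_ge[of "g - h"] that by (simp add: linear_diff[OF L_linear])
  have Li_L: "Li (L g) = g" for g
    by (rule L_inj) (rule L_Li)
  have Li_linear: "linear Li"
    by (rule linearI; rule L_inj)
      (simp_all add: linear_add[OF L_linear] linear_scale[OF L_linear] L_Li)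
  have Li_le: "norm (Li w) \<le> 2 * norm w" for w
    using L_ge[of "Li w"] by (simp add: L_Li)
  \<comment> \<open>After applying \<open>R\<close> this is the second resolvent identity; its last
    term is compact because \<open>K\<close> is.\<close>
  have Li_eq: "Li w = Si w + Si (K (Li w))" for w
    using L_Li[of w] by - (rule S_inj, simp add: linear_add[OF S_linear] S_Si L_def algebra_simps)

  have RS_sym: "R g \<bullet> S h = S g \<bullet> R h" for g h
    by (simp add: S_def shifted_def inner_add_left inner_add_right R_sym[of g h])
  have RL_sym: "R g \<bullet> L h = L g \<bullet> R h" for g h
    using RS_sym[of g h] KR_sym[of g h] by (simp add: L_def inner_diff)
  define N where "N w = R (Si w)" for w
  have N_linear: "linear N"
    unfolding N_def using linear_compose[OF Si_linear R_linear] by (simp add: o_def)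
  have N_sym: "N x \<bullet> y = x \<bullet> N y" for x y
    using RS_sym[of "Si x" "Si y"] by (simp add: N_def S_Si)
  have N_nonneg: "0 \<le> N x \<bullet> x" for x
  proof -
    have "0 \<le> R g \<bullet> S g" for g
      using R_nonneg[of g] l
      by (simp add: S_def shifted_def inner_add mult_nonneg_nonneg)
    from this[of "Si x"] show ?thesis by (simp add: N_def S_Si)
  qed
  have N_le: "N x \<bullet> x \<le> 1 / l * (norm x)\<^sup>2" for x
  proof -
    define g where "g = Si x"
    have x: "x = S g" by (simp add: g_def S_Si)
    \<comment> \<open>Expanding the norm of x = S g writes |x|^2 - l (R g, x) as a sum of two
      nonnegative terms, one for R <= 1 and one for \<open>R_ge\<close>.\<close>
    have "0 \<le> ((norm g)\<^sup>2 - R g \<bullet> g) + (l - 1) * (R g \<bullet> g - (norm (R g))\<^sup>2)"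
      using R_le[of g] R_ge[of g] l by (intro add_nonneg_nonneg mult_nonneg_nonneg) auto
    also have "\<dots> = (norm x)\<^sup>2 - l * (R g \<bullet> x)"
      unfolding x S_def norm_shifted
      by (simp add: shifted_def inner_add_right power2_norm_eq_inner[of "R g"] power2_eq_square[of "l - 1"] algebra_simps)
    finally show ?thesis
      using l by (simp add: N_def field_simps flip: g_def)
  qed

  define B where "B w = R (Li w)" for w
  define C where "C w = R (Si (K (Li w)))" for w
  \<comment> \<open>Reid's inequality for V (H + l)^-1, symmetrized by N = (H + l)^-1, turns the
    norm bound 1/2 into V <= (H + l) / 2 as forms. Hence H - V + l is nonnegative.\<close>
  have L_nonneg: "0 \<le> L g \<bullet> R g" for g
  proof -
    have "K (Si x) \<bullet> N y = N x \<bullet> K (Si y)" for x y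
      by (simp add: N_def KR_sym)
    from symmetrizable_bound[OF N_linear N_sym N_nonneg N_le this _ KSi, of "S g"]
    have "K (Si (S g)) \<bullet> N (S g) \<le> 1 / 2 * (N (S g) \<bullet> S g)"
      by simp
    moreover have "Si (S g) = g" using S_inj S_Si by blast
    ultimately show ?thesis
      using N_nonneg[of "S g"] by (simp add: N_def L_def inner_diff inner_commute)
  qed
  interpret bnc: compact_perturbation B N C "1 / l"
  proof (rule compact_perturbation.intro)
    show "linear B"
      unfolding B_def using linear_compose[OF Li_linear R_linear] by (simp add: o_def)
    show "B x \<bullet> y = x \<bullet> B y" for x y
      using RL_sym[of "Li x" "Li y"] by (simp add: B_def L_Li)
    show "0 \<le> B x \<bullet> x" for x
      using L_nonneg[of "Li x"] by (simp add: B_def L_Li inner_commute)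
    show "\<exists>b. \<forall>x. norm (B x) \<le> b * norm x"
      using norm_R_le Li_le by (auto simp: B_def intro!: exI[of _ 2] intro: order_trans)
    show "B x = N x + C x" for x
      using Li_eq[of x] by (simp add: B_def N_def C_def flip: linear_add[OF R_linear])
    show "N x \<bullet> x \<le> 1 / l * (norm x)\<^sup>2" for x by (rule N_le)
    show "0 \<le> 1 / l" using l by simp
    show "\<exists>r::nat\<Rightarrow>nat. strict_mono r \<and> convergent (\<lambda>n. C (x (r n)))"
      if "bounded (range x)" for x :: "nat \<Rightarrow> 'a"
    proof -
      obtain b where "\<And>n. norm (x n) \<le> b"
        using \<open>bounded (range x)\<close> by (auto simp: bounded_iff)
      then have "norm (Li (x n)) \<le> 2 * b" for n
        using Li_le[of "x n"] by (smt (verit))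
      then have "bounded (range (\<lambda>n. Li (x n)))"
        by (auto simp: bounded_iff)
      then obtain r k where r: "strict_mono r" "(\<lambda>n. K (Li (x (r n)))) \<longlonglongrightarrow> k"
        using K_subseq by blast
      have "bounded_linear N"
      proof (rule bounded_linear_intro[where K = 1])
        show "norm (N x) \<le> norm x * 1" for x
          using norm_R_le[of "Si x"] Si_le[of x] by (simp add: N_def)
      qed (simp_all add: linear_add[OF N_linear] linear_scale[OF N_linear])
      from bounded_linear.tendsto[OF this r(2)] show ?thesis
        using r(1) by (auto simp: convergent_def C_def N_def)
    qed
  qed (rule N_linear)

  \<comment> \<open>The minimum keeps l - \<delta>' positive. The \<epsilon> below is then chosen so
    that the window above 1 / l ends at 1 / (l - \<delta>'), the image of \<mu> = -
    \<delta>'.\<close>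
  define \<delta>' where "\<delta>' = min \<delta> (l / 2)"
  have \<delta>': "0 < \<delta>'" "\<delta>' \<le> \<delta>" "\<delta>' < l" using \<open>0 < \<delta>\<close> l by (auto simp: \<delta>'_def min_def)
  define \<epsilon> where "\<epsilon> = 1 / (l - \<delta>') - 1 / l"
  have "0 < \<epsilon>" using \<delta>' by (simp add: \<epsilon>_def field_simps)
  have "\<exists>u. \<forall>a. (\<exists>i\<le>n. a i \<noteq> 0) \<longrightarrow>
      1 / l * (norm (\<Sum>i\<le>n::nat. a i *\<^sub>R u i))\<^sup>2 < B (\<Sum>i\<le>n. a i *\<^sub>R u i) \<bullet> (\<Sum>i\<le>n. a i *\<^sub>R u i)" for n
  proof -
    obtain f where f: "\<And>a. (\<exists>i\<le>n. a i \<noteq> 0) \<Longrightarrow>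
      (\<exists>F. F = (\<Sum>i\<le>n. a i *\<^sub>R f i) \<and> (F - R F - K F) \<bullet> R F < 0)"
      using trial[of n] by blast
    show ?thesis
    proof (intro exI[of _ "\<lambda>i. R (f i)"] allI impI)
      fix a :: "nat \<Rightarrow> real"
      assume "\<exists>i\<le>n. a i \<noteq> 0"
      define F where "F = (\<Sum>i\<le>n. a i *\<^sub>R f i)"
      have neg: "(F - R F - K F) \<bullet> R F < 0"
        using f[OF \<open>\<exists>i\<le>n. a i \<noteq> 0\<close>] by (simp add: F_def)
      define u where "u = R F"
      have u: "(\<Sum>i\<le>n. a i *\<^sub>R R (f i)) = u"
        by (simp add: u_def F_def linear_sum[OF R_linear] linear_scale[OF R_linear])
      have "u \<noteq> 0" using neg by (auto simp: u_def)
      then have pos: "0 < u \<bullet> u" by simp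
      have BLF: "B (L F) = u" by (simp add: B_def Li_L u_def)
      have "u \<bullet> L F = (F - R F - K F) \<bullet> R F + l * (u \<bullet> u)"
        by (simp add: L_def S_def shifted_def u_def inner_add inner_diff inner_commute algebra_simps)
      with neg have less: "u \<bullet> L F < l * (u \<bullet> u)" by simp
      \<comment> \<open>Since u = B (L F), Cauchy-Schwarz for the form of \<open>B\<close> converts
        the upper bound l |u|^2 on the form of H - V + l into the lower bound |u|^2 / l on the form
        of its inverse.\<close>
      have "(u \<bullet> u)\<^sup>2 \<le> (u \<bullet> L F) * (B u \<bullet> u)"
        using form_Cauchy_Schwarz[OF bnc.B_linear subspace_UNIV bnc.B_sym bnc.B_nonneg UNIV_I UNIV_I, of "L F" u]
        by (simp add: BLF)
      moreover have "0 < (u \<bullet> u)\<^sup>2" using pos by simp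
      ultimately have "0 < (u \<bullet> L F) * (B u \<bullet> u)" by linarith
      then have Bu: "0 < B u \<bullet> u" using bnc.B_nonneg[of u] by (cases "B u \<bullet> u = 0") auto
      have "(u \<bullet> u) * (u \<bullet> u) < (l * (B u \<bullet> u)) * (u \<bullet> u)"
        using \<open>(u \<bullet> u)\<^sup>2 \<le> _\<close> mult_strict_right_mono[OF less Bu]
        by (simp add: power2_eq_square mult_ac)
      then have "u \<bullet> u < l * (B u \<bullet> u)"
        using pos by (metis mult_less_cancel_right_pos)
      then have "1 / l * (norm u)\<^sup>2 < B u \<bullet> u"
        using l by (simp add: power2_norm_eq_inner field_simps)
      then show "1 / l * (norm (\<Sum>i\<le>n. a i *\<^sub>R R (f i)))\<^sup>2
          < B (\<Sum>i\<le>n. a i *\<^sub>R R (f i)) \<bullet> (\<Sum>i\<le>n. a i *\<^sub>R R (f i))"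
        by (simp add: u)
    qed
  qed
  from bnc.eigenvalues_accumulate[OF this \<open>0 < \<epsilon>\<close>] obtain \<sigma> x where
    \<sigma>: "1 / l < \<sigma>" "\<sigma> < 1 / l + \<epsilon>" and x: "x \<noteq> 0" "B x = \<sigma> *\<^sub>R x"
    by blast
  have "0 < 1 / l" using l by simp
  then have "0 < \<sigma>" using \<sigma> by linarith
  define G where "G = Li x"
  have RG: "R G = \<sigma> *\<^sub>R x" using x by (simp add: G_def B_def)
  have "L G = x" by (simp add: G_def L_Li)
  \<comment> \<open>With R G = \<sigma> x and L G = x this is the eigenvalue equation (H - V + l) (R
    G) = (1 / \<sigma>) R G.\<close>
  then have "L G = (1 / \<sigma>) *\<^sub>R R G"
    using RG \<open>0 < \<sigma>\<close> by simp
  then have "G - R G - K G = (1 / \<sigma> - l) *\<^sub>R R G"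
    by (simp add: L_def S_def shifted_def algebra_simps)
  moreover have "1 / \<sigma> - l < 0"
    using \<sigma> l \<open>0 < \<sigma>\<close> by (simp add: field_simps)
  moreover have "- \<delta> < 1 / \<sigma> - l"
  proof -
    have "\<sigma> < 1 / (l - \<delta>')" using \<sigma> by (simp add: \<epsilon>_def)
    then have "l - \<delta>' < 1 / \<sigma>"
      using \<open>0 < \<sigma>\<close> \<delta>' by (simp add: field_simps)
    then show ?thesis using \<delta>' by simp
  qed
  moreover have "R G \<noteq> 0" using RG x \<open>0 < \<sigma>\<close> by simp
  ultimately show ?thesis using that by blast
qed

end

subsection \<open>The Hilbert space of square integrable functions\<close>

text \<open>Preimages under the two functions differ by null sets, and Lebesgue measure is
  complete.\<close>

lemma borel_measurable_lebesgue_AE_cong: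
  fixes f g :: "'a::euclidean_space \<Rightarrow> 'b::topological_space"
  assumes "g \<in> borel_measurable lebesgue" "AE p in lebesgue. f p = g p"
  shows "f \<in> borel_measurable lebesgue"
proof (rule measurableI)
  fix A :: "'b set"
  assume "A \<in> sets borel"
  then have "g -` A \<inter> space lebesgue \<in> sets lebesgue"
    using assms(1) by (rule measurable_sets[rotated])
  then show "f -` A \<inter> space lebesgue \<in> sets lebesgue"
  proof (rule completion.in_sets_AE[rotated])
    show "AE p in lebesgue. p \<in> g -` A \<inter> space lebesgue \<longleftrightarrow> p \<in> f -` A \<inter> space lebesgue"
      using assms(2) by eventually_elim auto
  qed auto
qed auto

lemma square_integrable_rep: "square_integrable (rep_L2 F)"
  using Quotient3_rep_reflp[OF Quotient3_L2, of F] by (simp add: L2_rel_def)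

lemma L2_rel_refl: "square_integrable f \<Longrightarrow> L2_rel f f"
  by (simp add: L2_rel_def)

lemma represents_L2_rel:
  assumes "represents f F"
  shows "L2_rel f (rep_L2 F)"
proof -
  have AE: "AE p in lebesgue. f p = rep_L2 F p"
    using assms by (simp add: represents_def)
  note sq = square_integrable_rep[of F]
  then have meas: "f \<in> borel_measurable lebesgue"
    using borel_measurable_lebesgue_AE_cong AE by (auto simp: square_integrable_def)
  have "integrable lebesgue (\<lambda>p. (cmod (f p))\<^sup>2)"
  proof (rule integrable_cong_AE_imp)
    show "integrable lebesgue (\<lambda>p. (cmod (rep_L2 F p))\<^sup>2)"
      using sq by (simp add: square_integrable_def)
    show "AE p in lebesgue. (cmod (rep_L2 F p))\<^sup>2 = (cmod (f p))\<^sup>2"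
      using AE by eventually_elim simp
  qed (use meas in measurable)
  with meas sq AE show ?thesis
    by (simp add: L2_rel_def square_integrable_def)
qed

text \<open>The bridge between concrete functions and classes: the arithmetic of \<open>L2\<close>
  can be read off from the lifted definitions, independently of the representative picked by
  \<open>rep_L2\<close>.\<close>

lemma represents_iff: "represents f F \<longleftrightarrow> square_integrable f \<and> F = abs_L2 f"
proof
  assume "represents f F"
  then have "L2_rel f (rep_L2 F)"
    by (rule represents_L2_rel)
  then show "square_integrable f \<and> F = abs_L2 f"
    using Quotient3_rel_abs[OF Quotient3_L2, of f "rep_L2 F"]
    by (simp add: L2_rel_def Quotient3_abs_rep[OF Quotient3_L2])
next
  assume *: "square_integrable f \<and> F = abs_L2 f"
  then have "L2_rel (rep_L2 (abs_L2 f)) f"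
    by (intro rep_abs_rsp_left[OF Quotient3_L2] L2_rel_refl) auto
  with * show "represents f F"
    by (auto simp: represents_def L2_rel_def elim: eventually_mono)
qed

lemma represents_abs: "square_integrable f \<Longrightarrow> represents f (abs_L2 f)"
  by (simp add: represents_iff)

lemma represents_rep: "represents (rep_L2 F) F"
  by (simp add: represents_def)

lemma represents_unique: "represents f F \<Longrightarrow> represents f G \<Longrightarrow> F = G"
  by (simp add: represents_iff)

lemma represents_cong_AE:
  assumes "represents f F" "AE p in lebesgue. f p = g p"
  shows "represents g F"
  using assms unfolding represents_def by (auto elim: eventually_elim2)

lemma represents_0: "represents (\<lambda>p. 0) 0"
  using represents_abs[OF square_integrable_0] by (simp add: zero_L2_def)

lemma represents_add: "represents f F \<Longrightarrow> represents g G \<Longrightarrow> represents (\<lambda>p. f p + g p) (F + G)"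
  by (simp add: represents_iff square_integrable_add plus_L2.abs_eq L2_rel_refl)

lemma represents_diff: "represents f F \<Longrightarrow> represents g G \<Longrightarrow> represents (\<lambda>p. f p - g p) (F - G)"
  by (simp add: represents_iff square_integrable_diff minus_L2.abs_eq L2_rel_refl)

lemma represents_scaleR: "represents f F \<Longrightarrow> represents (\<lambda>p. c *\<^sub>R f p) (c *\<^sub>R F)"
  by (simp add: represents_iff square_integrable_scaleR scaleR_L2.abs_eq L2_rel_refl
      del: scaleR_conv_of_real)

lemma represents_sum:
  assumes "\<And>i. i \<in> I \<Longrightarrow> represents (f i) (F i)"
  shows "represents (\<lambda>p. \<Sum>i\<in>I. f i p) (\<Sum>i\<in>I. F i)"
  using assms
  by (induction I rule: infinite_finite_induct) (auto intro: represents_0 represents_add)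

lemma inner_represents:
  "represents f F \<Longrightarrow> represents g G \<Longrightarrow> F \<bullet> G = (\<integral>p. f p \<bullet> g p \<partial>lebesgue)"
  by (simp add: represents_iff inner_L2.abs_eq L2_rel_refl)

lemma represents_inner_integrable:
  "represents f F \<Longrightarrow> represents g G \<Longrightarrow> integrable lebesgue (\<lambda>p. f p \<bullet> g p)"
  by (simp add: represents_iff integrable_inner_square_integrable)

lemma norm_represents:
  "represents f F \<Longrightarrow> (norm F)\<^sup>2 = (\<integral>p. (cmod (f p))\<^sup>2 \<partial>lebesgue)"
  unfolding power2_norm_eq_inner by (rule inner_represents)

lemma nn_integral_represents:
  assumes "represents f F"
  shows "(\<integral>\<^sup>+p. ennreal ((cmod (f p))\<^sup>2) \<partial>lebesgue) = ennreal ((norm F)\<^sup>2)"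
  using assms
  by (subst nn_integral_eq_integral)
    (auto simp: norm_represents represents_iff square_integrable_def)

text \<open>Norm convergence means that the squared distances tend to 0 in L^1, which gives almost
  everywhere convergence along a subsequence.\<close>

lemma L2_AE_subseq:
  assumes "\<And>n. represents (f n) (F n)" "F \<longlonglongrightarrow> G" "represents g G"
  obtains r :: "nat \<Rightarrow> nat" where "strict_mono r" "AE p in lebesgue. (\<lambda>n. f (r n) p) \<longlonglongrightarrow> g p"
proof -
  have d: "represents (\<lambda>p. f n p - g p) (F n - G)" for n
    using assms by (intro represents_diff)
  have "\<exists>r::nat\<Rightarrow>nat. strict_mono r \<and> (AE p in lebesgue. (\<lambda>n. (cmod (f (r n) p - g p))\<^sup>2) \<longlonglongrightarrow> 0)"
  proof (rule tendsto_L1_AE_subseq)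
    show "integrable lebesgue (\<lambda>p. (cmod (f n p - g p))\<^sup>2)" for n
      using d by (auto simp: represents_iff square_integrable_def)
    have "(\<lambda>n. (norm (F n - G))\<^sup>2) \<longlonglongrightarrow> (norm (G - G))\<^sup>2"
      by (intro tendsto_intros assms)
    then show "(\<lambda>n. \<integral>p. norm ((cmod (f n p - g p))\<^sup>2) \<partial>lebesgue) \<longlonglongrightarrow> 0"
      by (simp add: norm_represents[OF d])
  qed
  then obtain r :: "nat \<Rightarrow> nat" where r: "strict_mono r"
      "AE p in lebesgue. (\<lambda>n. (cmod (f (r n) p - g p))\<^sup>2) \<longlonglongrightarrow> 0"
    by blast
  have "AE p in lebesgue. (\<lambda>n. f (r n) p) \<longlonglongrightarrow> g p"
    using r(2) by eventually_elim (simp add: tendsto_norm_zero_iff LIM_zero_iff)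
  with r(1) show ?thesis by (rule that)
qed

section \<open>Completeness\<close>

text \<open>The Riesz-Fischer argument: geometric decay of the increments gives pointwise
  convergence almost everywhere, and Fatou's lemma identifies the pointwise limit as the limit in
  norm.\<close>

lemma L2_fast_Cauchy_convergent:
  fixes F :: "nat \<Rightarrow> L2"
  assumes fast: "\<And>k m. k \<le> m \<Longrightarrow> norm (F m - F k) \<le> (1 / 4) ^ k"
  shows "convergent F"
proof -
  define f where "f k = rep_L2 (F k)" for k
  have f: "represents (f k) (F k)" for k
    by (simp add: f_def represents_rep)
  have [measurable]: "f k \<in> borel_measurable lebesgue" for k
    using square_integrable_rep[of "F k"] by (simp add: f_def square_integrable_def)
  define d where "d k p = (cmod (f (Suc k) p - f k p))\<^sup>2" for k p
  have [measurable]: "d k \<in> borel_measurable lebesgue" for k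
    unfolding d_def by measurable
  \<comment> \<open>The squared increments integrate to at most 16^-k. The weight 4^k leaves the
    summable 4^-k, yet it makes finiteness of the weighted sum at a point imply increments of order
    2^-k there.\<close>
  have "(\<integral>\<^sup>+p. ennreal (4 ^ k * d k p) \<partial>lebesgue) \<le> ennreal ((1 / 4) ^ k)" for k
  proof -
    have "(\<integral>\<^sup>+p. ennreal (4 ^ k * d k p) \<partial>lebesgue)
        = ennreal (4 ^ k) * (\<integral>\<^sup>+p. ennreal (d k p) \<partial>lebesgue)"
      by (subst nn_integral_cmult[symmetric]) (auto simp: ennreal_mult d_def)
    also have "(\<integral>\<^sup>+p. ennreal (d k p) \<partial>lebesgue) = ennreal ((norm (F (Suc k) - F k))\<^sup>2)"
      unfolding d_def by (intro nn_integral_represents represents_diff f)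
    also have "(norm (F (Suc k) - F k))\<^sup>2 \<le> ((1 / 4) ^ k)\<^sup>2"
      by (intro power_mono fast) auto
    then have "ennreal (4 ^ k) * ennreal ((norm (F (Suc k) - F k))\<^sup>2)
        \<le> ennreal (4 ^ k) * ennreal (((1 / 4) ^ k)\<^sup>2)"
      by (intro mult_left_mono ennreal_leI) auto
    also have "\<dots> = ennreal (4 ^ k * ((1 / 4) ^ k)\<^sup>2)"
      by (simp add: ennreal_mult)
    also have "4 ^ k * ((1 / 4) ^ k)\<^sup>2 = ((1 / 4) ^ k :: real)"
      by (simp add: power2_eq_square power_divide)
    finally show ?thesis .
  qed
  then have "(\<Sum>k. \<integral>\<^sup>+p. ennreal (4 ^ k * d k p) \<partial>lebesgue) \<le> (\<Sum>k. ennreal ((1 / 4) ^ k))"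
    by (intro suminf_le summableI)
  also have "\<dots> < \<infinity>"
    by (subst suminf_ennreal2) (auto intro: summable_geometric)
  finally have "(\<integral>\<^sup>+p. (\<Sum>k. ennreal (4 ^ k * d k p)) \<partial>lebesgue) \<noteq> \<infinity>"
    by (subst nn_integral_suminf) auto
  then have "AE p in lebesgue. (\<Sum>k. ennreal (4 ^ k * d k p)) \<noteq> \<infinity>"
    by (intro nn_integral_PInf_AE) auto
  then have conv: "AE p in lebesgue. convergent (\<lambda>k. f k p)"
  proof eventually_elim
    fix p
    assume fin: "(\<Sum>k. ennreal (4 ^ k * d k p)) \<noteq> \<infinity>"
    have "summable (\<lambda>k. 4 ^ k * d k p)"
      using fin by (intro summable_suminf_not_top) (auto simp: d_def)
    then have "(\<lambda>k. 4 ^ k * d k p) \<longlonglongrightarrow> 0"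
      by (rule summable_LIMSEQ_zero)
    then have "Bseq (\<lambda>k. 4 ^ k * d k p)"
      by (rule convergent_imp_Bseq[OF convergentI])
    then obtain M where M: "\<And>k. \<bar>4 ^ k * d k p\<bar> \<le> M"
      by (auto simp: Bseq_def)
    have le: "norm (f (Suc k) p - f k p) \<le> sqrt M * (1 / 2) ^ k" for k
    proof -
      have "(2 ^ k * norm (f (Suc k) p - f k p))\<^sup>2 \<le> M"
        using M[of k] by (simp add: d_def power_mult_distrib flip: power_mult)
          (simp add: power_mult mult.commute[of k 2])
      then have "2 ^ k * norm (f (Suc k) p - f k p) \<le> sqrt M"
        by (rule real_le_rsqrt)
      then show ?thesis by (simp add: field_simps)
    qed
    have "summable (\<lambda>k. sqrt M * (1 / 2) ^ k)"
      by (rule summable_mult, rule summable_geometric) simp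
    then have "summable (\<lambda>k. f (Suc k) p - f k p)"
      by (rule summable_comparison_test'[where N = 0]) (rule le)
    then have "convergent (\<lambda>n. \<Sum>k<n. f (Suc k) p - f k p)"
      by (simp add: summable_iff_convergent)
    then have "convergent (\<lambda>n. (\<Sum>k<n. f (Suc k) p - f k p) + f 0 p)"
      by (intro convergent_add convergent_const)
    then show "convergent (\<lambda>k. f k p)"
      by (simp add: sum_lessThan_telescope[of "\<lambda>k. f k p"])
  qed
  define g where "g p = lim (\<lambda>k. f k p)" for p
  have [measurable]: "g \<in> borel_measurable lebesgue"
    unfolding g_def by (intro borel_measurable_lim_metric) measurable
  have lim: "AE p in lebesgue. (\<lambda>k. f k p) \<longlonglongrightarrow> g p"
    using conv by eventually_elim (simp add: g_def convergent_LIMSEQ_iff)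
  have bound: "(\<integral>\<^sup>+p. ennreal ((cmod (g p - f k p))\<^sup>2) \<partial>lebesgue) \<le> ennreal (((1 / 4) ^ k)\<^sup>2)" for k
  proof -
    have "(\<integral>\<^sup>+p. ennreal ((cmod (g p - f k p))\<^sup>2) \<partial>lebesgue)
        = (\<integral>\<^sup>+p. liminf (\<lambda>m. ennreal ((cmod (f m p - f k p))\<^sup>2)) \<partial>lebesgue)"
    proof (rule nn_integral_cong_AE)
      show "AE p in lebesgue. ennreal ((cmod (g p - f k p))\<^sup>2)
          = liminf (\<lambda>m. ennreal ((cmod (f m p - f k p))\<^sup>2))"
        using lim
      proof eventually_elim
        fix p
        assume "(\<lambda>m. f m p) \<longlonglongrightarrow> g p"
        then have "(\<lambda>m. ennreal ((cmod (f m p - f k p))\<^sup>2)) \<longlonglongrightarrow> ennreal ((cmod (g p - f k p))\<^sup>2)"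
          by (intro tendsto_ennrealI tendsto_intros)
        then show "ennreal ((cmod (g p - f k p))\<^sup>2) = liminf (\<lambda>m. ennreal ((cmod (f m p - f k p))\<^sup>2))"
          by (rule lim_imp_Liminf[OF sequentially_bot, symmetric])
      qed
    qed
    also have "\<dots> \<le> liminf (\<lambda>m. \<integral>\<^sup>+p. ennreal ((cmod (f m p - f k p))\<^sup>2) \<partial>lebesgue)"
      by (rule nn_integral_liminf) measurable
    also have "\<dots> = liminf (\<lambda>m. ennreal ((norm (F m - F k))\<^sup>2))"
      by (simp add: nn_integral_represents[OF represents_diff[OF f f]])
    also have "\<dots> \<le> ennreal (((1 / 4) ^ k)\<^sup>2)"
    proof (rule Liminf_le)
      show "\<forall>\<^sub>F m in sequentially. ennreal ((norm (F m - F k))\<^sup>2) \<le> ennreal (((1 / 4) ^ k)\<^sup>2)"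
        using eventually_ge_at_top[of k]
        by eventually_elim (intro ennreal_leI power_mono fast, auto)
    qed simp
    finally show ?thesis .
  qed
  have "square_integrable (\<lambda>p. g p - f 0 p)"
    unfolding square_integrable_def
  proof (intro conjI integrableI_bounded)
    show "(\<integral>\<^sup>+p. ennreal (norm ((cmod (g p - f 0 p))\<^sup>2)) \<partial>lebesgue) < \<infinity>"
      using bound[of 0] by (simp add: order_le_less_trans)
  qed measurable
  from square_integrable_add[OF this, of "f 0"] have "square_integrable g"
    using f[of 0] by (simp add: represents_iff)
  then have g: "represents g (abs_L2 g)"
    by (rule represents_abs)
  have le: "norm (F k - abs_L2 g) \<le> (1 / 4) ^ k" for k
  proof (rule power2_le_imp_le)
    have "ennreal ((norm (abs_L2 g - F k))\<^sup>2) \<le> ennreal (((1 / 4) ^ k)\<^sup>2)"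
      using bound[of k] nn_integral_represents[OF represents_diff[OF g f]] by simp
    then show "(norm (F k - abs_L2 g))\<^sup>2 \<le> ((1 / 4) ^ k)\<^sup>2"
      by (subst (asm) ennreal_le_iff) (auto simp: norm_minus_commute)
  qed simp
  have "(\<lambda>k. F k - abs_L2 g) \<longlonglongrightarrow> 0"
    by (rule Lim_null_comparison[OF always_eventually[OF allI[OF le]]])
      (intro LIMSEQ_power_zero, simp)
  then show ?thesis
    by (auto simp: LIM_zero_iff convergent_def)
qed

text \<open>A Cauchy sequence converges once a subsequence does, so it is enough to extract one with
  increments below powers of 1/4.\<close>

instance L2 :: banach
proof
  fix X :: "nat \<Rightarrow> L2"
  assume X: "Cauchy X"
  define P where "P k n \<longleftrightarrow> (\<forall>m\<ge>n. norm (X m - X n) \<le> (1 / 4) ^ k)" for k n :: nat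
  have "\<exists>n>i. P k n" for k i
  proof -
    obtain M where M: "\<And>m n. M \<le> m \<Longrightarrow> M \<le> n \<Longrightarrow> norm (X m - X n) < (1 / 4) ^ k"
      using CauchyD[OF X, of "(1 / 4) ^ k"] by auto
    then show ?thesis
      unfolding P_def
      by (intro exI[of _ "max M (Suc i)"] conjI allI impI less_imp_le[OF M]) auto
  qed
  then have "\<exists>r. \<forall>k. P k (r k) \<and> r k < r (Suc k)"
    by (intro dependent_nat_choice) blast+
  then obtain r where r: "\<And>k. P k (r k)" "\<And>k. r k < r (Suc k)"
    by blast
  then have mono: "strict_mono r"
    by (simp add: strict_mono_Suc_iff)
  have "convergent (X \<circ> r)"
  proof (rule L2_fast_Cauchy_convergent)
    show "norm ((X \<circ> r) m - (X \<circ> r) k) \<le> (1 / 4) ^ k" if "k \<le> m" for k m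
      using r(1)[of k] that mono by (auto simp: P_def strict_mono_less_eq)
  qed
  then obtain L where L: "(X \<circ> r) \<longlonglongrightarrow> L"
    by (auto simp: convergent_def)
  show "convergent X"
    using Cauchy_converges_subseq[OF X mono L] by (auto simp: convergent_def)
qed

section \<open>Multiplication operators\<close>

lemma mult_op_sym:
  assumes "(F, VF) \<in> mult_op W" "(G, VG) \<in> mult_op W"
  shows "VF \<bullet> G = F \<bullet> VG"
proof -
  have "VF \<bullet> G = (\<integral>p. (of_real (W p) * rep_L2 F p) \<bullet> rep_L2 G p \<partial>lebesgue)"
    using assms by (intro inner_represents represents_rep) (simp add: mult_op_def)
  also have "\<dots> = (\<integral>p. rep_L2 F p \<bullet> (of_real (W p) * rep_L2 G p) \<partial>lebesgue)"
    by (simp flip: scaleR_conv_of_real)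
  also have "\<dots> = F \<bullet> VG"
    using assms by (intro inner_represents[symmetric] represents_rep) (simp add: mult_op_def)
  finally show ?thesis .
qed

text \<open>Two successive subsequences make both \<open>F n\<close> and \<open>W\<close> times
  \<open>F n\<close> converge almost everywhere. At each such point \<open>W p\<close> is a fixed
  finite number, so the second limit is 0. No bound on \<open>W\<close> is involved.\<close>

lemma mult_op_closable:
  assumes "\<And>n::nat. (F n, G n) \<in> mult_op W" "F \<longlonglongrightarrow> 0" "G \<longlonglongrightarrow> H"
  shows "H = 0"
proof -
  obtain r where r: "strict_mono r" "AE p in lebesgue. (\<lambda>n. rep_L2 (F (r n)) p) \<longlonglongrightarrow> 0"
    using L2_AE_subseq[OF represents_rep assms(2) represents_0] by metis
  have "represents (\<lambda>p. of_real (W p) * rep_L2 (F (r n)) p) (G (r n))" for n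
    using assms(1)[of "r n"] by (simp add: mult_op_def)
  moreover have "(\<lambda>n. G (r n)) \<longlonglongrightarrow> H"
    using LIMSEQ_subseq_LIMSEQ[OF assms(3) r(1)] by (simp add: o_def)
  ultimately obtain s where s: "strict_mono s"
      "AE p in lebesgue. (\<lambda>n. of_real (W p) * rep_L2 (F (r (s n))) p) \<longlonglongrightarrow> rep_L2 H p"
    using L2_AE_subseq[of "\<lambda>n p. of_real (W p) * rep_L2 (F (r n)) p" "\<lambda>n. G (r n)", OF _ _ represents_rep]
    by blast
  have "AE p in lebesgue. 0 = rep_L2 H p"
    using r(2) s(2)
  proof eventually_elim
    fix p
    assume *: "(\<lambda>n. rep_L2 (F (r n)) p) \<longlonglongrightarrow> 0"
      and **: "(\<lambda>n. of_real (W p) * rep_L2 (F (r (s n))) p) \<longlonglongrightarrow> rep_L2 H p"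
    have "(\<lambda>n. rep_L2 (F (r (s n))) p) \<longlonglongrightarrow> 0"
      using LIMSEQ_subseq_LIMSEQ[OF * s(1)] by (simp add: o_def)
    from tendsto_mult_right_zero[OF this] ** show "0 = rep_L2 H p"
      by (rule LIMSEQ_unique)
  qed
  then show ?thesis
    using represents_unique[OF represents_0, of H] by (simp add: represents_def)
qed

subsection \<open>Integration by parts\<close>

text \<open>Difference quotients along \<open>a\<close> have integral 0 by translation invariance,
  and the mean value theorem dominates them. Only the direction \<open>a\<close> is differentiated,
  so \<open>g\<close> may be merely measurable transversally, as it is after multiplication by a
  cutoff or the logarithm.\<close>

lemma integral_directional_derivative_eq_0:
  fixes g g' :: "'a::euclidean_space \<Rightarrow> real"
  assumes meas: "g \<in> borel_measurable borel"
    and deriv: "\<And>p. ((\<lambda>t. g (p + t *\<^sub>R a)) has_real_derivative g' p) (at 0)"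
    and g_bound: "\<And>p. \<bar>g p\<bar> \<le> B" and bound: "\<And>p. \<bar>g' p\<bar> \<le> B"
    and supp: "\<And>p. g p \<noteq> 0 \<Longrightarrow> norm p \<le> r"
  shows "g' \<in> borel_measurable borel" and "integrable lebesgue g'" and "(\<integral>p. g' p \<partial>lebesgue) = 0"
proof -
  note [measurable] = meas
  define h where "h n = inverse (real (Suc n))" for n
  have h: "0 < h n" "h n \<le> 1" for n
    by (auto simp: h_def field_simps)
  have h_lim: "h \<longlonglongrightarrow> 0"
    unfolding h_def by (rule LIMSEQ_inverse_real_of_nat)
  define q where "q n p = (g (p + h n *\<^sub>R a) - g p) / h n" for n p
  have [measurable]: "q n \<in> borel_measurable borel" for n
    unfolding q_def by measurable
  have q_lim: "(\<lambda>n. q n p) \<longlonglongrightarrow> g' p" for p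
  proof -
    have "((\<lambda>t. (g (p + t *\<^sub>R a) - g p) / t) \<longlongrightarrow> g' p) (at 0)"
      using deriv[of p] by (simp add: has_field_derivative_iff)
    moreover have "filterlim h (at 0) sequentially"
      using h_lim h(1) by (auto simp: filterlim_at intro!: always_eventually) (metis less_irrefl)
    ultimately show ?thesis
      unfolding q_def by (rule filterlim_compose)
  qed
  then show g'_meas [measurable]: "g' \<in> borel_measurable borel"
    by (rule borel_measurable_LIMSEQ_real) measurable
  \<comment> \<open>The steps satisfy h n <= 1, so all difference quotients live in the ball of
    radius r + |a|.\<close>
  define w where "w p = B * indicator (cball 0 (r + norm a)) p" for p :: 'a
  have "0 \<le> B" using bound[of 0] by linarith
  have deriv': "((\<lambda>s. g (p + s *\<^sub>R a)) has_real_derivative g' (p + t *\<^sub>R a)) (at t)" for p t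
    using deriv[of "p + t *\<^sub>R a"] DERIV_shift[of "\<lambda>s. g (p + s *\<^sub>R a)" "g' (p + t *\<^sub>R a)" 0 t]
    by (simp add: algebra_simps)
  have q_bound: "norm (q n p) \<le> w p" for n p
  proof (cases "norm p \<le> r + norm a")
    case True
    obtain z where "g (p + h n *\<^sub>R a) - g (p + 0 *\<^sub>R a) = (h n - 0) * g' (p + z *\<^sub>R a)"
      using MVT2[OF h(1)[of n], of "\<lambda>s. g (p + s *\<^sub>R a)" "\<lambda>t. g' (p + t *\<^sub>R a)"] deriv' by blast
    then have "q n p = g' (p + z *\<^sub>R a)"
      using h(1)[of n] by (simp add: q_def)
    then show ?thesis
      using True bound by (simp add: w_def)
  next
    case False
    have "norm p - norm a \<le> norm (p + h n *\<^sub>R a)"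
    proof -
      have "norm (h n *\<^sub>R a) \<le> 1 * norm a"
        unfolding norm_scaleR using h[of n] by (intro mult_right_mono) auto
      then show ?thesis using norm_diff_ineq[of p "h n *\<^sub>R a"] by simp
    qed
    then have "g (p + h n *\<^sub>R a) = 0" "g p = 0"
      using False supp[of p] supp[of "p + h n *\<^sub>R a"] norm_ge_zero[of a] by force+
    then show ?thesis
      using \<open>0 \<le> B\<close> by (simp add: q_def w_def)
  qed
  have "emeasure lborel (cball (0 :: 'a) (r + norm a)) < top"
    using emeasure_bounded_finite[OF bounded_cball] by (metis infinity_ennreal_def)
  then have w: "integrable lborel w"
    unfolding w_def by (intro integrable_mult_right integrable_real_indicator)
      simp_all
  have g_int: "integrable lborel g"
  proof (rule Bochner_Integration.integrable_bound[OF w])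
    show "AE p in lborel. norm (g p) \<le> norm (w p)"
    proof (intro AE_I2)
      show "norm (g p) \<le> norm (w p)" for p
      proof (cases "g p = 0")
        case False
        then have "norm p \<le> r + norm a" using supp[of p] norm_ge_zero[of a] by linarith
        then show ?thesis using g_bound[of p] by (simp add: w_def)
      qed simp
    qed
  qed measurable
  have int_q: "(\<integral>p. q n p \<partial>lborel) = 0" for n
  proof -
    have "integrable lborel (\<lambda>p. g (h n *\<^sub>R a + p))"
      using g_int integrable_distr_eq[of "(+) (h n *\<^sub>R a)" lborel borel g]
      by (simp add: lborel_distr_plus)
    moreover have "(\<integral>p. g (h n *\<^sub>R a + p) \<partial>lborel) = (\<integral>p. g p \<partial>lborel)"
      using integral_distr[of "(+) (h n *\<^sub>R a)" lborel borel g]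
      by (simp add: lborel_distr_plus)
    ultimately show ?thesis
      using g_int by (simp add: q_def add.commute[of _ "h n *\<^sub>R a"])
  qed
  have dom: "integrable lborel g'"
    by (rule integrable_dominated_convergence[where s = q and w = w])
      (use w q_lim q_bound in simp_all)
  have "(\<lambda>n. \<integral>p. q n p \<partial>lborel) \<longlonglongrightarrow> (\<integral>p. g' p \<partial>lborel)"
    by (rule integral_dominated_convergence[where w = w])
      (use w q_lim q_bound in simp_all)
  then have "(\<integral>p. g' p \<partial>lborel) = 0"
    by (simp add: int_q LIMSEQ_const_iff)
  then show "(\<integral>p. g' p \<partial>lebesgue) = 0"
    by (simp add: integral_completion)
  from dom show "integrable lebesgue g'"
    by (simp add: integrable_completion)
qed

lemma has_partial_deriv:
  assumes "u differentiable_on UNIV"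
  shows "((\<lambda>t. u (p + t *\<^sub>R axis j 1)) has_vector_derivative partial_deriv j u p) (at 0)"
proof -
  have "u differentiable (at (p + 0 *\<^sub>R axis j 1))"
    using assms by (simp add: differentiable_on_def)
  moreover have "(\<lambda>t::real. p + t *\<^sub>R axis j 1) differentiable (at 0)"
    by (intro derivative_intros)
  ultimately have "(u \<circ> (\<lambda>t. p + t *\<^sub>R axis j 1)) differentiable (at 0)"
    by (intro differentiable_chain_at)
  then show ?thesis
    unfolding partial_deriv_def by (simp add: vector_derivative_works o_def)
qed

lemma partial_deriv_eqI:
  "((\<lambda>t. u (p + t *\<^sub>R axis j 1)) has_vector_derivative D) (at 0) \<Longrightarrow> partial_deriv j u p = D"
  unfolding partial_deriv_def by (rule vector_derivative_at)

lemma partial_deriv_eq_0: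
  assumes "open S" "p \<in> S" "\<And>q. q \<in> S \<Longrightarrow> u q = 0"
  shows "partial_deriv j u p = 0"
proof (rule partial_deriv_eqI)
  have "((\<lambda>t::real. p + t *\<^sub>R axis j 1) \<longlongrightarrow> p + 0 *\<^sub>R axis j 1) (at 0)"
    by (intro tendsto_intros)
  then have "eventually (\<lambda>t::real. p + t *\<^sub>R axis j 1 \<in> S) (at 0)"
    using assms by (intro topological_tendstoD) auto
  then have "eventually (\<lambda>t::real. 0 = u (p + t *\<^sub>R axis j 1)) (at 0)"
    by eventually_elim (simp add: assms)
  moreover have "u p = 0" using assms by blast
  ultimately show "((\<lambda>t. u (p + t *\<^sub>R axis j 1)) has_vector_derivative 0) (at 0)"
    unfolding has_vector_derivative_def
    by (intro has_derivative_transform_eventually[OF has_vector_derivative_const[unfolded has_vector_derivative_def]]) auto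
qed

section \<open>The magnetic Laplacian on test functions\<close>

definition ln_radius :: "real ^ 3 \<Rightarrow> real" where
  "ln_radius p = ln (sqrt ((p $ 1)\<^sup>2 + (p $ 2)\<^sup>2))"

lemma A_pot_nth: "A_pot p $ 1 = 0" "A_pot p $ 2 = 0" "A_pot p $ 3 = ln_radius p"
  by (simp_all add: A_pot_def ln_radius_def)

lemma ln_radius_shift: "ln_radius (p + t *\<^sub>R axis 3 1) = ln_radius p"
  by (simp add: ln_radius_def axis_def)

text \<open>The logarithm is constant along the third axis, so the square of D_z - log r expands
  without differentiating it. The identity therefore holds at every point, including the axis r =
  0.\<close>

lemma magnetic_laplacian_expand:
  assumes "Ck 2 u"
  shows "magnetic_laplacian A_pot u p =
    - partial_deriv 1 (partial_deriv 1 u) p - partial_deriv 2 (partial_deriv 2 u) p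
    - partial_deriv 3 (partial_deriv 3 u) p + 2 * \<i> * of_real (ln_radius p) * partial_deriv 3 u p
    + (of_real (ln_radius p))\<^sup>2 * u p"
proof -
  from assms have u: "u differentiable_on UNIV" "\<And>j. partial_deriv j u differentiable_on UNIV"
    by (simp_all add: numeral_2_eq_2)
  have 12: "magnetic_momentum A_pot j (magnetic_momentum A_pot j u) p
      = - partial_deriv j (partial_deriv j u) p" if "j = 1 \<or> j = 2" for j
  proof -
    have mm: "magnetic_momentum A_pot j u q = - \<i> * partial_deriv j u q" for u q
      using that by (auto simp: magnetic_momentum_def A_pot_nth)
    have "partial_deriv j (\<lambda>q. - \<i> * partial_deriv j u q) p = - \<i> * partial_deriv j (partial_deriv j u) p"
      by (intro partial_deriv_eqI has_vector_derivative_mult_right has_partial_deriv u)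
    then show ?thesis
      by (simp add: mm[abs_def])
  qed
  have mm: "magnetic_momentum A_pot 3 w q = - \<i> * partial_deriv 3 w q - of_real (ln_radius q) * w q" for w q
    by (simp add: magnetic_momentum_def A_pot_nth)
  have "partial_deriv 3 (\<lambda>q. - \<i> * partial_deriv 3 u q - of_real (ln_radius q) * u q) p
      = - \<i> * partial_deriv 3 (partial_deriv 3 u) p - of_real (ln_radius p) * partial_deriv 3 u p"
    by (intro partial_deriv_eqI, unfold ln_radius_shift)
      (intro has_vector_derivative_diff has_vector_derivative_mult_right has_partial_deriv u)
  then have eq: "partial_deriv 3 (magnetic_momentum A_pot 3 u) p
      = - \<i> * partial_deriv 3 (partial_deriv 3 u) p - of_real (ln_radius p) * partial_deriv 3 u p"
    by (simp add: mm[of u, abs_def])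
  have "magnetic_momentum A_pot 3 (magnetic_momentum A_pot 3 u) p
      = - partial_deriv 3 (partial_deriv 3 u) p + 2 * \<i> * of_real (ln_radius p) * partial_deriv 3 u p
        + (of_real (ln_radius p))\<^sup>2 * u p"
    unfolding mm[of "magnetic_momentum A_pot 3 u" p] eq mm[of u p]
    by (simp add: algebra_simps power2_eq_square)
  then show ?thesis
    by (simp add: magnetic_laplacian_def sum_3 12)
qed

lemma test_function_bounded:
  assumes "test_function u"
  obtains r where "0 \<le> r" "\<And>p. u p \<noteq> 0 \<Longrightarrow> norm p \<le> r"
    "\<And>j p. partial_deriv j u p \<noteq> 0 \<Longrightarrow> norm p \<le> r"
    "\<And>j k p. partial_deriv j (partial_deriv k u) p \<noteq> 0 \<Longrightarrow> norm p \<le> r"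
proof -
  have "bounded (closure {p. u p \<noteq> 0})"
    using assms by (auto simp: test_function_def intro: compact_imp_bounded)
  then have "bounded {p. u p \<noteq> 0}"
    by (rule bounded_subset[OF _ closure_subset])
  then obtain r where "\<forall>p. u p \<noteq> 0 \<longrightarrow> norm p \<le> r"
    by (auto simp: bounded_iff)
  then have r: "\<And>p. u p \<noteq> 0 \<Longrightarrow> norm p \<le> max r 0"
    by (blast intro: max.coboundedI1)
  define S where "S = {p :: real ^ 3. max r 0 < norm p}"
  have S: "open S"
    unfolding S_def by (intro open_Collect_less continuous_intros)
  have u0: "u p = 0" if "p \<in> S" for p
    using r[of p] that by (metis S_def mem_Collect_eq not_le)
  have u1: "partial_deriv j u p = 0" if "p \<in> S" for j p
    using partial_deriv_eq_0[OF S that u0] .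
  have u2: "partial_deriv j (partial_deriv k u) p = 0" if "p \<in> S" for j k p
    using partial_deriv_eq_0[OF S that u1] .
  show ?thesis
  proof (rule that[of "max r 0"])
    show "norm p \<le> max r 0" if "partial_deriv j u p \<noteq> 0" for j p
      using u1[of p j] that by (metis S_def mem_Collect_eq not_le)
    show "norm p \<le> max r 0" if "partial_deriv j (partial_deriv k u) p \<noteq> 0" for j k p
      using u2[of p j k] that by (metis S_def mem_Collect_eq not_le)
  qed (use r in auto)
qed

lemma test_function_Ck: "test_function u \<Longrightarrow> Ck k u"
  by (simp add: test_function_def)

lemma continuous_bounded_support:
  fixes f :: "'a::euclidean_space \<Rightarrow> 'b::real_normed_vector"
  assumes "continuous_on UNIV f" "\<And>p. f p \<noteq> 0 \<Longrightarrow> norm p \<le> r"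
  obtains B where "0 \<le> B" "\<And>p. norm (f p) \<le> B"
proof -
  have "compact (f ` cball 0 r)"
    using assms(1) by (intro compact_continuous_image) (auto intro: continuous_on_subset)
  then obtain B where B: "\<forall>p\<in>cball 0 r. norm (f p) \<le> B"
    using compact_imp_bounded[of "f ` cball 0 r"] by (auto simp: bounded_iff)
  have "norm (f p) \<le> max B 0" for p
    using B assms(2)[of p] by (cases "f p = 0") (auto intro: max.coboundedI1)
  then show ?thesis by (intro that[of "max B 0"]) auto
qed

text \<open>By the product rule the integrand is the j-th derivative of c (u, v), since
  \<open>c\<close> does not depend on the j-th coordinate. Boundedness of \<open>c\<close> is asked
  only on a ball that carries \<open>u\<close>.\<close>

lemma integral_partial_deriv_flux:
  fixes u v :: "real ^ 3 \<Rightarrow> complex"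
  assumes u: "Ck 1 u" and v: "Ck 1 v"
    and supp: "\<And>p. u p \<noteq> 0 \<Longrightarrow> norm p \<le> r" "\<And>p. partial_deriv j u p \<noteq> 0 \<Longrightarrow> norm p \<le> r"
    and c_meas: "c \<in> borel_measurable borel"
    and c_bound: "\<And>p. norm p \<le> r \<Longrightarrow> \<bar>c p\<bar> \<le> b"
    and c_shift: "\<And>p t. c (p + t *\<^sub>R axis j 1) = c p"
  shows "integrable lebesgue (\<lambda>p. c p * (partial_deriv j u p \<bullet> v p + u p \<bullet> partial_deriv j v p))"
    and "(\<integral>p. c p * (partial_deriv j u p \<bullet> v p + u p \<bullet> partial_deriv j v p) \<partial>lebesgue) = 0"
proof -
  from u v have diff: "u differentiable_on UNIV" "v differentiable_on UNIV"
    and cont: "continuous_on UNIV (partial_deriv j u)" "continuous_on UNIV (partial_deriv j v)"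
    by auto
  note cont' = diff[THEN differentiable_imp_continuous_on]
  define g where "g p = u p \<bullet> v p" for p
  define g' where "g' p = partial_deriv j u p \<bullet> v p + u p \<bullet> partial_deriv j v p" for p
  have g: "continuous_on UNIV g" "continuous_on UNIV g'"
    unfolding g_def g'_def by (intro continuous_intros cont cont')+
  have supp_g: "norm p \<le> r" if "g p \<noteq> 0" for p
    using that by (intro supp(1)) (auto simp: g_def)
  have supp_g': "norm p \<le> r" if "g' p \<noteq> 0" for p
  proof (cases "u p = 0")
    case True
    with that have "partial_deriv j u p \<noteq> 0" by (auto simp: g'_def)
    then show ?thesis by (rule supp(2))
  qed (rule supp(1))
  obtain B1 where B1: "0 \<le> B1" "\<And>p. norm (g p) \<le> B1"
    using continuous_bounded_support[OF g(1) supp_g] by blast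
  obtain B2 where B2: "0 \<le> B2" "\<And>p. norm (g' p) \<le> B2"
    using continuous_bounded_support[OF g(2) supp_g'] by blast
  define B where "B = \<bar>b\<bar> * max B1 B2"
  have cB: "\<bar>c p * x\<bar> \<le> B" if "x \<noteq> 0 \<Longrightarrow> norm p \<le> r" "\<bar>x\<bar> \<le> max B1 B2" for p x
  proof (cases "x = 0")
    case False
    then have "\<bar>c p\<bar> \<le> \<bar>b\<bar>" using c_bound[of p] that by linarith
    then show ?thesis
      unfolding B_def abs_mult using that(2) by (intro mult_mono) auto
  qed (use B1 in \<open>auto simp: B_def\<close>)
  have deriv: "((\<lambda>t. c (p + t *\<^sub>R axis j 1) * g (p + t *\<^sub>R axis j 1)) has_real_derivative c p * g' p) (at 0)" for p
  proof -
    have "((\<lambda>t. u (p + t *\<^sub>R axis j 1) \<bullet> v (p + t *\<^sub>R axis j 1)) has_vector_derivative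
        (u (p + 0 *\<^sub>R axis j 1) \<bullet> partial_deriv j v p + partial_deriv j u p \<bullet> v (p + 0 *\<^sub>R axis j 1))) (at 0)"
      by (rule bounded_bilinear.has_vector_derivative[OF bounded_bilinear_inner])
        (intro has_partial_deriv diff)+
    then have "((\<lambda>t. g (p + t *\<^sub>R axis j 1)) has_real_derivative g' p) (at 0)"
      by (simp add: g_def g'_def has_real_derivative_iff_has_vector_derivative add.commute)
    then show ?thesis
      unfolding c_shift by (rule DERIV_cmult)
  qed
  have "(\<lambda>p. c p * g p) \<in> borel_measurable borel"
    using c_meas borel_measurable_continuous_onI[OF g(1)] by measurable
  note * = integral_directional_derivative_eq_0[where g = "\<lambda>p. c p * g p" and g' = "\<lambda>p. c p * g' p"
      and a = "axis j 1" and B = B and r = r, OF this deriv]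
  have 1: "\<bar>c p * g p\<bar> \<le> B" for p
    using supp_g B1(2)[of p] by (intro cB) auto
  have 2: "\<bar>c p * g' p\<bar> \<le> B" for p
    using supp_g' B2(2)[of p] by (intro cB) auto
  have 3: "norm p \<le> r" if "c p * g p \<noteq> 0" for p
    using that supp_g by auto
  show "integrable lebesgue (\<lambda>p. c p * (partial_deriv j u p \<bullet> v p + u p \<bullet> partial_deriv j v p))"
    using *(2)[OF 1 2 3] by (simp add: g'_def)
  show "(\<integral>p. c p * (partial_deriv j u p \<bullet> v p + u p \<bullet> partial_deriv j v p) \<partial>lebesgue) = 0"
    using *(3)[OF 1 2 3] by (simp add: g'_def)
qed


text \<open>The inequality ln t <= t - 1, used for the radius and for its inverse, controls the
  logarithm off a slab around the plane where the first coordinate vanishes.\<close>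

lemma ln_radius_bound:
  assumes "norm p \<le> r" "\<epsilon> < \<bar>p $ 1\<bar>" "0 < \<epsilon>"
  shows "\<bar>ln_radius p\<bar> \<le> r + inverse \<epsilon>"
proof -
  define s where "s = sqrt ((p $ 1)\<^sup>2 + (p $ 2)\<^sup>2)"
  have "sqrt ((p $ 1)\<^sup>2) \<le> s"
    unfolding s_def by (intro real_sqrt_le_mono) simp
  then have s1: "\<epsilon> < s" using assms by simp
  have "s \<le> norm p"
    unfolding s_def norm_eq_sqrt_inner
    by (intro real_sqrt_le_mono) (simp add: inner_vec_def sum_3 power2_eq_square)
  then have s2: "s \<le> r" using assms by simp
  have "ln s \<le> s - 1" "ln (inverse s) \<le> inverse s - 1"
    using s1 assms by (auto intro!: ln_le_minus_one)
  moreover have "inverse s \<le> inverse \<epsilon>"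
    using s1 assms by (intro le_imp_inverse_le) auto
  moreover have "0 < inverse \<epsilon>" "0 < s" using assms s1 by auto
  moreover have "ln (inverse s) = - ln s" by (rule ln_inverse)
  ultimately show ?thesis
    using s2 unfolding ln_radius_def s_def[symmetric] abs_le_iff by linarith
qed

lemma ln_radius_measurable [measurable]: "ln_radius \<in> borel_measurable borel"
  unfolding ln_radius_def[abs_def] by measurable

lemma test_function_differentiable:
  assumes "test_function u"
  shows "u differentiable_on UNIV" "partial_deriv j u differentiable_on UNIV"
    "partial_deriv k (partial_deriv j u) differentiable_on UNIV"
  using test_function_Ck[OF assms, of 3] by (simp_all add: numeral_3_eq_3)

text \<open>
  The logarithm is unbounded near the axis, but it is independent of the third coordinate.  Hence a
  cutoff in the first coordinate does not disturb the integration by parts along the axis.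
\<close>

lemma magnetic_laplacian_symmetric:
  assumes u: "test_function u" and v: "test_function v"
    and int: "integrable lebesgue (\<lambda>p. magnetic_laplacian A_pot u p \<bullet> v p)"
      "integrable lebesgue (\<lambda>p. u p \<bullet> magnetic_laplacian A_pot v p)"
  shows "(\<integral>p. magnetic_laplacian A_pot u p \<bullet> v p \<partial>lebesgue)
    = (\<integral>p. u p \<bullet> magnetic_laplacian A_pot v p \<partial>lebesgue)"
proof -
  obtain r where r: "0 \<le> r" "\<And>p. u p \<noteq> 0 \<Longrightarrow> norm p \<le> r"
      "\<And>j p. partial_deriv j u p \<noteq> 0 \<Longrightarrow> norm p \<le> r"
      "\<And>j k p. partial_deriv j (partial_deriv k u) p \<noteq> 0 \<Longrightarrow> norm p \<le> r"
    using test_function_bounded[OF u] by metis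
  have C1: "Ck 1 u" "Ck 1 v" "Ck 1 (partial_deriv j u)" "Ck 1 (partial_deriv j v)" for j
    using test_function_Ck[OF u, of 1] test_function_Ck[OF v, of 1]
      test_function_Ck[OF u, of "Suc 1"] test_function_Ck[OF v, of "Suc 1"] by simp_all
  define J where "J j p = u p \<bullet> partial_deriv j (partial_deriv j v) p - partial_deriv j (partial_deriv j u) p \<bullet> v p"
    for j p
  define M where "M p = 2 * ln_radius p * ((\<i> * partial_deriv 3 u p) \<bullet> v p + (\<i> * u p) \<bullet> partial_deriv 3 v p)" for p
  have J: "integrable lebesgue (\<lambda>p. c p * J j p)" "(\<integral>p. c p * J j p \<partial>lebesgue) = 0"
    if c: "c \<in> borel_measurable borel" "\<And>p. norm p \<le> r \<Longrightarrow> \<bar>c p\<bar> \<le> b"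
      "\<And>p t. c (p + t *\<^sub>R axis j 1) = c p" for c b j
  proof -
    note 1 = integral_partial_deriv_flux[OF C1(1) C1(4) r(2) r(3) c]
    note 2 = integral_partial_deriv_flux[OF C1(3) C1(2) r(3) r(4) c]
    have eq: "c p * J j p = c p * (partial_deriv j u p \<bullet> partial_deriv j v p + u p \<bullet> partial_deriv j (partial_deriv j v) p)
        - c p * (partial_deriv j (partial_deriv j u) p \<bullet> v p + partial_deriv j u p \<bullet> partial_deriv j v p)" for p
      by (simp add: J_def algebra_simps)
    show "integrable lebesgue (\<lambda>p. c p * J j p)" "(\<integral>p. c p * J j p \<partial>lebesgue) = 0"
      unfolding eq using 1 2 by simp_all
  qed
  have iu: "Ck 1 (\<lambda>p. \<i> * u p)" "partial_deriv j (\<lambda>p. \<i> * u p) = (\<lambda>p. \<i> * partial_deriv j u p)" for j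
  proof -
    show 1: "partial_deriv j (\<lambda>p. \<i> * u p) = (\<lambda>p. \<i> * partial_deriv j u p)" for j
      by (intro ext partial_deriv_eqI has_vector_derivative_mult_right has_partial_deriv
          test_function_differentiable u)
    show "Ck 1 (\<lambda>p. \<i> * u p)"
      using test_function_differentiable[OF u]
      by (auto simp: 1 intro!: differentiable_on_mult differentiable_on_const continuous_intros
          differentiable_imp_continuous_on)
  qed
  \<comment> \<open>The removed slabs contain the axis and shrink to a null set. Where
    \<open>cut n\<close> is nonzero, the logarithm is bounded on the support of
    \<open>u\<close>.\<close>
  define cut where "cut n = indicat_real {p :: real ^ 3. inverse (real (Suc n)) < \<bar>p $ 1\<bar>}" for n
  have cut_meas [measurable]: "cut n \<in> borel_measurable borel" for n
    unfolding cut_def by measurable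
  have cut_shift: "cut n (p + t *\<^sub>R axis 3 1) = cut n p" for n p t
    by (simp add: cut_def indicator_def axis_def)
  have cut_le: "\<bar>cut n p\<bar> \<le> 1" for n p
    by (simp add: cut_def indicator_def)
  have cut_M: "integrable lebesgue (\<lambda>p. cut n p * M p)" "(\<integral>p. cut n p * M p \<partial>lebesgue) = 0" for n
  proof -
    have "\<bar>cut n p * (2 * ln_radius p)\<bar> \<le> 2 * (r + Suc n)" if "norm p \<le> r" for p
      using ln_radius_bound[OF that, of "inverse (real (Suc n))"] r(1) by (auto simp: cut_def indicator_def)
    note * = integral_partial_deriv_flux[OF iu(1) C1(2) _ _ _ this, where j = 3]
    have eq: "cut n p * M p = (cut n p * (2 * ln_radius p)) * (partial_deriv 3 (\<lambda>p. \<i> * u p) p \<bullet> v p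
        + (\<i> * u p) \<bullet> partial_deriv 3 v p)" for p
      by (simp add: M_def iu)
    show "integrable lebesgue (\<lambda>p. cut n p * M p)" "(\<integral>p. cut n p * M p \<partial>lebesgue) = 0"
      unfolding eq by (rule *; use r in \<open>simp add: iu cut_shift ln_radius_shift\<close>)+
  qed
  define d where "d p = magnetic_laplacian A_pot u p \<bullet> v p - u p \<bullet> magnetic_laplacian A_pot v p" for p
  have d_eq: "d p = J 1 p + J 2 p + J 3 p + M p" for p
    unfolding d_def J_def M_def magnetic_laplacian_expand[OF test_function_Ck[OF u]]
      magnetic_laplacian_expand[OF test_function_Ck[OF v]]
    by (simp add: inner_complex_def power2_eq_square algebra_simps)
  have d_int: "integrable lebesgue d"
    unfolding d_def using int by simp
  have J12: "integrable lebesgue (J j)" "(\<integral>p. J j p \<partial>lebesgue) = 0" for j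
    using J[of "\<lambda>_. 1" 1 j] by simp_all
  \<comment> \<open>Only the terms in the third direction tolerate the cutoff, which depends on the
    first coordinate. Integrability of their sum \<open>T\<close> comes from that of
    \<open>d\<close>, not from a separate estimate of the logarithmic term, and it is what provides
    the dominating function.\<close>
  define T where "T p = J 3 p + M p" for p
  have T_eq: "T p = d p - J 1 p - J 2 p" for p
    by (simp add: T_def d_eq)
  have T_int: "integrable lebesgue T"
    unfolding T_eq[abs_def] using d_int J12 by simp
  have cut_T: "(\<integral>p. cut n p * T p \<partial>lebesgue) = 0" for n
    using J[OF cut_meas cut_le cut_shift, of n] cut_M[of n] by (simp add: T_def distrib_left)
  have "(\<lambda>n. \<integral>p. cut n p * T p \<partial>lebesgue) \<longlonglongrightarrow> (\<integral>p. T p \<partial>lebesgue)"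
  proof (rule integral_dominated_convergence)
    show "integrable lebesgue (\<lambda>p. norm (T p))" using T_int by simp
    show "AE p in lebesgue. norm (cut n p * T p) \<le> norm (T p)" for n
      by (intro AE_I2) (simp add: cut_def indicator_def)
    show "(\<lambda>p. cut n p * T p) \<in> borel_measurable lebesgue" for n
      by (intro borel_measurable_times borel_measurable_integrable[OF T_int] measurable_completion)
        (simp add: cut_meas)
    have "negligible {p :: real ^ 3. p $ 1 = 0}"
      by (rule negligible_standard_hyperplane_cart)
    then have "AE p :: real ^ 3 in lebesgue. p $ 1 \<noteq> 0"
      by (intro AE_I'[of "{p. p $ 1 = 0}"]) (auto simp: negligible_iff_null_sets)
    then show "AE p in lebesgue. (\<lambda>n. cut n p * T p) \<longlonglongrightarrow> T p"
    proof eventually_elim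
      fix p :: "real ^ 3"
      assume "p $ 1 \<noteq> 0"
      then have "eventually (\<lambda>n. inverse (real (Suc n)) < \<bar>p $ 1\<bar>) sequentially"
        by (intro order_tendstoD(2)[OF LIMSEQ_inverse_real_of_nat]) simp
      then have "eventually (\<lambda>n. cut n p * T p = T p) sequentially"
        by eventually_elim (simp add: cut_def)
      then show "(\<lambda>n. cut n p * T p) \<longlonglongrightarrow> T p"
        by (rule tendsto_eventually)
    qed
  qed (use T_int in auto)
  then have "(\<integral>p. T p \<partial>lebesgue) = 0"
    by (simp add: cut_T LIMSEQ_const_iff)
  then have "(\<integral>p. d p \<partial>lebesgue) = 0"
    unfolding T_eq using d_int J12 by simp
  then show ?thesis
    unfolding d_def using int by simp
qed

text \<open>Adding the three exact derivatives \<open>J\<close>, which integrate to 0, makes the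
  integrand a pointwise sum of squares. The logarithm itself is never integrated by parts, so this
  needs no cutoff.\<close>

lemma magnetic_laplacian_nonneg:
  assumes u: "test_function u" and int: "integrable lebesgue (\<lambda>p. magnetic_laplacian A_pot u p \<bullet> u p)"
  shows "0 \<le> (\<integral>p. magnetic_laplacian A_pot u p \<bullet> u p \<partial>lebesgue)"
proof -
  obtain r where r: "0 \<le> r" "\<And>p. u p \<noteq> 0 \<Longrightarrow> norm p \<le> r"
      "\<And>j p. partial_deriv j u p \<noteq> 0 \<Longrightarrow> norm p \<le> r"
      "\<And>j k p. partial_deriv j (partial_deriv k u) p \<noteq> 0 \<Longrightarrow> norm p \<le> r"
    using test_function_bounded[OF u] by metis
  have C1: "Ck 1 u" "Ck 1 (partial_deriv j u)" for j
    using test_function_Ck[OF u, of 1] test_function_Ck[OF u, of "Suc 1"] by simp_all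
  define J where "J j p = partial_deriv j (partial_deriv j u) p \<bullet> u p + partial_deriv j u p \<bullet> partial_deriv j u p"
    for j p
  have J: "integrable lebesgue (J j)" "(\<integral>p. J j p \<partial>lebesgue) = 0" for j
    using integral_partial_deriv_flux[OF C1(2) C1(1) r(3) r(4), where c = "\<lambda>_. 1" and b = 1 and j = j]
    by (simp_all add: J_def[abs_def])
  have "0 \<le> magnetic_laplacian A_pot u p \<bullet> u p + J 1 p + J 2 p + J 3 p" for p
  proof -
    have "magnetic_laplacian A_pot u p \<bullet> u p + J 1 p + J 2 p + J 3 p
      = (norm (partial_deriv 1 u p))\<^sup>2 + (norm (partial_deriv 2 u p))\<^sup>2
        + (norm (- \<i> * partial_deriv 3 u p - of_real (ln_radius p) * u p))\<^sup>2"
      unfolding J_def magnetic_laplacian_expand[OF test_function_Ck[OF u]] power2_norm_eq_inner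
      by (simp add: inner_complex_def power2_eq_square algebra_simps)
    then show ?thesis by simp
  qed
  then have "0 \<le> (\<integral>p. magnetic_laplacian A_pot u p \<bullet> u p + J 1 p + J 2 p + J 3 p \<partial>lebesgue)"
    by (intro integral_nonneg_AE) simp
  also have "\<dots> = (\<integral>p. magnetic_laplacian A_pot u p \<bullet> u p \<partial>lebesgue)"
    using int J by simp
  finally show ?thesis .
qed

subsection \<open>The operator and its perturbation\<close>

definition H_min :: L2_op where
  "H_min = {(F, G). \<exists>u. test_function u \<and> represents u F \<and> represents (magnetic_laplacian A_pot u) G}"

lemma H_A_closure: "H_A = closure H_min"
  by (simp add: H_A_def H_min_def)

lemma partial_deriv_lincomb:
  assumes "u differentiable_on UNIV" "v differentiable_on UNIV"
  shows "partial_deriv j (\<lambda>p. a *\<^sub>R u p + b *\<^sub>R v p) = (\<lambda>p. a *\<^sub>R partial_deriv j u p + b *\<^sub>R partial_deriv j v p)"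
  by (rule ext, rule partial_deriv_eqI)
    (intro has_vector_derivative_add bounded_linear.has_vector_derivative[OF bounded_linear_scaleR_right]
      has_partial_deriv assms)

lemma Ck_lincomb: "Ck k u \<Longrightarrow> Ck k v \<Longrightarrow> Ck k (\<lambda>p. a *\<^sub>R u p + b *\<^sub>R v p)"
  by (induction k arbitrary: u v)
    (auto simp: partial_deriv_lincomb simp del: scaleR_conv_of_real
      intro!: continuous_intros differentiable_on_add differentiable_on_scaleR differentiable_on_const)

lemma test_function_lincomb:
  assumes "test_function u" "test_function v"
  shows "test_function (\<lambda>p. a *\<^sub>R u p + b *\<^sub>R v p)"
proof -
  let ?w = "\<lambda>p. a *\<^sub>R u p + b *\<^sub>R v p"
  have "{p. ?w p \<noteq> 0} \<subseteq> {p. u p \<noteq> 0} \<union> {p. v p \<noteq> 0}"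
    by auto
  moreover have "bounded ({p. u p \<noteq> 0} \<union> {p. v p \<noteq> 0})"
    using assms by (simp add: test_function_def)
  ultimately have "compact (closure {p. ?w p \<noteq> 0})"
    unfolding compact_closure by (rule bounded_subset[rotated])
  then show ?thesis
    using assms by (auto simp: test_function_def intro: Ck_lincomb)
qed

lemma magnetic_laplacian_lincomb:
  assumes "test_function u" "test_function v"
  shows "magnetic_laplacian A_pot (\<lambda>p. a *\<^sub>R u p + b *\<^sub>R v p)
    = (\<lambda>p. a *\<^sub>R magnetic_laplacian A_pot u p + b *\<^sub>R magnetic_laplacian A_pot v p)"
proof
  fix p
  note d = assms[THEN test_function_differentiable(1)]
  note d' = assms[THEN test_function_differentiable(2)]
  show "magnetic_laplacian A_pot (\<lambda>p. a *\<^sub>R u p + b *\<^sub>R v p) p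
    = a *\<^sub>R magnetic_laplacian A_pot u p + b *\<^sub>R magnetic_laplacian A_pot v p"
    unfolding magnetic_laplacian_expand[OF test_function_Ck[OF assms(1)]]
      magnetic_laplacian_expand[OF test_function_Ck[OF assms(2)]]
      magnetic_laplacian_expand[OF test_function_Ck[OF test_function_lincomb[OF assms]]]
      partial_deriv_lincomb[OF d] partial_deriv_lincomb[OF d']
    by (simp add: algebra_simps scaleR_conv_of_real)
qed

lemma test_function_0: "test_function (\<lambda>p. 0)"
proof -
  have "partial_deriv j (\<lambda>p. 0) = (\<lambda>p. 0)" for j
    by (rule ext, rule partial_deriv_eqI) (rule has_vector_derivative_const)
  then have "Ck k (\<lambda>p. 0)" for k
    by (induction k) auto
  then show ?thesis by (simp add: test_function_def)
qed

lemma H_min_subspace: "subspace H_min"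
proof (rule subspaceI)
  have "magnetic_laplacian A_pot (\<lambda>p. 0) = (\<lambda>p. 0)"
    using magnetic_laplacian_lincomb[OF test_function_0 test_function_0, of 0 0] by simp
  then show "0 \<in> H_min"
    unfolding H_min_def zero_prod_def using test_function_0 represents_0 by force
next
  fix x y assume "x \<in> H_min" "y \<in> H_min"
  then obtain u v where "test_function u" "represents u (fst x)"
      "represents (magnetic_laplacian A_pot u) (snd x)"
      "test_function v" "represents v (fst y)" "represents (magnetic_laplacian A_pot v) (snd y)"
    by (auto simp: H_min_def)
  then have "test_function (\<lambda>p. u p + v p) \<and> represents (\<lambda>p. u p + v p) (fst x + fst y) \<and>
      represents (magnetic_laplacian A_pot (\<lambda>p. u p + v p)) (snd x + snd y)"
    using test_function_lincomb[of u v 1 1]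
      represents_add[of "magnetic_laplacian A_pot u" _ "magnetic_laplacian A_pot v"]
      magnetic_laplacian_lincomb[of u v 1 1]
    by (auto intro: represents_add)
  then show "x + y \<in> H_min"
    unfolding H_min_def plus_prod_def by blast
next
  fix x :: "L2 \<times> L2" and c :: real assume "x \<in> H_min"
  then obtain u where "test_function u" "represents u (fst x)"
      "represents (magnetic_laplacian A_pot u) (snd x)"
    by (auto simp: H_min_def)
  then have "test_function (\<lambda>p. c *\<^sub>R u p) \<and> represents (\<lambda>p. c *\<^sub>R u p) (c *\<^sub>R fst x) \<and>
      represents (magnetic_laplacian A_pot (\<lambda>p. c *\<^sub>R u p)) (c *\<^sub>R snd x)"
    using test_function_lincomb[of u u c 0] magnetic_laplacian_lincomb[of u u c 0]
    by (auto intro: represents_scaleR simp del: scaleR_conv_of_real)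
  then show "c *\<^sub>R x \<in> H_min"
    unfolding H_min_def scaleR_prod_def by blast
qed

lemma subspace_closure:
  fixes S :: "'a::real_normed_vector set"
  assumes "subspace S"
  shows "subspace (closure S)"
proof (rule subspaceI)
  show "0 \<in> closure S"
    using subspace_0[OF assms] closure_subset by blast
next
  fix x y assume "x \<in> closure S" "y \<in> closure S"
  then obtain f g where "\<And>n::nat. f n \<in> S" "f \<longlonglongrightarrow> x" "\<And>n::nat. g n \<in> S" "g \<longlonglongrightarrow> y"
    unfolding closure_sequential by blast
  then show "x + y \<in> closure S"
    unfolding closure_sequential
    by (intro exI[of _ "\<lambda>n. f n + g n"]) (auto intro: subspace_add[OF assms] tendsto_add)
next
  fix x and c :: real assume "x \<in> closure S"
  then obtain f where "\<And>n::nat. f n \<in> S" "f \<longlonglongrightarrow> x"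
    unfolding closure_sequential by blast
  then show "c *\<^sub>R x \<in> closure S"
    unfolding closure_sequential
    by (intro exI[of _ "\<lambda>n. c *\<^sub>R f n"]) (auto intro: subspace_scale[OF assms] tendsto_scaleR)
qed

lemma H_A_subspace: "subspace H_A"
  unfolding H_A_closure by (rule subspace_closure[OF H_min_subspace])

lemma H_A_sym:
  assumes "(F, F') \<in> H_A" "(G, G') \<in> H_A"
  shows "F' \<bullet> G = F \<bullet> G'"
proof -
  have min: "F' \<bullet> G = F \<bullet> G'" if FG: "(F, F') \<in> H_min" "(G, G') \<in> H_min" for F F' G G'
  proof -
    obtain u v where u: "test_function u" "represents u F" "represents (magnetic_laplacian A_pot u) F'"
      and v: "test_function v" "represents v G" "represents (magnetic_laplacian A_pot v) G'"
      using FG unfolding H_min_def by blast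
    have "F' \<bullet> G = (\<integral>p. magnetic_laplacian A_pot u p \<bullet> v p \<partial>lebesgue)"
      using u v by (intro inner_represents)
    also have "\<dots> = (\<integral>p. u p \<bullet> magnetic_laplacian A_pot v p \<partial>lebesgue)"
      using u v by (intro magnetic_laplacian_symmetric represents_inner_integrable)
    also have "\<dots> = F \<bullet> G'"
      using u v by (intro inner_represents[symmetric])
    finally show ?thesis .
  qed
  obtain x where x: "\<And>n::nat. x n \<in> H_min" "x \<longlonglongrightarrow> (F, F')"
    using assms(1) unfolding H_A_closure closure_sequential by blast
  obtain y where y: "\<And>n::nat. y n \<in> H_min" "y \<longlonglongrightarrow> (G, G')"
    using assms(2) unfolding H_A_closure closure_sequential by blast
  have "(\<lambda>n. snd (x n) \<bullet> fst (y n)) \<longlonglongrightarrow> snd (F, F') \<bullet> fst (G, G')"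
    by (intro tendsto_intros x y)
  moreover have "(\<lambda>n. fst (x n) \<bullet> snd (y n)) \<longlonglongrightarrow> fst (F, F') \<bullet> snd (G, G')"
    by (intro tendsto_intros x y)
  moreover have "snd (x n) \<bullet> fst (y n) = fst (x n) \<bullet> snd (y n)" for n
    using x(1)[of n] y(1)[of n] by (intro min) auto
  ultimately show ?thesis
    using LIMSEQ_unique by fastforce
qed

lemma H_A_nonneg:
  assumes "(F, F') \<in> H_A"
  shows "0 \<le> F' \<bullet> F"
proof -
  obtain x where x: "\<And>n::nat. x n \<in> H_min" "x \<longlonglongrightarrow> (F, F')"
    using assms(1) unfolding H_A_closure closure_sequential by blast
  have lim: "(\<lambda>n. snd (x n) \<bullet> fst (x n)) \<longlonglongrightarrow> snd (F, F') \<bullet> fst (F, F')"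
    by (intro tendsto_intros x)
  have pos: "0 \<le> snd (x n) \<bullet> fst (x n)" for n
  proof -
    obtain u where u: "test_function u" "represents u (fst (x n))"
        "represents (magnetic_laplacian A_pot u) (snd (x n))"
      using x(1)[of n] by (auto simp: H_min_def)
    have "snd (x n) \<bullet> fst (x n) = (\<integral>p. magnetic_laplacian A_pot u p \<bullet> u p \<partial>lebesgue)"
      using u by (intro inner_represents)
    then show ?thesis
      using magnetic_laplacian_nonneg[OF u(1) represents_inner_integrable[OF u(3,2)]] by simp
  qed
  have "0 \<le> snd (F, F') \<bullet> fst (F, F')"
    by (rule LIMSEQ_le_const[OF lim]) (use pos in blast)
  then show ?thesis by simp
qed

text \<open>A compact operator is defined everywhere, so every vector lies in the range of H + 1 and
  its preimage in the domain of \<open>V\<close>. The premise on trial vectors quantifies over all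
  \<open>W\<close> because V F is not yet known to be in L^2 when the vectors are built; here it is
  supplied by \<open>K\<close>.\<close>

lemma H_A_negative_eigenvalues:
  assumes V_compact: "compact_op ((op_shift H_A 1)\<inverse> O mult_op V)"
    and trial: "\<And>n::nat. \<exists>F G. (\<forall>i\<le>n. (F i, G i) \<in> H_A) \<and>
      (\<forall>a W. (\<exists>i\<le>n. a i \<noteq> 0) \<longrightarrow> (\<Sum>i\<le>n. a i *\<^sub>R F i, W) \<in> mult_op V \<longrightarrow>
        ((\<Sum>i\<le>n. a i *\<^sub>R G i) - W) \<bullet> (\<Sum>i\<le>n. a i *\<^sub>R F i) < 0)"
  shows "0 islimpt {\<mu>. \<mu> < 0 \<and> eigenvalue (op_diff H_A (mult_op V)) \<mu>}"
proof -
  obtain K where K: "(op_shift H_A 1)\<inverse> O mult_op V = {(F, K F) |F. True}" "linear K"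
      "compact (closure (K ` cball 0 1))"
    using V_compact unfolding compact_op_def by blast
  have "\<exists>U. (U, F) \<in> op_shift H_A 1 \<and> (U, K F) \<in> mult_op V" for F
  proof -
    have "(F, K F) \<in> (op_shift H_A 1)\<inverse> O mult_op V" by (simp add: K)
    then show ?thesis by blast
  qed
  then obtain R where R: "\<And>F. (R F, F) \<in> op_shift H_A 1" "\<And>F. (R F, K F) \<in> mult_op V"
    by metis
  have RH: "(R F, F - R F) \<in> H_A" for F
  proof -
    obtain G where "F = G + R F" "(R F, G) \<in> H_A"
      using R(1)[of F] by (auto simp: op_shift_def)
    moreover from this have "F - R F = G" by (metis add_diff_cancel_right')
    ultimately show ?thesis by simp
  qed
  \<comment> \<open>The difference of two solutions satisfies H D = - D, which nonnegativity allows
    only for D = 0.\<close>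
  have unique: "U = R F" if "(U, F - U) \<in> H_A" for U F
  proof -
    have "(U, F - U) - (R F, F - R F) \<in> H_A"
      using that RH by (rule subspace_diff[OF H_A_subspace])
    moreover define D where "D = U - R F"
    ultimately have "(D, - D) \<in> H_A" by simp
    from H_A_nonneg[OF this] have "D \<bullet> D \<le> 0" by simp
    then have "D = 0" by (metis inner_gt_zero_iff not_le)
    then show ?thesis by (simp add: D_def)
  qed
  have R_linear: "linear R"
  proof (rule linearI)
    fix F G
    have "(R F, F - R F) + (R G, G - R G) \<in> H_A"
      by (intro subspace_add[OF H_A_subspace] RH)
    then show "R (F + G) = R F + R G"
      by (intro unique[symmetric]) (simp add: algebra_simps)
  next
    fix c F
    have "c *\<^sub>R (R F, F - R F) \<in> H_A"
      by (intro subspace_scale[OF H_A_subspace] RH)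
    then show "R (c *\<^sub>R F) = c *\<^sub>R R F"
      by (intro unique[symmetric]) (simp add: scaleR_diff_right)
  qed
  interpret rc: relatively_compact_perturbation R K
  proof (rule relatively_compact_perturbation.intro)
    show "R f \<bullet> g = f \<bullet> R g" for f g
      using H_A_sym[OF RH RH, of f g] by (simp add: inner_diff)
    show "(norm (R f))\<^sup>2 \<le> R f \<bullet> f" for f
      using H_A_nonneg[OF RH, of f] by (simp add: inner_diff power2_norm_eq_inner inner_commute)
    show "K f \<bullet> R g = R f \<bullet> K g" for f g
      by (rule mult_op_sym[OF R(2) R(2)])
    show "k = 0" if "(\<lambda>n. R (g n)) \<longlonglongrightarrow> 0" "(\<lambda>n. K (g n)) \<longlonglongrightarrow> k" for g k
      by (rule mult_op_closable[OF R(2) that])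
  qed (use K R_linear in auto)
  have "\<exists>f. \<forall>a. (\<exists>i\<le>n. a i \<noteq> 0) \<longrightarrow>
      (\<exists>F. F = (\<Sum>i\<le>n::nat. a i *\<^sub>R f i) \<and> (F - R F - K F) \<bullet> R F < 0)" for n
  proof -
    obtain F G where FG: "\<And>i. i \<le> n \<Longrightarrow> (F i, G i) \<in> H_A"
      and neg: "\<And>a W. \<exists>i\<le>n. a i \<noteq> 0 \<Longrightarrow> (\<Sum>i\<le>n. a i *\<^sub>R F i, W) \<in> mult_op V \<Longrightarrow>
        ((\<Sum>i\<le>n. a i *\<^sub>R G i) - W) \<bullet> (\<Sum>i\<le>n. a i *\<^sub>R F i) < 0"
      using trial[of n] by blast
    \<comment> \<open>\<open>F i + G i\<close> is (H + 1) applied to \<open>F i\<close>, so these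
      vectors are the preimages of the trial vectors under \<open>R\<close>.\<close>
    have RF: "R (F i + G i) = F i" if "i \<le> n" for i
      using FG[OF that] by (intro unique[symmetric]) simp
    show ?thesis
    proof (intro exI[of _ "\<lambda>i. F i + G i"] allI impI)
      fix a :: "nat \<Rightarrow> real" assume a: "\<exists>i\<le>n. a i \<noteq> 0"
      define J where "J = (\<Sum>i\<le>n. a i *\<^sub>R (F i + G i))"
      have RJ: "R J = (\<Sum>i\<le>n. a i *\<^sub>R F i)"
        unfolding J_def by (simp add: linear_sum[OF R_linear] linear_scale[OF R_linear] RF)
      have "J - R J = (\<Sum>i\<le>n. a i *\<^sub>R G i)"
        unfolding RJ by (simp add: J_def scaleR_add_right sum.distrib)
      then have "(J - R J - K J) \<bullet> R J < 0"
        using neg[OF a, of "K J"] R(2)[of J] by (simp flip: RJ)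
      then show "\<exists>J. J = (\<Sum>i\<le>n. a i *\<^sub>R (F i + G i)) \<and> (J - R J - K J) \<bullet> R J < 0"
        by (intro exI[of _ J]) (simp only: J_def)
    qed
  qed
  note accumulate = rc.negative_eigenvalues_accumulate[OF this]
  show ?thesis
    unfolding islimpt_approachable
  proof (intro allI impI)
    fix e :: real assume "0 < e"
    then obtain \<mu> F where \<mu>: "- e < \<mu>" "\<mu> < 0" "R F \<noteq> 0" "F - R F - K F = \<mu> *\<^sub>R R F"
      by (rule accumulate)
    have "(R F, F - R F - K F) \<in> op_diff H_A (mult_op V)"
      unfolding op_diff_def using RH[of F] R(2)[of F] by blast
    with \<mu> have "eigenvalue (op_diff H_A (mult_op V)) \<mu>"
      by (auto simp: eigenvalue_def)
    with \<mu> show "\<exists>x'\<in>{\<mu>. \<mu> < 0 \<and> eigenvalue (op_diff H_A (mult_op V)) \<mu>}. x' \<noteq> 0 \<and> dist x' 0 < e"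
      by (intro bexI[of _ \<mu>]) auto
  qed
qed

subsection \<open>Smooth functions of product form\<close>

text \<open>The derivative is existentially quantified, which makes the closure properties below
  plain inductions on the order.\<close>

primrec times_differentiable :: "nat \<Rightarrow> (real \<Rightarrow> 'a::real_normed_vector) \<Rightarrow> bool" where
  "times_differentiable 0 f \<longleftrightarrow> True"
| "times_differentiable (Suc n) f \<longleftrightarrow>
    (\<exists>f'. (\<forall>x. (f has_vector_derivative f' x) (at x)) \<and> times_differentiable n f')"

definition smooth :: "(real \<Rightarrow> 'a::real_normed_vector) \<Rightarrow> bool" where
  "smooth f \<longleftrightarrow> (\<forall>n. times_differentiable n f)"

lemma times_differentiable_SucI:
  "(\<And>x. (f has_vector_derivative f' x) (at x)) \<Longrightarrow> times_differentiable n f' \<Longrightarrow>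
    times_differentiable (Suc n) f"
  by auto

lemma times_differentiable_Suc_imp: "times_differentiable (Suc n) f \<Longrightarrow> times_differentiable n f"
  by (induction n arbitrary: f) force+

lemma times_differentiable_add:
  "times_differentiable n f \<Longrightarrow> times_differentiable n g \<Longrightarrow> times_differentiable n (\<lambda>x. f x + g x)"
proof (induction n arbitrary: f g)
  case (Suc n)
  then obtain f' g' where "\<And>x. (f has_vector_derivative f' x) (at x)" "times_differentiable n f'"
      "\<And>x. (g has_vector_derivative g' x) (at x)" "times_differentiable n g'"
    by auto
  with Suc.IH show ?case
    by (auto intro!: exI[of _ "\<lambda>x. f' x + g' x"] has_vector_derivative_add)
qed simp

lemma times_differentiable_scaleR:
  "times_differentiable n f \<Longrightarrow> times_differentiable n (\<lambda>x. c *\<^sub>R f x)"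
proof (induction n arbitrary: f)
  case (Suc n)
  then obtain f' where "\<And>x. (f has_vector_derivative f' x) (at x)" "times_differentiable n f'"
    by auto
  with Suc.IH show ?case
    by (auto intro!: exI[of _ "\<lambda>x. c *\<^sub>R f' x"]
        bounded_linear.has_vector_derivative[OF bounded_linear_scaleR_right])
qed simp

lemma times_differentiable_mult:
  fixes f g :: "real \<Rightarrow> 'a::real_normed_algebra"
  shows "times_differentiable n f \<Longrightarrow> times_differentiable n g \<Longrightarrow> times_differentiable n (\<lambda>x. f x * g x)"
proof (induction n arbitrary: f g)
  case (Suc n)
  then have lower: "times_differentiable n f" "times_differentiable n g"
    by (simp_all only: times_differentiable_Suc_imp)
  from Suc obtain f' g' where f': "\<And>x. (f has_vector_derivative f' x) (at x)" "times_differentiable n f'"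
      and g': "\<And>x. (g has_vector_derivative g' x) (at x)" "times_differentiable n g'"
    by auto
  have "((\<lambda>x. f x * g x) has_vector_derivative (f x * g' x + f' x * g x)) (at x)" for x
    by (intro has_vector_derivative_mult f' g')
  moreover have "times_differentiable n (\<lambda>x. f x * g' x + f' x * g x)"
    by (intro times_differentiable_add Suc.IH lower f' g')
  ultimately show ?case by (rule times_differentiable_SucI)
qed simp

lemma times_differentiable_affine:
  "times_differentiable n f \<Longrightarrow> times_differentiable n (\<lambda>x. f (c * x + d))"
proof (induction n arbitrary: f)
  case (Suc n)
  then obtain f' where f': "\<And>x. (f has_vector_derivative f' x) (at x)" "times_differentiable n f'"
    by auto
  have "((\<lambda>x. f (c * x + d)) has_vector_derivative c *\<^sub>R f' (c * x + d)) (at x)" for x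
  proof -
    have "((\<lambda>x. c * x + d) has_vector_derivative c) (at x)"
      by (auto intro!: derivative_eq_intros simp flip: has_real_derivative_iff_has_vector_derivative)
    from vector_diff_chain_at[OF this f'(1)] show ?thesis
      by (simp add: o_def)
  qed
  moreover have "times_differentiable n (\<lambda>x. c *\<^sub>R f' (c * x + d))"
    by (intro times_differentiable_scaleR Suc.IH f')
  ultimately show ?case by (rule times_differentiable_SucI)
qed simp

lemma times_differentiable_of_real:
  "times_differentiable n f \<Longrightarrow> times_differentiable n (\<lambda>x. of_real (f x) :: complex)"
proof (induction n arbitrary: f)
  case (Suc n)
  then obtain f' where "\<And>x. (f has_vector_derivative f' x) (at x)" "times_differentiable n f'"
    by auto
  with Suc.IH show ?case
    by (auto intro!: exI[of _ "\<lambda>x. of_real (f' x)"] has_vector_derivative_of_real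
      simp flip: has_real_derivative_iff_has_vector_derivative)
qed simp

lemma exp_i_has_vector_derivative:
  "((\<lambda>x. exp (\<i> * of_real (k * x))) has_vector_derivative \<i> * of_real k * exp (\<i> * of_real (k * x))) (at x)"
proof -
  have "((\<lambda>z. exp (\<i> * (of_real k * z))) has_field_derivative \<i> * of_real k * exp (\<i> * (of_real k * of_real x)))
      (at (of_real x))"
    by (auto intro!: derivative_eq_intros)
  from has_vector_derivative_real_field[OF this] show ?thesis by simp
qed

lemma times_differentiable_exp_i: "times_differentiable n (\<lambda>x. c * exp (\<i> * of_real (k * x)))"
proof (induction n arbitrary: c)
  case (Suc n)
  have "((\<lambda>x. c * exp (\<i> * of_real (k * x))) has_vector_derivative
      c * (\<i> * of_real k * exp (\<i> * of_real (k * x)))) (at x)" for x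
    by (intro has_vector_derivative_mult_right exp_i_has_vector_derivative)
  then show ?case
    by (rule times_differentiable_SucI) (use Suc[of "c * (\<i> * of_real k)"] in \<open>simp add: mult.assoc\<close>)
qed simp

text \<open>The witnesses for different orders n coincide because derivatives are unique, so a
  single function serves for all n.\<close>

lemma smooth_derivative:
  assumes "smooth f"
  obtains f' where "\<And>x. (f has_vector_derivative f' x) (at x)" "smooth f'"
proof (rule that)
  show d: "(f has_vector_derivative vector_derivative f (at x)) (at x)" for x
    using assms unfolding smooth_def
    by (metis times_differentiable.simps(2) vector_derivative_at)
  show "smooth (\<lambda>x. vector_derivative f (at x))"
    unfolding smooth_def
  proof
    fix n
    have "times_differentiable (Suc n) f" using assms by (simp add: smooth_def)
    then obtain f' where f': "\<And>x. (f has_vector_derivative f' x) (at x)" "times_differentiable n f'"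
      by auto
    then have "f' = (\<lambda>x. vector_derivative f (at x))"
      by (intro ext vector_derivative_at[symmetric])
    with f' show "times_differentiable n (\<lambda>x. vector_derivative f (at x))" by simp
  qed
qed

section \<open>A smooth bump function\<close>

text \<open>The classical exp (-1/x) glued to 0, together with its multiples by powers of 1/x: the
  linear span of this family is closed under differentiation, so smoothness becomes an
  induction.\<close>

definition flat :: "nat \<Rightarrow> real \<Rightarrow> real" where
  "flat n x = (if 0 < x then exp (- inverse x) * inverse x ^ n else 0)"

lemma flat_limit: "((\<lambda>x. flat n x) \<longlongrightarrow> 0) (at 0)"
proof -
  have "((\<lambda>t::real. t ^ n / exp t) \<longlongrightarrow> 0) at_top"
    by (rule tendsto_power_div_exp_0)
  from filterlim_compose[OF this filterlim_inverse_at_top_right]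
  have "((\<lambda>x::real. inverse x ^ n / exp (inverse x)) \<longlongrightarrow> 0) (at_right 0)" .
  moreover have "eventually (\<lambda>x. inverse x ^ n / exp (inverse x) = flat n x) (at_right 0)"
    using eventually_at_right_less[of 0]
    by eventually_elim (simp add: flat_def exp_minus divide_inverse mult.commute)
  ultimately have right: "((\<lambda>x. flat n x) \<longlongrightarrow> 0) (at_right 0)"
    by (rule Lim_transform_eventually)
  have "eventually (\<lambda>x::real. x < 0) (at_left 0)"
    by (simp add: eventually_at_filter)
  then have "eventually (\<lambda>x. 0 = flat n x) (at_left 0)"
    by eventually_elim (simp add: flat_def)
  then have "((\<lambda>x. flat n x) \<longlongrightarrow> 0) (at_left 0)"
    by (rule Lim_transform_eventually[OF tendsto_const])
  with right show ?thesis
    by (simp add: filterlim_split_at)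
qed

lemma flat_has_derivative:
  "(flat n has_real_derivative flat (n + 2) x - real n * flat (n + 1) x) (at x)"
proof -
  consider "0 < x" | "x < 0" | "x = 0" by linarith
  then show ?thesis
  proof cases
    case 1
    have "((\<lambda>x. inverse x ^ n) has_real_derivative - real n * inverse x ^ (n + 1)) (at x)"
    proof (induction n)
      case (Suc n)
      have "(inverse has_real_derivative - (inverse x * inverse x)) (at x)"
        using 1 by (auto intro!: derivative_eq_intros)
      from DERIV_mult'[OF this Suc] show ?case
        by (simp add: algebra_simps)
    qed simp
    moreover have "((\<lambda>x. exp (- inverse x)) has_real_derivative exp (- inverse x) * (inverse x * inverse x)) (at x)"
      using 1 by (auto intro!: derivative_eq_intros)
    ultimately have "((\<lambda>x. exp (- inverse x) * inverse x ^ n) has_real_derivative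
        exp (- inverse x) * (- real n * inverse x ^ (n + 1))
        + exp (- inverse x) * (inverse x * inverse x) * inverse x ^ n) (at x)"
      by (rule DERIV_mult'[rotated])
    also have "exp (- inverse x) * (- real n * inverse x ^ (n + 1))
        + exp (- inverse x) * (inverse x * inverse x) * inverse x ^ n
        = flat (n + 2) x - real n * flat (n + 1) x"
      using 1 by (simp add: flat_def mult_ac)
    finally have "((\<lambda>x. exp (- inverse x) * inverse x ^ n) has_real_derivative
        flat (n + 2) x - real n * flat (n + 1) x) (at x)" .
    moreover have "eventually (\<lambda>x. exp (- inverse x) * inverse x ^ n = flat n x) (nhds x)"
      using eventually_nhds_in_open[of "{0<..}" x] 1
      by (auto elim!: eventually_mono simp: flat_def)
    ultimately show ?thesis
      using DERIV_cong_ev[OF refl _ refl, of "\<lambda>x. exp (- inverse x) * inverse x ^ n" "flat n" x] by blast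
  next
    case 2
    have "eventually (\<lambda>x. 0 = flat n x) (nhds x)"
      using eventually_nhds_in_open[of "{..<0}" x] 2
      by (auto elim!: eventually_mono simp: flat_def)
    from DERIV_cong_ev[OF refl this refl, of 0] have "(flat n has_real_derivative 0) (at x)"
      by simp
    then show ?thesis
      using 2 by (simp add: flat_def)
  next
    case 3
    \<comment> \<open>At the gluing point the difference quotient is the next member of the family,
      which tends to 0.\<close>
    have "(flat n (0 + h) - flat n 0) / h = flat (n + 1) h" for h
      by (simp add: flat_def divide_inverse mult.commute)
    then show ?thesis
      using flat_limit[of "n + 1"] 3 by (simp add: DERIV_def flat_def)
  qed
qed

lemma times_differentiable_flat: "times_differentiable k (flat n)"
proof (induction k arbitrary: n)
  case (Suc k)
  have "times_differentiable k (\<lambda>x. flat (n + 2) x + (- real n) *\<^sub>R flat (n + 1) x)"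
    by (intro times_differentiable_add times_differentiable_scaleR Suc)
  then show ?case
    by (rule times_differentiable_SucI[rotated])
      (use flat_has_derivative[of n] in \<open>simp add: has_real_derivative_iff_has_vector_derivative\<close>)
qed simp

definition bump :: "real \<Rightarrow> real" where
  "bump x = flat 0 (1 + x) * flat 0 (1 - x)"

lemma smooth_bump: "smooth bump"
proof -
  have "times_differentiable n (\<lambda>x. flat 0 (1 * x + 1) * flat 0 (- 1 * x + 1))" for n
    by (intro times_differentiable_mult times_differentiable_affine times_differentiable_flat)
  then show ?thesis
    by (simp add: smooth_def bump_def[abs_def] add.commute)
qed

lemma bump_nonneg: "0 \<le> bump x"
  by (simp add: bump_def flat_def)

lemma bump_pos: "\<bar>x\<bar> < 1 \<Longrightarrow> 0 < bump x"
  by (simp add: bump_def flat_def abs_less_iff)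

lemma bump_eq_0: "1 \<le> \<bar>x\<bar> \<Longrightarrow> bump x = 0"
  by (auto simp: bump_def flat_def abs_if split: if_splits)

lemma has_derivative_support:
  fixes f f' :: "real \<Rightarrow> real"
  assumes "\<And>x. (f has_real_derivative f' x) (at x)" "\<And>x. r < \<bar>x\<bar> \<Longrightarrow> f x = 0" "r < \<bar>x\<bar>"
  shows "f' x = 0"
proof -
  have "open {x::real. r < \<bar>x\<bar>}"
    by (intro open_Collect_less continuous_intros)
  then have "eventually (\<lambda>x. f x = 0) (nhds x)"
    using eventually_nhds_in_open[of "{x. r < \<bar>x\<bar>}" x] assms(2,3)
    by (auto elim!: eventually_mono)
  from DERIV_cong_ev[OF refl this refl, of 0] have "(f has_real_derivative 0) (at x)"
    by simp
  then show ?thesis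
    using assms(1) DERIV_unique by blast
qed

lemma bump_derivatives:
  obtains b1 b2 B where
    "\<And>x. (bump has_real_derivative b1 x) (at x)" "\<And>x. (b1 has_real_derivative b2 x) (at x)"
    "\<And>x. \<bar>bump x\<bar> \<le> B" "\<And>x. \<bar>b1 x\<bar> \<le> B" "\<And>x. \<bar>b2 x\<bar> \<le> B" "1 \<le> B"
    "\<And>x. 1 < \<bar>x\<bar> \<Longrightarrow> b1 x = 0" "\<And>x. 1 < \<bar>x\<bar> \<Longrightarrow> b2 x = 0"
    "continuous_on UNIV b1" "continuous_on UNIV b2"
proof -
  obtain b1 where b1: "\<And>x. (bump has_vector_derivative b1 x) (at x)" "smooth b1"
    using smooth_derivative[OF smooth_bump] by blast
  obtain b2 where b2: "\<And>x. (b1 has_vector_derivative b2 x) (at x)" "smooth b2"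
    using smooth_derivative[OF b1(2)] by blast
  obtain b3 where b3: "\<And>x. (b2 has_vector_derivative b3 x) (at x)"
    using smooth_derivative[OF b2(2)] by blast
  have d: "(bump has_real_derivative b1 x) (at x)" "(b1 has_real_derivative b2 x) (at x)"
    "(b2 has_real_derivative b3 x) (at x)" for x
    using b1 b2 b3 by (auto simp: has_real_derivative_iff_has_vector_derivative)
  then have cont: "continuous_on UNIV bump" "continuous_on UNIV b1" "continuous_on UNIV b2"
    by (auto intro!: DERIV_atLeastAtMost_imp_continuous_on continuous_at_imp_continuous_on DERIV_isCont)
  have z1: "b1 x = 0" if "1 < \<bar>x\<bar>" for x
    by (rule has_derivative_support[OF d(1) _ that]) (auto simp: bump_eq_0)
  have z2: "b2 x = 0" if "1 < \<bar>x\<bar>" for x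
    by (rule has_derivative_support[OF d(2) z1 that])
  have norm_le: "norm x \<le> 1" if "f x \<noteq> 0" "\<And>x. 1 < \<bar>x\<bar> \<Longrightarrow> f x = 0" for f :: "real \<Rightarrow> real" and x
    using that(1) that(2)[of x] by (metis not_le real_norm_def)
  have z0: "bump x = 0" if "1 < \<bar>x\<bar>" for x using that by (simp add: bump_eq_0)
  obtain B0 where B0: "0 \<le> B0" "\<And>x. norm (bump x) \<le> B0"
    using continuous_bounded_support[OF cont(1) norm_le[of bump, OF _ z0]] by blast
  obtain B1 where B1: "0 \<le> B1" "\<And>x. norm (b1 x) \<le> B1"
    using continuous_bounded_support[OF cont(2) norm_le[of b1, OF _ z1]] by blast
  obtain B2 where B2: "0 \<le> B2" "\<And>x. norm (b2 x) \<le> B2"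
    using continuous_bounded_support[OF cont(3) norm_le[of b2, OF _ z2]] by blast
  define B where "B = 1 + B0 + B1 + B2"
  have "\<bar>bump x\<bar> \<le> B" "\<bar>b1 x\<bar> \<le> B" "\<bar>b2 x\<bar> \<le> B" for x
    using B0(1) B0(2)[of x] B1(1) B1(2)[of x] B2(1) B2(2)[of x] by (auto simp: B_def)
  moreover have "1 \<le> B" using B0 B1 B2 by (simp add: B_def)
  ultimately show ?thesis
    using that[of b1 b2 B] d z1 z2 cont by blast
qed

lemma smooth_of_real_affine: "smooth f \<Longrightarrow> smooth (\<lambda>x. of_real (f (c * x + d)) :: complex)"
  unfolding smooth_def by (intro allI times_differentiable_of_real times_differentiable_affine) auto

lemma smooth_exp_i_mult:
  "smooth f \<Longrightarrow> smooth (\<lambda>x. exp (\<i> * of_real (k * x)) * f x)"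
  unfolding smooth_def
  using times_differentiable_exp_i[of _ 1 k] by (auto intro: times_differentiable_mult)

section \<open>Products of one-variable functions\<close>

definition tensor :: "(real \<Rightarrow> complex) \<Rightarrow> (real \<Rightarrow> complex) \<Rightarrow> (real \<Rightarrow> complex) \<Rightarrow> real ^ 3 \<Rightarrow> complex" where
  "tensor f g h p = f (p $ 1) * g (p $ 2) * h (p $ 3)"

lemma axis_nth_3:
  "axis 1 c $ (2::3) = 0" "axis 1 c $ (3::3) = 0" "axis 2 c $ (1::3) = 0"
  "axis 2 c $ (3::3) = 0" "axis 3 c $ (1::3) = 0" "axis 3 c $ (2::3) = 0"
  by (simp_all add: axis_def)

lemma shift_has_vector_derivative:
  assumes "(f has_vector_derivative f') (at a)"
  shows "((\<lambda>t. f (a + t)) has_vector_derivative f') (at 0)"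
proof -
  have "((\<lambda>t. a + t) has_vector_derivative 1) (at 0)"
    by (auto intro!: derivative_eq_intros simp flip: has_real_derivative_iff_has_vector_derivative)
  from vector_diff_chain_at[OF this, of f f'] assms show ?thesis
    by (simp add: o_def)
qed

lemma partial_deriv_tensor:
  assumes "\<And>x. (f has_vector_derivative f' x) (at x)" "\<And>x. (g has_vector_derivative g' x) (at x)"
    "\<And>x. (h has_vector_derivative h' x) (at x)"
  shows "partial_deriv 1 (tensor f g h) = tensor f' g h"
    and "partial_deriv 2 (tensor f g h) = tensor f g' h"
    and "partial_deriv 3 (tensor f g h) = tensor f g h'"
  by (rule ext, rule partial_deriv_eqI,
      simp add: tensor_def axis_nth_3,
      intro has_vector_derivative_mult_left has_vector_derivative_mult_right
        shift_has_vector_derivative assms)+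

lemma differentiable_nth:
  assumes "\<And>x. (f has_vector_derivative f' x) (at x)"
  shows "(\<lambda>p :: real ^ 3. f (p $ i)) differentiable (at p)"
proof -
  have "f differentiable (at (p $ i))"
    using assms by (auto intro: differentiableI_vector)
  moreover have "(\<lambda>p :: real ^ 3. p $ i) differentiable (at p)"
    by (intro bounded_linear_imp_differentiable bounded_linear_vec_nth)
  ultimately have "(f \<circ> (\<lambda>p. p $ i)) differentiable (at p)"
    by (rule differentiable_chain_at[rotated])
  then show ?thesis by (simp add: o_def)
qed

text \<open>A partial derivative of a product is again a product of smooth factors, so the induction
  on k never leaves this class.\<close>

lemma Ck_tensor:
  assumes "smooth f" "smooth g" "smooth h"
  shows "Ck k (tensor f g h)"
proof -
  have diff: "tensor f g h differentiable_on UNIV" if "smooth f" "smooth g" "smooth h" for f g h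
  proof -
    obtain f' g' h' where "\<And>x. (f has_vector_derivative f' x) (at x)"
        "\<And>x. (g has_vector_derivative g' x) (at x)" "\<And>x. (h has_vector_derivative h' x) (at x)"
      using smooth_derivative \<open>smooth f\<close> \<open>smooth g\<close> \<open>smooth h\<close> by metis
    then show ?thesis
      unfolding differentiable_on_def tensor_def[abs_def]
      by (auto intro!: differentiable_mult differentiable_nth)
  qed
  show ?thesis
    using assms
  proof (induction k arbitrary: f g h)
    case 0
    then show ?case by (auto intro: differentiable_imp_continuous_on diff)
  next
    case (Suc k)
    obtain f' where f': "\<And>x. (f has_vector_derivative f' x) (at x)" "smooth f'"
      using smooth_derivative Suc.prems(1) by blast
    obtain g' where g': "\<And>x. (g has_vector_derivative g' x) (at x)" "smooth g'"
      using smooth_derivative Suc.prems(2) by blast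
    obtain h' where h': "\<And>x. (h has_vector_derivative h' x) (at x)" "smooth h'"
      using smooth_derivative Suc.prems(3) by blast
    have "Ck k (partial_deriv j (tensor f g h))" for j :: 3
      using exhaust_3[of j] partial_deriv_tensor[OF f'(1) g'(1) h'(1)] Suc f' g' h' by auto
    then show ?case
      using diff Suc.prems by auto
  qed
qed

subsection \<open>Integrals of products\<close>

text \<open>The nesting ((x, y), z) matches the splitting of the integrals into a horizontal factor
  and a vertical one.\<close>

definition vec3 :: "(real \<times> real) \<times> real \<Rightarrow> real ^ 3" where
  "vec3 q = fst (fst q) *\<^sub>R axis 1 1 + snd (fst q) *\<^sub>R axis 2 1 + snd q *\<^sub>R axis 3 1"

lemma vec3_nth [simp]: "vec3 q $ 1 = fst (fst q)" "vec3 q $ 2 = snd (fst q)" "vec3 q $ 3 = snd q"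
  by (simp_all add: vec3_def axis_def)

lemma vec3_measurable [measurable]: "vec3 \<in> borel_measurable borel"
  unfolding vec3_def[abs_def] by (intro borel_measurable_continuous_onI continuous_intros)

text \<open>Lebesgue measure is determined by open boxes, and the preimage of a box is a product of
  three intervals.\<close>

lemma distr_vec3: "distr lborel borel vec3 = lborel"
proof (rule lborel_eqI[symmetric])
  fix l u :: "real ^ 3"
  assume le: "\<And>b. b \<in> Basis \<Longrightarrow> l \<bullet> b \<le> u \<bullet> b"
  have le': "l $ i \<le> u $ i" for i
    using le[of "axis i 1"] by (simp add: inner_axis axis_in_Basis_iff)
  have "vec3 -` box l u = ({l $ 1<..<u $ 1} \<times> {l $ 2<..<u $ 2}) \<times> {l $ 3<..<u $ 3}"
    by (auto simp: mem_box_cart forall_3)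
  then have "emeasure (distr lborel borel vec3) (box l u)
      = emeasure (lborel \<Otimes>\<^sub>M lborel) (({l $ 1<..<u $ 1} \<times> {l $ 2<..<u $ 2}) \<times> {l $ 3<..<u $ 3})"
    by (simp add: emeasure_distr lborel_prod)
  also have "\<dots> = emeasure (lborel \<Otimes>\<^sub>M lborel) ({l $ 1<..<u $ 1} \<times> {l $ 2<..<u $ 2}) * emeasure lborel {l $ 3<..<u $ 3}"
    by (subst lborel.emeasure_pair_measure_Times)
      (simp_all add: lborel_prod borel_open open_Times)
  also have "\<dots> = ennreal ((u $ 1 - l $ 1) * (u $ 2 - l $ 2) * (u $ 3 - l $ 3))"
    using le' by (subst lborel.emeasure_pair_measure_Times) (simp_all add: ennreal_mult)
  also have "(u $ 1 - l $ 1) * (u $ 2 - l $ 2) * (u $ 3 - l $ 3) = (\<Prod>b\<in>Basis. (u - l) \<bullet> b)"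
  proof -
    have B: "Basis = range (\<lambda>i :: 3. axis i (1::real))"
      by (simp add: Basis_vec_def UNION_singleton_eq_range)
    have inj: "inj (\<lambda>i :: 3. axis i (1::real))"
      by (rule injI) (simp add: axis_eq_axis)
    have nth: "(u - l) \<bullet> axis i 1 = u $ i - l $ i" for i
      by (simp add: inner_axis)
    have "(\<Prod>b\<in>Basis. (u - l) \<bullet> b) = (\<Prod>i\<in>UNIV. u $ i - l $ i)"
      unfolding B prod.reindex[OF inj] o_def nth ..
    then show ?thesis
      unfolding UNIV_3 by (simp add: mult.assoc)
  qed
  finally show "emeasure (distr lborel borel vec3) (box l u) = ennreal (\<Prod>b\<in>Basis. (u - l) \<bullet> b)" .
qed simp

lemma lborel_integral_mult:
  fixes f :: "'a::euclidean_space \<Rightarrow> real" and g :: "'b::euclidean_space \<Rightarrow> real"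
  assumes f: "integrable lborel f" and g: "integrable lborel g"
  shows "integrable lborel (\<lambda>q. f (fst q) * g (snd q))"
    and "(\<integral>q. f (fst q) * g (snd q) \<partial>lborel) = (\<integral>x. f x \<partial>lborel) * (\<integral>y. g y \<partial>lborel)"
proof -
  have [measurable]: "f \<in> borel_measurable lborel" "g \<in> borel_measurable lborel"
    using f g by auto
  have int: "integrable (lborel \<Otimes>\<^sub>M lborel) (\<lambda>q. f (fst q) * g (snd q))"
  proof (rule lborel_pair.Fubini_integrable)
    show "integrable lborel (\<lambda>x. \<integral>y. norm (f (fst (x, y)) * g (snd (x, y))) \<partial>lborel)"
      using f by (simp add: abs_mult)
    show "AE x in lborel. integrable lborel (\<lambda>y. f (fst (x, y)) * g (snd (x, y)))"
      using g by simp
  qed measurable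
  then show "integrable lborel (\<lambda>q. f (fst q) * g (snd q))"
    by (simp add: lborel_prod)
  show "(\<integral>q. f (fst q) * g (snd q) \<partial>lborel) = (\<integral>x. f x \<partial>lborel) * (\<integral>y. g y \<partial>lborel)"
    using lborel_pair.integral_fst'[OF int] by (simp add: lborel_prod)
qed

lemma AE_lborel_nth_3:
  assumes "AE z in lborel. P z"
  shows "AE p :: real ^ 3 in lborel. P (p $ 3)"
proof -
  obtain N where "{z \<in> space lborel. \<not> P z} \<subseteq> N" "emeasure lborel N = 0" "N \<in> sets lborel"
    using assms by (rule AE_E)
  then have N: "{z. \<not> P z} \<subseteq> N" "N \<in> sets borel" "emeasure lborel N = 0"
    by simp_all
  define M where "M = {p :: real ^ 3. p $ 3 \<in> N}"
  have M: "M \<in> sets borel"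
    using N(2) measurable_sets[of "\<lambda>p :: real ^ 3. p $ 3" borel borel N]
    by (simp add: M_def vimage_def)
  have "vec3 -` M = UNIV \<times> N"
    by (auto simp: M_def)
  then have "emeasure (distr lborel borel vec3) M = emeasure (lborel \<Otimes>\<^sub>M lborel) ((UNIV :: (real \<times> real) set) \<times> N)"
    using M by (simp add: emeasure_distr lborel_prod)
  also have "\<dots> = 0"
    using N by (subst lborel.emeasure_pair_measure_Times) auto
  finally have "M \<in> null_sets lborel"
    using M by (auto simp: distr_vec3)
  then show ?thesis
    by (rule AE_I') (use N in \<open>auto simp: M_def\<close>)
qed

text \<open>The vertical factor is only Lebesgue measurable, whereas the product theorem is applied
  to Borel functions. It is replaced by a Borel version, and the exceptional null set of the line is
  lifted to a null set of space.\<close>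

lemma lebesgue_integral_vec3_mult:
  fixes f :: "real \<times> real \<Rightarrow> real" and g :: "real \<Rightarrow> real"
  assumes f: "integrable lborel f" and g: "integrable lebesgue g"
  shows "integrable lebesgue (\<lambda>p :: real ^ 3. f (p $ 1, p $ 2) * g (p $ 3))"
    and "(\<integral>p. f (p $ 1, p $ 2) * g (p $ 3) \<partial>(lebesgue :: (real ^ 3) measure)) = (\<integral>x. f x \<partial>lborel) * (\<integral>y. g y \<partial>lebesgue)"
proof -
  obtain g' where g' [measurable]: "g' \<in> borel_measurable lborel" and AE: "AE z in lborel. g z = g' z"
    using completion_ex_borel_measurable_real[OF borel_measurable_integrable[OF g]] by blast
  have [measurable]: "f \<in> borel_measurable lborel" using f by auto
  have AE': "AE z in lebesgue. g z = g' z"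
    by (rule AE_completion[OF AE])
  have "integrable lebesgue g'"
    using g by (rule integrable_cong_AE_imp) (use AE' in \<open>auto intro: measurable_completion simp: eq_commute\<close>)
  then have g'_int: "integrable lborel g'"
    by (simp add: integrable_completion)
  define h where "h p = f (p $ 1, p $ 2) * g' (p $ 3)" for p :: "real ^ 3"
  have h [measurable]: "h \<in> borel_measurable borel"
    unfolding h_def by measurable
  have hv: "h (vec3 q) = f (fst q) * g' (snd q)" for q
    by (simp add: h_def)
  have "integrable (distr lborel borel vec3) h"
    using lborel_integral_mult(1)[OF f g'_int] by (subst integrable_distr_eq) (auto simp: hv)
  then have h_int: "integrable lebesgue h"
    by (simp add: distr_vec3 integrable_completion)
  have "(\<integral>p. h p \<partial>lebesgue) = (\<integral>p. h p \<partial>distr lborel borel vec3)"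
    by (simp add: distr_vec3 integral_completion)
  also have "\<dots> = (\<integral>x. f x \<partial>lborel) * (\<integral>y. g' y \<partial>lborel)"
    by (subst integral_distr) (auto simp: hv lborel_integral_mult(2)[OF f g'_int])
  also have "(\<integral>y. g' y \<partial>lborel) = (\<integral>y. g' y \<partial>lebesgue)"
    by (simp add: integral_completion)
  also have "\<dots> = (\<integral>y. g y \<partial>lebesgue)"
    using AE' g by (intro integral_cong_AE) (auto intro: measurable_completion simp: eq_commute)
  finally have h_eq: "(\<integral>p. h p \<partial>lebesgue) = (\<integral>x. f x \<partial>lborel) * (\<integral>y. g y \<partial>lebesgue)" .
  have AEh: "AE p in lebesgue. h p = f (p $ 1, p $ 2) * g (p $ 3)"
    using AE_completion[OF AE_lborel_nth_3[OF AE]] by eventually_elim (simp add: h_def)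
  have "h \<in> borel_measurable lebesgue" using h_int by auto
  then have meas: "(\<lambda>p :: real ^ 3. f (p $ 1, p $ 2) * g (p $ 3)) \<in> borel_measurable lebesgue"
    by (rule borel_measurable_lebesgue_AE_cong) (use AEh in eventually_elim, simp)
  show "integrable lebesgue (\<lambda>p :: real ^ 3. f (p $ 1, p $ 2) * g (p $ 3))"
    using h_int meas AEh by (rule integrable_cong_AE_imp)
  show "(\<integral>p. f (p $ 1, p $ 2) * g (p $ 3) \<partial>(lebesgue :: (real ^ 3) measure)) = (\<integral>x. f x \<partial>lborel) * (\<integral>y. g y \<partial>lebesgue)"
    unfolding h_eq[symmetric] using h_int meas AEh by (intro integral_cong_AE) (auto simp: eq_commute)
qed

subsection \<open>Trial functions\<close>

text \<open>The parameter is \<open>s = sqrt \<rho>\<close>, so that \<open>x / s - s = (x - \<rho>) / s\<close>.\<close>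

definition trial :: "real \<Rightarrow> real ^ 3 \<Rightarrow> complex" where
  "trial s = tensor (\<lambda>x. of_real (bump (x / s - s))) (\<lambda>y. of_real (bump (y / s)))
    (\<lambda>z. exp (\<i> * of_real (ln (s\<^sup>2) * z)) * of_real (bump (z / s)))"

definition trial_box :: "real \<Rightarrow> (real ^ 3) set" where
  "trial_box s = {p. \<bar>p $ 1 - s\<^sup>2\<bar> \<le> s \<and> \<bar>p $ 2\<bar> \<le> s \<and> \<bar>p $ 3\<bar> \<le> s}"

lemma smooth_bump_scaled:
  "smooth (\<lambda>x. of_real (bump (x / s)) :: complex)" "smooth (\<lambda>x. of_real (bump (x / s - d)) :: complex)"
  using smooth_of_real_affine[OF smooth_bump, of "1 / s" 0]
    smooth_of_real_affine[OF smooth_bump, of "1 / s" "- d"] by simp_all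

text \<open>Both 1 + x and 1 - x are at least 1/2, so each factor of \<open>bump\<close> is at least
  exp (-2).\<close>

lemma bump_ge:
  assumes "\<bar>x\<bar> \<le> 1 / 2"
  shows "exp (- 4) \<le> bump x"
proof -
  have "exp (- 2) \<le> flat 0 t" if "1 / 2 \<le> t" for t
  proof -
    have "inverse t \<le> inverse (1 / 2)" using that by (intro le_imp_inverse_le) auto
    then show ?thesis using that by (simp add: flat_def)
  qed
  moreover have "0 \<le> flat 0 t" for t
    by (simp add: flat_def)
  ultimately have "exp (- 2) * exp (- 2) \<le> bump x"
    unfolding bump_def using assms by (intro mult_mono) (auto simp: abs_le_iff)
  then show ?thesis by (simp flip: exp_add)
qed

lemma bump_measurable [measurable]: "bump \<in> borel_measurable borel"
proof -
  have "(bump has_real_derivative (SOME d. (bump has_real_derivative d) (at x))) (at x)" for x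
    by (rule someI_ex) (meson bump_derivatives)
  then have "continuous_on UNIV bump"
    by (intro continuous_at_imp_continuous_on ballI DERIV_isCont)
  then show ?thesis by (rule borel_measurable_continuous_onI)
qed

lemma box_measure_integral:
  fixes s :: real
  assumes "0 < s"
  defines "f \<equiv> (\<lambda>q. indicator {s\<^sup>2 - s..s\<^sup>2 + s} (fst q) * indicator {- s..s} (snd q) :: real)"
  shows "integrable lborel f"
    and "integrable lebesgue (indicat_real (trial_box s))"
    and "(\<integral>p. indicat_real (trial_box s) p \<partial>lebesgue) = 8 * s ^ 3"
proof -
  have i1: "integrable lborel (indicat_real {s\<^sup>2 - s..s\<^sup>2 + s})" "integrable lborel (indicat_real {- s..s})"
    by (auto intro!: integrable_real_indicator simp: emeasure_lborel_Icc_eq)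
  show f: "integrable lborel f"
    unfolding f_def by (rule lborel_integral_mult(1)[OF i1])
  have fi: "(\<integral>q. f q \<partial>lborel) = 2 * s * (2 * s)"
    unfolding f_def lborel_integral_mult(2)[OF i1] using assms(1) by simp
  have g: "integrable lebesgue (indicat_real {- s..s})"
    using i1(2) by (simp add: integrable_completion)
  have gi: "(\<integral>z. indicat_real {- s..s} z \<partial>lebesgue) = 2 * s"
    using assms(1) by (simp add: integral_completion)
  have eq: "f (p $ 1, p $ 2) * indicat_real {- s..s} (p $ 3) = indicat_real (trial_box s) p" for p :: "real ^ 3"
    by (auto simp: f_def trial_box_def indicator_def abs_le_iff)
  show "integrable lebesgue (indicat_real (trial_box s))"
    using lebesgue_integral_vec3_mult(1)[OF f g] unfolding eq .
  show "(\<integral>p. indicat_real (trial_box s) p \<partial>lebesgue) = 8 * s ^ 3"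
    using lebesgue_integral_vec3_mult(2)[OF f g] unfolding eq fi gi by (simp add: power3_eq_cube)
qed

text \<open>On the box r lies between s^2 - s and s^2 + 2 s, a relative deviation of order 1 / s,
  and ln t <= t - 1 is applied to both quotients. Squared, the bound is of order 1 / s^2, the same
  as the kinetic cost of a bump of width s.\<close>

lemma ln_radius_trial_box:
  assumes "4 \<le> s" "p \<in> trial_box s"
  shows "\<bar>ln (s\<^sup>2) - ln_radius p\<bar> \<le> 2 / s"
proof -
  define r where "r = sqrt ((p $ 1)\<^sup>2 + (p $ 2)\<^sup>2)"
  have p: "s\<^sup>2 - s \<le> p $ 1" "p $ 1 \<le> s\<^sup>2 + s" "\<bar>p $ 2\<bar> \<le> s"
    using assms(2) by (auto simp: trial_box_def abs_le_iff)
  have "4 * s \<le> s\<^sup>2" using assms(1) by (simp add: power2_eq_square)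
  have "\<bar>p $ 1\<bar> \<le> r" unfolding r_def by (intro real_le_rsqrt) simp
  then have r1: "s\<^sup>2 - s \<le> r" using p by simp
  have "r \<le> \<bar>p $ 1\<bar> + \<bar>p $ 2\<bar>" unfolding r_def by (rule sqrt_sum_squares_le_sum_abs)
  then have r2: "r \<le> s\<^sup>2 + 2 * s" using p \<open>4 * s \<le> s\<^sup>2\<close> assms(1) by simp
  have r0: "0 < r" using r1 \<open>4 * s \<le> s\<^sup>2\<close> assms(1) by linarith
  have s0: "0 < s" using assms(1) by simp
  have "ln (r / s\<^sup>2) \<le> r / s\<^sup>2 - 1"
    using r0 s0 by (intro ln_le_minus_one) simp
  also have "\<dots> \<le> (s\<^sup>2 + 2 * s) / s\<^sup>2 - 1"
    using r2 by (intro diff_right_mono divide_right_mono) auto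
  also have "\<dots> = 2 / s"
    using s0 by (simp add: add_divide_distrib power2_eq_square)
  finally have 1: "ln_radius p - ln (s\<^sup>2) \<le> 2 / s"
    using r0 s0 by (simp add: ln_radius_def ln_div flip: r_def)
  have "ln (s\<^sup>2 / r) \<le> s\<^sup>2 / r - 1"
    using r0 s0 by (intro ln_le_minus_one) simp
  also have "\<dots> \<le> 2 / s"
  proof -
    have "s * s\<^sup>2 \<le> 2 * (s\<^sup>2 - s) + s * (s\<^sup>2 - s)"
      using \<open>4 * s \<le> s\<^sup>2\<close> s0 by (simp add: algebra_simps power2_eq_square)
    also have "\<dots> \<le> 2 * r + s * r" using r1 s0 by (intro add_mono mult_left_mono) auto
    finally show ?thesis using r0 s0 by (simp add: field_simps)
  qed
  finally have 2: "ln (s\<^sup>2) - ln_radius p \<le> 2 / s"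
    using r0 s0 by (simp add: ln_radius_def ln_div flip: r_def)
  from 1 2 show ?thesis by (simp add: abs_le_iff)
qed

section \<open>Energy density of the trial functions\<close>

locale bump_bounds =
  fixes b1 b2 :: "real \<Rightarrow> real" and B :: real
  assumes bump_deriv: "\<And>x. (bump has_real_derivative b1 x) (at x)"
    and b1_deriv: "\<And>x. (b1 has_real_derivative b2 x) (at x)"
    and bump_le: "\<And>x. \<bar>bump x\<bar> \<le> B" and b1_le: "\<And>x. \<bar>b1 x\<bar> \<le> B" and b2_le: "\<And>x. \<bar>b2 x\<bar> \<le> B"
    and B_ge: "1 \<le> B"
    and b1_eq_0: "\<And>x. 1 < \<bar>x\<bar> \<Longrightarrow> b1 x = 0" and b2_eq_0: "\<And>x. 1 < \<bar>x\<bar> \<Longrightarrow> b2 x = 0"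
    and b1_cont: "continuous_on UNIV b1" and b2_cont: "continuous_on UNIV b2"
begin

lemma b_measurable [measurable]: "b1 \<in> borel_measurable borel" "b2 \<in> borel_measurable borel"
  using b1_cont b2_cont by (auto intro: borel_measurable_continuous_onI)

lemma scaled_derivs:
  assumes "s \<noteq> 0"
  shows "((\<lambda>x. of_real (bump (x / s - d)) :: complex) has_vector_derivative of_real (b1 (x / s - d) / s)) (at x)"
    "((\<lambda>x. of_real (b1 (x / s - d) / s) :: complex) has_vector_derivative of_real (b2 (x / s - d) / s\<^sup>2)) (at x)"
proof -
  have a: "((\<lambda>x. x / s - d) has_real_derivative 1 / s) (at x)"
    using assms by (auto intro!: derivative_eq_intros)
  have "((\<lambda>x. bump (x / s - d)) has_real_derivative b1 (x / s - d) * (1 / s)) (at x)"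
    by (rule DERIV_chain2[OF bump_deriv a])
  then show "((\<lambda>x. of_real (bump (x / s - d)) :: complex) has_vector_derivative of_real (b1 (x / s - d) / s)) (at x)"
    by (intro has_vector_derivative_of_real) simp
  have "((\<lambda>x. b1 (x / s - d) / s) has_real_derivative b2 (x / s - d) * (1 / s) / s) (at x)"
    by (rule DERIV_cdivide[OF DERIV_chain2[OF b1_deriv a]])
  then show "((\<lambda>x. of_real (b1 (x / s - d) / s) :: complex) has_vector_derivative of_real (b2 (x / s - d) / s\<^sup>2)) (at x)"
    by (intro has_vector_derivative_of_real) (simp add: power2_eq_square)
qed

text \<open>Real part of the magnetic Laplacian of \<open>trial s\<close> after the phase is divided
  out. As the amplitude is real, this part alone enters the quadratic form; \<open>energy_im\<close>
  enters the bound that places the Laplacian in L^2.\<close>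

definition energy_re :: "real \<Rightarrow> real ^ 3 \<Rightarrow> real" where
  "energy_re s p = - (b2 (p $ 1 / s - s) * bump (p $ 2 / s) * bump (p $ 3 / s)
      + bump (p $ 1 / s - s) * b2 (p $ 2 / s) * bump (p $ 3 / s)
      + bump (p $ 1 / s - s) * bump (p $ 2 / s) * b2 (p $ 3 / s)) / s\<^sup>2
    + (ln (s\<^sup>2) - ln_radius p)\<^sup>2 * (bump (p $ 1 / s - s) * bump (p $ 2 / s) * bump (p $ 3 / s))"

definition energy_im :: "real \<Rightarrow> real ^ 3 \<Rightarrow> real" where
  "energy_im s p = - 2 * (ln (s\<^sup>2) - ln_radius p) * (bump (p $ 1 / s - s) * bump (p $ 2 / s) * b1 (p $ 3 / s)) / s"

definition amplitude :: "real \<Rightarrow> real ^ 3 \<Rightarrow> real" where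
  "amplitude s p = bump (p $ 1 / s - s) * bump (p $ 2 / s) * bump (p $ 3 / s)"

lemma trial_amplitude: "trial s p = exp (\<i> * of_real (ln (s\<^sup>2) * p $ 3)) * of_real (amplitude s p)"
  by (simp add: trial_def tensor_def amplitude_def)

lemma trial_Ck: "Ck k (trial s)"
  unfolding trial_def by (intro Ck_tensor smooth_exp_i_mult smooth_bump_scaled)

text \<open>The phase of frequency k acts as a gauge change, replacing D_z - l by D_z + (k - l). The
  factors and their derivatives are abstracted to letters so that the identity is pure
  algebra.\<close>

lemma trial_laplacian_algebra:
  fixes E :: complex and X0 X2 Y0 Y2 Z0 Z1 Z2 k l s :: real
  assumes "s \<noteq> 0"
  shows "- (of_real (X2 / s\<^sup>2) * of_real Y0 * (E * of_real Z0))
      - of_real X0 * of_real (Y2 / s\<^sup>2) * (E * of_real Z0)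
      - of_real X0 * of_real Y0 * (E * (- (of_real k)\<^sup>2 * of_real Z0
          + 2 * \<i> * of_real k * of_real (Z1 / s) + of_real (Z2 / s\<^sup>2)))
      + 2 * \<i> * of_real l * (of_real X0 * of_real Y0 * (E * (\<i> * of_real k * of_real Z0 + of_real (Z1 / s))))
      + (of_real l)\<^sup>2 * (of_real X0 * of_real Y0 * (E * of_real Z0))
    = E * (of_real (- (X2 * Y0 * Z0 + X0 * Y2 * Z0 + X0 * Y0 * Z2) / s\<^sup>2 + (k - l)\<^sup>2 * (X0 * Y0 * Z0))
      + \<i> * of_real (- 2 * (k - l) * (X0 * Y0 * Z1) / s))"
  by (simp add: algebra_simps power2_eq_square add_divide_distrib diff_divide_distrib)

lemma magnetic_laplacian_trial:
  assumes "0 < s"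
  shows "magnetic_laplacian A_pot (trial s) p
    = exp (\<i> * of_real (ln (s\<^sup>2) * p $ 3)) * Complex (energy_re s p) (energy_im s p)"
proof -
  define k where "k = ln (s\<^sup>2)"
  define e where "e z = exp (\<i> * of_real (k * z))" for z
  have e: "(e has_vector_derivative \<i> * of_real k * e z) (at z)" for z
    unfolding e_def by (rule exp_i_has_vector_derivative)
  have s: "s \<noteq> 0" using assms by simp
  note f = scaled_derivs[OF s, of s]
  note g = scaled_derivs[OF s, of 0, simplified]
  define f0 f1 f2 g0 g1 g2 :: "real \<Rightarrow> complex" where
    "f0 = (\<lambda>x. of_real (bump (x / s - s)))" and "f1 = (\<lambda>x. of_real (b1 (x / s - s) / s))" and
    "f2 = (\<lambda>x. of_real (b2 (x / s - s) / s\<^sup>2))" and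
    "g0 = (\<lambda>x. of_real (bump (x / s)))" and "g1 = (\<lambda>x. of_real (b1 (x / s) / s))" and
    "g2 = (\<lambda>x. of_real (b2 (x / s) / s\<^sup>2))"
  note defs = f0_def f1_def f2_def g0_def g1_def g2_def
  have df: "(f0 has_vector_derivative f1 x) (at x)" "(f1 has_vector_derivative f2 x) (at x)" for x
    unfolding defs by (rule f)+
  have dg: "(g0 has_vector_derivative g1 x) (at x)" "(g1 has_vector_derivative g2 x) (at x)" for x
    unfolding defs using g by simp_all
  define h0 h1 h2 where
    "h0 = (\<lambda>z. e z * g0 z)" and "h1 = (\<lambda>z. e z * (\<i> * of_real k * g0 z + g1 z))" and
    "h2 = (\<lambda>z. e z * (- (of_real k)\<^sup>2 * g0 z + 2 * \<i> * of_real k * g1 z + g2 z))"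
  have dh: "(h0 has_vector_derivative h1 z) (at z)" "(h1 has_vector_derivative h2 z) (at z)" for z
  proof -
    have "(h0 has_vector_derivative (e z * g1 z + (\<i> * of_real k * e z) * g0 z)) (at z)"
      unfolding h0_def by (intro has_vector_derivative_mult e dg)
    then show "(h0 has_vector_derivative h1 z) (at z)"
      by (simp add: h1_def algebra_simps)
    have "(h1 has_vector_derivative (e z * (\<i> * of_real k * g1 z + g2 z)
        + (\<i> * of_real k * e z) * (\<i> * of_real k * g0 z + g1 z))) (at z)"
      unfolding h1_def
      by (intro has_vector_derivative_mult has_vector_derivative_add has_vector_derivative_mult_right e dg)
    then show "(h1 has_vector_derivative h2 z) (at z)"
      by (simp add: h2_def algebra_simps power2_eq_square)
  qed
  have trial: "trial s = tensor f0 g0 h0"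
    by (simp add: trial_def defs h0_def e_def k_def)
  have P: "partial_deriv 1 (partial_deriv 1 (trial s)) = tensor f2 g0 h0"
    "partial_deriv 2 (partial_deriv 2 (trial s)) = tensor f0 g2 h0"
    "partial_deriv 3 (partial_deriv 3 (trial s)) = tensor f0 g0 h2"
    "partial_deriv 3 (trial s) = tensor f0 g0 h1"
    unfolding trial partial_deriv_tensor[OF df(1) dg(1) dh(1)]
      partial_deriv_tensor[OF df(2) dg(1) dh(1)] partial_deriv_tensor[OF df(1) dg(2) dh(1)]
      partial_deriv_tensor[OF df(1) dg(1) dh(2)] by (rule refl)+
  have C: "Complex a b = of_real a + \<i> * of_real b" for a b
    by (rule complex_eqI) simp_all
  show ?thesis
    unfolding magnetic_laplacian_expand[OF trial_Ck] P(1,2,3)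
    unfolding P(4)
    unfolding trial tensor_def h0_def h1_def h2_def defs C energy_re_def energy_im_def
      k_def[symmetric] e_def[symmetric]
    by (rule trial_laplacian_algebra[OF s])
qed

lemma bump_outside: "1 < \<bar>x\<bar> \<Longrightarrow> bump x = 0"
  by (simp add: bump_eq_0)

lemma outside_trial_box:
  assumes "0 < s" "p \<notin> trial_box s"
  shows "amplitude s p = 0" "energy_re s p = 0" "energy_im s p = 0"
proof -
  consider "s < \<bar>p $ 1 - s\<^sup>2\<bar>" | "s < \<bar>p $ 2\<bar>" | "s < \<bar>p $ 3\<bar>"
    using assms(2) by (auto simp: trial_box_def)
  then have "amplitude s p = 0 \<and> energy_re s p = 0 \<and> energy_im s p = 0"
  proof cases
    case 1
    have "p $ 1 / s - s = (p $ 1 - s\<^sup>2) / s"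
      using assms(1) by (simp add: diff_divide_distrib power2_eq_square)
    then have "1 < \<bar>p $ 1 / s - s\<bar>"
      using 1 assms(1) by (simp add: abs_divide)
    then show ?thesis
      by (simp add: amplitude_def energy_re_def energy_im_def bump_outside b2_eq_0)
  next
    case 2
    then have "1 < \<bar>p $ 2 / s\<bar>"
      using assms(1) by (simp add: abs_divide)
    then show ?thesis
      by (simp add: amplitude_def energy_re_def energy_im_def bump_outside b2_eq_0)
  next
    case 3
    then have "1 < \<bar>p $ 3 / s\<bar>"
      using assms(1) by (simp add: abs_divide)
    then show ?thesis
      by (simp add: amplitude_def energy_re_def energy_im_def bump_outside b1_eq_0 b2_eq_0)
  qed
  then show "amplitude s p = 0" "energy_re s p = 0" "energy_im s p = 0" by auto
qed

lemma abs_triple_product_le: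
  fixes x y z :: real
  assumes "\<bar>x\<bar> \<le> B" "\<bar>y\<bar> \<le> B" "\<bar>z\<bar> \<le> B"
  shows "\<bar>x * y * z\<bar> \<le> B ^ 3"
  unfolding power3_eq_cube abs_mult using assms B_ge by (intro mult_mono) auto

text \<open>The constant 7 collects three second derivatives and the 4 from (2 / s)^2; the 4 of the
  imaginary part is 2 times the 2 in 2 / s.\<close>

lemma trial_bounds:
  assumes "4 \<le> s" "p \<in> trial_box s"
  shows "\<bar>amplitude s p\<bar> \<le> B ^ 3" "\<bar>energy_re s p\<bar> \<le> 7 * B ^ 3 / s\<^sup>2" "\<bar>energy_im s p\<bar> \<le> 4 * B ^ 3 / s\<^sup>2"
proof -
  note le = bump_le b1_le b2_le
  have ln_radius: "\<bar>ln (s\<^sup>2) - ln_radius p\<bar> \<le> 2 / s"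
    by (rule ln_radius_trial_box[OF assms])
  then have "\<bar>ln (s\<^sup>2) - ln_radius p\<bar>\<^sup>2 \<le> (2 / s)\<^sup>2"
    by (intro power_mono) auto
  then have ell2: "(ln (s\<^sup>2) - ln_radius p)\<^sup>2 \<le> 4 / s\<^sup>2"
    by (simp add: power_divide)
  show amp: "\<bar>amplitude s p\<bar> \<le> B ^ 3"
    unfolding amplitude_def by (intro abs_triple_product_le le)
  define T where "T = b2 (p $ 1 / s - s) * bump (p $ 2 / s) * bump (p $ 3 / s)
      + bump (p $ 1 / s - s) * b2 (p $ 2 / s) * bump (p $ 3 / s)
      + bump (p $ 1 / s - s) * bump (p $ 2 / s) * b2 (p $ 3 / s)"
  have "\<bar>T\<bar> \<le> B ^ 3 + B ^ 3 + B ^ 3"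
    unfolding T_def by (intro order_trans[OF abs_triangle_ineq] add_mono abs_triple_product_le le)
  then have "\<bar>- T / s\<^sup>2\<bar> \<le> 3 * B ^ 3 / s\<^sup>2"
    by (simp add: abs_divide divide_right_mono)
  moreover have "\<bar>(ln (s\<^sup>2) - ln_radius p)\<^sup>2 * amplitude s p\<bar> \<le> 4 / s\<^sup>2 * B ^ 3"
    unfolding abs_mult using ell2 amp by (intro mult_mono) auto
  moreover have "energy_re s p = - T / s\<^sup>2 + (ln (s\<^sup>2) - ln_radius p)\<^sup>2 * amplitude s p"
    by (simp add: energy_re_def T_def amplitude_def)
  ultimately have "\<bar>energy_re s p\<bar> \<le> 3 * B ^ 3 / s\<^sup>2 + 4 / s\<^sup>2 * B ^ 3"
    by linarith
  then show "\<bar>energy_re s p\<bar> \<le> 7 * B ^ 3 / s\<^sup>2"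
    by (simp flip: add_divide_distrib)
  have "\<bar>energy_im s p\<bar> = 2 * \<bar>ln (s\<^sup>2) - ln_radius p\<bar> * \<bar>bump (p $ 1 / s - s) * bump (p $ 2 / s) * b1 (p $ 3 / s)\<bar> / s"
    using assms(1) by (simp only: energy_im_def abs_divide abs_mult) simp
  also have "\<dots> \<le> 2 * (2 / s) * B ^ 3 / s"
    using assms(1) ln_radius by (intro divide_right_mono mult_mono abs_triple_product_le le) auto
  also have "\<dots> = 4 * B ^ 3 / s\<^sup>2"
    by (simp add: power2_eq_square)
  finally show "\<bar>energy_im s p\<bar> \<le> 4 * B ^ 3 / s\<^sup>2" .
qed

lemma energy_measurable [measurable]:
  "amplitude s \<in> borel_measurable borel" "energy_re s \<in> borel_measurable borel"
  "energy_im s \<in> borel_measurable borel"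
  unfolding amplitude_def[abs_def] energy_re_def[abs_def] energy_im_def[abs_def] by measurable

lemma square_integrable_trial_box:
  fixes f :: "real ^ 3 \<Rightarrow> complex"
  assumes "f \<in> borel_measurable borel" "0 < s" "\<And>p. p \<in> trial_box s \<Longrightarrow> cmod (f p) \<le> c"
    "\<And>p. p \<notin> trial_box s \<Longrightarrow> f p = 0"
  shows "square_integrable f"
  unfolding square_integrable_def
proof
  show f: "f \<in> borel_measurable lebesgue"
    using assms(1) by (intro measurable_completion) simp
  show "integrable lebesgue (\<lambda>p. (cmod (f p))\<^sup>2)"
  proof (rule Bochner_Integration.integrable_bound)
    show "integrable lebesgue (\<lambda>p. c\<^sup>2 * indicat_real (trial_box s) p)"
      using box_measure_integral(2)[OF assms(2)] by simp
    show "AE p in lebesgue. norm ((cmod (f p))\<^sup>2) \<le> norm (c\<^sup>2 * indicat_real (trial_box s) p)"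
    proof (intro AE_I2)
      show "norm ((cmod (f p))\<^sup>2) \<le> norm (c\<^sup>2 * indicat_real (trial_box s) p)" for p
      proof (cases "p \<in> trial_box s")
        case True
        then have "(cmod (f p))\<^sup>2 \<le> c\<^sup>2" using assms(3) by (intro power_mono) auto
        with True show ?thesis by simp
      qed (simp add: assms(4))
    qed
  qed (use f in measurable)
qed

lemma trial_laplacian_eq:
  assumes "0 < s"
  shows "magnetic_laplacian A_pot (trial s)
    = (\<lambda>p. exp (\<i> * of_real (ln (s\<^sup>2) * p $ 3)) * (of_real (energy_re s p) + \<i> * of_real (energy_im s p)))"
  by (rule ext) (simp add: magnetic_laplacian_trial[OF assms] Complex_eq)

lemma trial_square_integrable:
  assumes "4 \<le> s"
  shows "square_integrable (trial s)" "square_integrable (magnetic_laplacian A_pot (trial s))"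
proof -
  have s: "0 < s" using assms by simp
  show "square_integrable (trial s)"
  proof (rule square_integrable_trial_box[OF _ s])
    show "trial s \<in> borel_measurable borel"
      unfolding trial_amplitude[abs_def] by measurable
    show "cmod (trial s p) \<le> B ^ 3" if "p \<in> trial_box s" for p
      using trial_bounds(1)[OF assms that] by (simp add: trial_amplitude norm_mult)
    show "trial s p = 0" if "p \<notin> trial_box s" for p
      using outside_trial_box[OF s that] by (simp add: trial_amplitude)
  qed
  show "square_integrable (magnetic_laplacian A_pot (trial s))"
  proof (rule square_integrable_trial_box[OF _ s])
    show "magnetic_laplacian A_pot (trial s) \<in> borel_measurable borel"
      unfolding trial_laplacian_eq[OF s] by measurable
    show "cmod (magnetic_laplacian A_pot (trial s) p) \<le> 7 * B ^ 3 / s\<^sup>2 + 4 * B ^ 3 / s\<^sup>2"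
      if "p \<in> trial_box s" for p
    proof -
      have "cmod (of_real (energy_re s p) + \<i> * of_real (energy_im s p)) \<le> \<bar>energy_re s p\<bar> + \<bar>energy_im s p\<bar>"
        by (rule order_trans[OF norm_triangle_ineq]) (simp add: norm_mult)
      with trial_bounds(2,3)[OF assms that] show ?thesis
        unfolding trial_laplacian_eq[OF s] norm_mult by simp
    qed
    show "magnetic_laplacian A_pot (trial s) p = 0" if "p \<notin> trial_box s" for p
      using outside_trial_box[OF s that] by (simp add: trial_laplacian_eq[OF s])
  qed
qed

lemma test_function_trial:
  assumes "0 < s"
  shows "test_function (trial s)"
proof -
  have "norm p \<le> (s\<^sup>2 + s) + s + s" if "p \<in> trial_box s" for p
  proof -
    have "norm p \<le> \<bar>p $ 1\<bar> + \<bar>p $ 2\<bar> + \<bar>p $ 3\<bar>"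
      using norm_le_l1_cart[of p] by (simp add: sum_3)
    moreover have "\<bar>p $ 1\<bar> \<le> s\<^sup>2 + s" "\<bar>p $ 2\<bar> \<le> s" "\<bar>p $ 3\<bar> \<le> s"
      using that zero_le_power2[of s] assms unfolding trial_box_def mem_Collect_eq by linarith+
    ultimately show ?thesis by linarith
  qed
  then have "bounded (trial_box s)" by (auto simp: bounded_iff)
  moreover have "{p. trial s p \<noteq> 0} \<subseteq> trial_box s"
    using outside_trial_box[OF assms] by (auto simp: trial_amplitude)
  ultimately have "bounded {p. trial s p \<noteq> 0}" by (rule bounded_subset)
  then show ?thesis by (simp add: test_function_def trial_Ck)
qed

text \<open>The common phase has modulus one and cancels in the inner product.\<close>

lemma inner_trial:
  assumes "0 < s"
  shows "magnetic_laplacian A_pot (trial s) p \<bullet> trial s p = energy_re s p * amplitude s p"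
    "trial s p \<bullet> trial s p = (amplitude s p)\<^sup>2"
proof -
  define e where "e = exp (\<i> * of_real (ln (s\<^sup>2) * p $ 3))"
  have "(e * z) \<bullet> (e * w) = (cmod e)\<^sup>2 * (z \<bullet> w)" for z w
    unfolding inner_complex_def cmod_power2 by (simp add: power2_eq_square algebra_simps)
  then have e: "(e * z) \<bullet> (e * w) = z \<bullet> w" for z w
    by (simp add: e_def)
  show "magnetic_laplacian A_pot (trial s) p \<bullet> trial s p = energy_re s p * amplitude s p"
    unfolding magnetic_laplacian_trial[OF assms] trial_amplitude e[unfolded e_def]
    by (simp add: inner_complex_def)
  show "trial s p \<bullet> trial s p = (amplitude s p)\<^sup>2"
    unfolding trial_amplitude e[unfolded e_def]
    by (simp add: inner_complex_def power2_eq_square)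
qed

text \<open>A density of at most 7 B^6 / s^2 on a box of volume 8 s^3 gives 56 B^6 s.\<close>

lemma energy_integral:
  assumes "4 \<le> s"
  shows "integrable lebesgue (\<lambda>p. energy_re s p * amplitude s p)"
    and "(\<integral>p. energy_re s p * amplitude s p \<partial>lebesgue) \<le> 56 * B ^ 6 * s"
proof -
  have s: "0 < s" using assms by simp
  show int: "integrable lebesgue (\<lambda>p. energy_re s p * amplitude s p)"
    using integrable_inner_square_integrable[OF trial_square_integrable(2,1)[OF assms]]
    by (simp add: inner_trial[OF s])
  have int': "integrable lebesgue (\<lambda>p. 7 * B ^ 6 / s\<^sup>2 * indicat_real (trial_box s) p)"
    using box_measure_integral(2)[OF s] by simp
  have "(\<integral>p. energy_re s p * amplitude s p \<partial>lebesgue)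
      \<le> (\<integral>p. 7 * B ^ 6 / s\<^sup>2 * indicat_real (trial_box s) p \<partial>lebesgue)"
  proof (rule integral_mono[OF int int'])
    show "energy_re s p * amplitude s p \<le> 7 * B ^ 6 / s\<^sup>2 * indicat_real (trial_box s) p" for p
    proof (cases "p \<in> trial_box s")
      case True
      have "\<bar>energy_re s p * amplitude s p\<bar> \<le> (7 * B ^ 3 / s\<^sup>2) * B ^ 3"
        unfolding abs_mult using trial_bounds[OF assms True] by (intro mult_mono) auto
      also have "\<dots> = 7 * B ^ 6 / s\<^sup>2" by (simp flip: power_add)
      finally show ?thesis using True by simp
    qed (simp add: outside_trial_box[OF s])
  qed
  also have "\<dots> = 7 * B ^ 6 / s\<^sup>2 * (8 * s ^ 3)"
    by (simp only: integral_mult_right_zero box_measure_integral(3)[OF s])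
  also have "\<dots> = 56 * B ^ 6 * s"
    using s by (simp add: power2_eq_square power3_eq_cube)
  finally show "(\<integral>p. energy_re s p * amplitude s p \<partial>lebesgue) \<le> 56 * B ^ 6 * s" .
qed

section \<open>Lower bounds for the potential term\<close>

text \<open>The lower bound uses only the concentric square of side s, of area s^2. There the two
  bumps contribute at least exp (-8), squared to exp (-16), and the bracket is at most 1 + s^2 + s,
  hence at most 2 s^2.\<close>

lemma horizontal_integral:
  fixes \<alpha> s :: real
  assumes "4 \<le> s" "0 < \<alpha>"
  defines "G \<equiv> (\<lambda>q :: real \<times> real. japanese_bracket q powr (- \<alpha>) * (bump (fst q / s - s) * bump (snd q / s))\<^sup>2)"
  shows "integrable lborel G" and "(2 * s\<^sup>2) powr (- \<alpha>) * exp (- 16) * s\<^sup>2 \<le> (\<integral>q. G q \<partial>lborel)"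
proof -
  have s: "0 < s" using assms by simp
  have jb: "1 \<le> japanese_bracket q" for q :: "real \<times> real"
    by (simp add: japanese_bracket_def)
  have [measurable]: "(\<lambda>q :: real \<times> real. japanese_bracket q) \<in> borel_measurable borel"
    unfolding japanese_bracket_def by (intro borel_measurable_continuous_onI continuous_intros)
  have [measurable]: "(\<lambda>q :: real \<times> real. bump (fst q / s - s)) \<in> borel_measurable borel"
    "(\<lambda>q :: real \<times> real. bump (snd q / s)) \<in> borel_measurable borel"
    using s by (auto intro!: measurable_compose[OF borel_measurable_continuous_onI bump_measurable]
        continuous_intros)
  have G_meas [measurable]: "G \<in> borel_measurable borel"
    unfolding G_def by measurable
  define f where "f = (\<lambda>q. indicator {s\<^sup>2 - s..s\<^sup>2 + s} (fst q) * indicator {- s..s} (snd q) :: real)"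
  have f: "integrable lborel f"
    unfolding f_def by (rule box_measure_integral(1)[OF s])
  have G_nonneg: "0 \<le> G q" for q
    by (simp add: G_def)
  show G_int: "integrable lborel G"
  proof (rule Bochner_Integration.integrable_bound)
    show "integrable lborel (\<lambda>q. (B * B)\<^sup>2 * f q)" using f by simp
    show "AE q in lborel. norm (G q) \<le> norm ((B * B)\<^sup>2 * f q)"
    proof (intro AE_I2)
      fix q :: "real \<times> real"
      show "norm (G q) \<le> norm ((B * B)\<^sup>2 * f q)"
      proof (cases "\<bar>fst q - s\<^sup>2\<bar> \<le> s \<and> \<bar>snd q\<bar> \<le> s")
        case True
        then have "f q = 1" by (auto simp: f_def indicator_def abs_le_iff)
        have "\<bar>bump (fst q / s - s) * bump (snd q / s)\<bar> \<le> B * B"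
          unfolding abs_mult using bump_le B_ge by (intro mult_mono) auto
        then have "\<bar>bump (fst q / s - s) * bump (snd q / s)\<bar>\<^sup>2 \<le> (B * B)\<^sup>2"
          by (intro power_mono) auto
        moreover have "japanese_bracket q powr (- \<alpha>) \<le> 1"
          using powr_mono[of "- \<alpha>" 0 "japanese_bracket q"] jb[of q] assms(2) by simp
        ultimately have "G q \<le> 1 * (B * B)\<^sup>2"
          unfolding G_def by (intro mult_mono) auto
        then show ?thesis using G_nonneg[of q] \<open>f q = 1\<close> by simp
      next
        case False
        then consider "s < \<bar>fst q - s\<^sup>2\<bar>" | "s < \<bar>snd q\<bar>" by linarith
        then have "bump (fst q / s - s) * bump (snd q / s) = 0"
        proof cases
          case 1
          have "fst q / s - s = (fst q - s\<^sup>2) / s"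
            using s by (simp add: diff_divide_distrib power2_eq_square)
          then have "1 < \<bar>fst q / s - s\<bar>" using 1 s by (simp add: abs_divide)
          then show ?thesis by (simp add: bump_outside)
        next
          case 2
          then have "1 < \<bar>snd q / s\<bar>" using s by (simp add: abs_divide)
          then show ?thesis by (simp add: bump_outside)
        qed
        then show ?thesis by (auto simp: G_def)
      qed
    qed
  qed simp
  define g where "g = (\<lambda>q. indicator {s\<^sup>2 - s / 2..s\<^sup>2 + s / 2} (fst q) * indicator {- s / 2..s / 2} (snd q) :: real)"
  have i: "integrable lborel (indicat_real {s\<^sup>2 - s / 2..s\<^sup>2 + s / 2})" "integrable lborel (indicat_real {- s / 2..s / 2})"
    by (auto intro!: integrable_real_indicator simp: emeasure_lborel_Icc_eq)
  have g: "integrable lborel g" "(\<integral>q. g q \<partial>lborel) = s\<^sup>2"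
    unfolding g_def using lborel_integral_mult[OF i] s by (simp_all add: power2_eq_square)
  define c where "c = (2 * s\<^sup>2) powr (- \<alpha>) * exp (- 16)"
  have "c * s\<^sup>2 = (\<integral>q. c * g q \<partial>lborel)"
    by (simp add: g)
  also have "\<dots> \<le> (\<integral>q. G q \<partial>lborel)"
  proof (rule integral_mono)
    show "c * g q \<le> G q" for q
    proof (cases "\<bar>fst q - s\<^sup>2\<bar> \<le> s / 2 \<and> \<bar>snd q\<bar> \<le> s / 2")
      case True
      have "fst q / s - s = (fst q - s\<^sup>2) / s"
        using s by (simp add: diff_divide_distrib power2_eq_square)
      then have "\<bar>fst q / s - s\<bar> \<le> 1 / 2" "\<bar>snd q / s\<bar> \<le> 1 / 2"
        using True s by (simp_all add: abs_divide field_simps)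
      then have "exp (- 4) * exp (- 4) \<le> bump (fst q / s - s) * bump (snd q / s)"
        by (intro mult_mono bump_ge) (auto simp: bump_nonneg)
      then have "(exp (- 4) * exp (- 4))\<^sup>2 \<le> (bump (fst q / s - s) * bump (snd q / s))\<^sup>2"
        by (intro power_mono) auto
      then have 1: "exp (- 16) \<le> (bump (fst q / s - s) * bump (snd q / s))\<^sup>2"
        by (simp add: power2_eq_square flip: exp_add)
      have "japanese_bracket q \<le> 2 * s\<^sup>2"
        unfolding japanese_bracket_def
      proof (rule real_le_lsqrt)
        have "4 * s \<le> s\<^sup>2" using assms(1) by (simp add: power2_eq_square)
        have n: "norm q \<le> \<bar>fst q\<bar> + \<bar>snd q\<bar>"
          using sqrt_sum_squares_le_sum_abs[of "fst q" "snd q"] by (simp add: norm_prod_def)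
        have "1 + norm q \<le> 2 * s\<^sup>2"
          using n True \<open>4 * s \<le> s\<^sup>2\<close> assms(1) by (auto simp: abs_le_iff abs_if split: if_splits)
        moreover have "1 + (norm q)\<^sup>2 \<le> (1 + norm q)\<^sup>2" by (simp add: power2_eq_square algebra_simps)
        ultimately show "1 + (norm q)\<^sup>2 \<le> (2 * s\<^sup>2)\<^sup>2"
          by (meson order_trans power_mono add_nonneg_nonneg norm_ge_zero zero_le_one)
      qed simp
      then have "(2 * s\<^sup>2) powr (- \<alpha>) \<le> japanese_bracket q powr (- \<alpha>)"
        using jb[of q] assms(2) by (intro powr_mono2') auto
      then have "c \<le> G q"
        unfolding c_def G_def using 1 by (intro mult_mono) auto
      moreover have "fst q \<in> {s\<^sup>2 - s / 2..s\<^sup>2 + s / 2} \<and> snd q \<in> {- s / 2..s / 2}"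
        using True unfolding atLeastAtMost_iff by linarith
      then have "g q = 1" by (simp add: g_def)
      ultimately show ?thesis by simp
    next
      case False
      then have "\<not> (fst q \<in> {s\<^sup>2 - s / 2..s\<^sup>2 + s / 2} \<and> snd q \<in> {- s / 2..s / 2})"
        unfolding atLeastAtMost_iff by linarith
      then have "g q = 0" by (auto simp: g_def)
      then show ?thesis using G_nonneg[of q] by simp
    qed
  qed (use g G_int in auto)
  finally show "(2 * s\<^sup>2) powr (- \<alpha>) * exp (- 16) * s\<^sup>2 \<le> (\<integral>q. G q \<partial>lborel)"
    by (simp add: c_def)
qed

text \<open>Integrability of V against the squared amplitude is not assumed. Comparison therefore
  goes through an integrable minorant \<open>L\<close> that factors into a horizontal and a vertical
  part.\<close>

lemma potential_dominates:
  fixes V :: "real ^ 3 \<Rightarrow> real" and w :: "real \<Rightarrow> real"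
  assumes "4 \<le> s" "0 < \<alpha>"
    and V: "\<And>x y z. V (vector [x, y, z]) \<ge> japanese_bracket (x, y) powr (- \<alpha>) * w z"
    and int: "integrable lebesgue (\<lambda>z. w z * (bump (z / s))\<^sup>2)"
    and large: "56 * B ^ 6 * s < (2 * s\<^sup>2) powr (- \<alpha>) * exp (- 16) * s\<^sup>2 * (\<integral>z. w z * (bump (z / s))\<^sup>2 \<partial>lebesgue)"
  obtains L where "integrable lebesgue L" "\<And>p. L p \<le> V p * (amplitude s p)\<^sup>2"
    "(\<integral>p. energy_re s p * amplitude s p \<partial>lebesgue) < (\<integral>p. L p \<partial>lebesgue)"
proof
  define G where "G = (\<lambda>q :: real \<times> real. japanese_bracket q powr (- \<alpha>) * (bump (fst q / s - s) * bump (snd q / s))\<^sup>2)"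
  define h where "h z = w z * (bump (z / s))\<^sup>2" for z
  define L where "L p = G (p $ 1, p $ 2) * h (p $ 3)" for p :: "real ^ 3"
  have h: "integrable lebesgue h" using int by (simp add: h_def[abs_def])
  note G = horizontal_integral[OF assms(1,2), folded G_def]
  have s: "0 < s" using assms(1) by simp
  show "integrable lebesgue L"
    unfolding L_def by (rule lebesgue_integral_vec3_mult(1)[OF G(1) h])
  show "L p \<le> V p * (amplitude s p)\<^sup>2" for p
  proof -
    have "vector [p $ 1, p $ 2, p $ 3] = p"
      by (simp add: vec_eq_iff forall_3)
    with V[of "p $ 1" "p $ 2" "p $ 3"]
    have "(japanese_bracket (p $ 1, p $ 2) powr (- \<alpha>) * w (p $ 3)) * (amplitude s p)\<^sup>2 \<le> V p * (amplitude s p)\<^sup>2"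
      by (intro mult_right_mono) simp_all
    then show ?thesis
      by (simp add: L_def G_def h_def amplitude_def power_mult_distrib mult_ac)
  qed
  define I where "I = (\<integral>z. h z \<partial>lebesgue)"
  have pos: "0 < (2 * s\<^sup>2) powr (- \<alpha>) * exp (- 16) * s\<^sup>2" using s by simp
  have "0 \<le> 56 * B ^ 6 * s" using s by simp
  \<comment> \<open>The assumption \<open>large\<close> itself forces \<open>I\<close> to be
    positive, even where \<open>w\<close> changes sign. Positivity is what permits multiplying the
    lower bound for the horizontal integral by \<open>I\<close>.\<close>
  then have "0 < (2 * s\<^sup>2) powr (- \<alpha>) * exp (- 16) * s\<^sup>2 * I"
    using large unfolding I_def h_def by linarith
  then have "0 < I" using pos by (simp only: zero_less_mult_pos)
  have "(\<integral>p. energy_re s p * amplitude s p \<partial>lebesgue) \<le> 56 * B ^ 6 * s"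
    by (rule energy_integral(2)[OF assms(1)])
  also have "\<dots> < (2 * s\<^sup>2) powr (- \<alpha>) * exp (- 16) * s\<^sup>2 * I"
    using large by (simp add: I_def h_def)
  also have "\<dots> \<le> (\<integral>q. G q \<partial>lborel) * I"
    using G(2) \<open>0 < I\<close> by (intro mult_right_mono) auto
  also have "\<dots> = (\<integral>p. L p \<partial>lebesgue)"
    unfolding L_def I_def by (rule lebesgue_integral_vec3_mult(2)[OF G(1) h, symmetric])
  finally show "(\<integral>p. energy_re s p * amplitude s p \<partial>lebesgue) < (\<integral>p. L p \<partial>lebesgue)" .
qed

end

subsection \<open>Energy of the trial functions\<close>

context bump_bounds
begin

text \<open>The powers of s are 1 on the left and 2 - 2 \<alpha> + \<beta> on the right. The
  exponent \<beta> is 0 in case (i) and 1 - \<gamma> in case (ii), so the positive gap is precisely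
  \<alpha> < 1/2, respectively \<alpha> + \<gamma> / 2 < 1.\<close>

lemma eventually_large:
  fixes \<alpha> \<beta> c :: real
  assumes "0 < c" "0 < 1 - 2 * \<alpha> + \<beta>"
    and I: "eventually (\<lambda>s. c * s powr \<beta> \<le> I s) at_top"
  shows "eventually (\<lambda>s. 56 * B ^ 6 * s < (2 * s\<^sup>2) powr (- \<alpha>) * exp (- 16) * s\<^sup>2 * I s) at_top"
proof -
  define e where "e = 1 - 2 * \<alpha> + \<beta>"
  define K where "K = 2 powr (- \<alpha>) * exp (- 16) * c"
  have K: "0 < K" using assms(1) by (simp add: K_def)
  define D where "D = 56 * B ^ 6 / K"
  have D: "0 < D" using K B_ge by (simp add: D_def)
  have "0 < e" using assms(2) by (simp add: e_def)
  show ?thesis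
    using I eventually_gt_at_top[of "D powr (1 / e)"]
  proof eventually_elim
    case (elim s)
    have "0 < D powr (1 / e)" using D by simp
    then have s: "0 < s" using elim by linarith
    have "(D powr (1 / e)) powr e < s powr e"
      using elim D \<open>0 < e\<close> by (intro powr_less_mono2) auto
    then have "D < s powr e" using D \<open>0 < e\<close> by (simp add: powr_powr)
    then have "56 * B ^ 6 * s < K * s powr e * s"
      using K s by (simp add: D_def field_simps)
    also have "\<dots> = (2 * s\<^sup>2) powr (- \<alpha>) * exp (- 16) * s\<^sup>2 * (c * s powr \<beta>)"
    proof -
      have "(2 * s\<^sup>2) powr (- \<alpha>) = 2 powr (- \<alpha>) * s powr (- 2 * \<alpha>)"
      proof -
        have "(2 * s\<^sup>2) powr (- \<alpha>) = 2 powr (- \<alpha>) * (s powr 2) powr (- \<alpha>)"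
          using s by (simp add: powr_mult)
        then show ?thesis by (simp add: powr_powr)
      qed
      moreover have "s\<^sup>2 = s powr 1 * s" using s by (simp add: power2_eq_square)
      moreover have "s powr e = s powr (- 2 * \<alpha>) * s powr 1 * s powr \<beta>"
        unfolding powr_add[symmetric] e_def by (rule arg_cong[where f = "(powr) s"]) simp
      ultimately show ?thesis by (simp only: K_def mult_ac)
    qed
    also have "\<dots> \<le> (2 * s\<^sup>2) powr (- \<alpha>) * exp (- 16) * s\<^sup>2 * I s"
      using elim by (intro mult_left_mono) auto
    finally show ?case .
  qed
qed

text \<open>As s grows, bump (z / s) tends to bump 0, and dominated convergence gives the limit
  (bump 0)^2 times the integral of \<open>v\<close>. Positivity of the total integral thus suffices
  although \<open>v\<close> may change sign; \<open>c\<close> is half the limit.\<close>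

lemma vertical_integral_integrable:
  fixes v :: "real \<Rightarrow> real"
  assumes "integrable lebesgue v"
  shows "eventually (\<lambda>s. integrable lebesgue (\<lambda>z. v z * (bump (z / s))\<^sup>2)) at_top"
    and "0 < (\<integral>z. v z \<partial>lebesgue) \<Longrightarrow>
      \<exists>c>0. eventually (\<lambda>s. c * s powr 0 \<le> (\<integral>z. v z * (bump (z / s))\<^sup>2 \<partial>lebesgue)) at_top"
proof -
  have v [measurable]: "v \<in> borel_measurable lebesgue" using assms by auto
  have meas: "(\<lambda>z. v z * (bump (z / s))\<^sup>2) \<in> borel_measurable lebesgue" for s
    by (intro borel_measurable_times v measurable_completion) measurable
  have le: "norm (v z * (bump (z / s))\<^sup>2) \<le> norm (B\<^sup>2 * v z)" for s z
  proof -
    have "\<bar>bump (z / s)\<bar>\<^sup>2 \<le> B\<^sup>2" by (intro power_mono bump_le) auto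
    then show ?thesis by (simp add: abs_mult mult.commute mult_left_mono)
  qed
  have w: "integrable lebesgue (\<lambda>z. norm (B\<^sup>2 * v z))" using assms by simp
  show "eventually (\<lambda>s. integrable lebesgue (\<lambda>z. v z * (bump (z / s))\<^sup>2)) at_top"
    by (intro always_eventually allI Bochner_Integration.integrable_bound[OF w meas] AE_I2)
      (use le in simp)
  assume pos: "0 < (\<integral>z. v z \<partial>lebesgue)"
  have "((\<lambda>s. \<integral>z. v z * (bump (z / s))\<^sup>2 \<partial>lebesgue) \<longlongrightarrow> (\<integral>z. v z * (bump 0)\<^sup>2 \<partial>lebesgue)) at_top"
  proof (rule integral_dominated_convergence_at_top[OF _ _ w])
    show "(\<lambda>z. v z * (bump 0)\<^sup>2) \<in> borel_measurable lebesgue" by measurable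
    show "AE z in lebesgue. ((\<lambda>s. v z * (bump (z / s))\<^sup>2) \<longlongrightarrow> v z * (bump 0)\<^sup>2) at_top"
    proof (intro AE_I2)
      fix z :: real
      have "((\<lambda>s. z / s) \<longlongrightarrow> 0) at_top"
        by (intro tendsto_divide_0[OF tendsto_const] filterlim_at_top_imp_at_infinity filterlim_ident)
      then have "((\<lambda>s. bump (z / s)) \<longlongrightarrow> bump 0) at_top"
        by (rule isCont_tendsto_compose[OF DERIV_isCont[OF bump_deriv]])
      then show "((\<lambda>s. v z * (bump (z / s))\<^sup>2) \<longlongrightarrow> v z * (bump 0)\<^sup>2) at_top"
        by (intro tendsto_intros)
    qed
    show "\<forall>\<^sub>F s in at_top. AE z in lebesgue. norm (v z * (bump (z / s))\<^sup>2) \<le> norm (B\<^sup>2 * v z)"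
      by (intro always_eventually allI AE_I2 le)
  qed (rule meas)
  moreover define c where "c = (\<integral>z. v z \<partial>lebesgue) * (bump 0)\<^sup>2 / 2"
  moreover have "(\<integral>z. v z * (bump 0)\<^sup>2 \<partial>lebesgue) = 2 * c"
    by (simp add: c_def)
  ultimately have lim: "((\<lambda>s. \<integral>z. v z * (bump (z / s))\<^sup>2 \<partial>lebesgue) \<longlongrightarrow> 2 * c) at_top"
    by metis
  have "0 < c" using pos bump_pos[of 0] by (simp add: c_def)
  then have "eventually (\<lambda>s. c < (\<integral>z. v z * (bump (z / s))\<^sup>2 \<partial>lebesgue)) at_top"
    by (intro order_tendstoD(1)[OF lim]) simp
  then have "eventually (\<lambda>s. c * s powr 0 \<le> (\<integral>z. v z * (bump (z / s))\<^sup>2 \<partial>lebesgue)) at_top"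
    using eventually_gt_at_top[of 0] by eventually_elim simp
  with \<open>0 < c\<close> show "\<exists>c>0. eventually (\<lambda>s. c * s powr 0 \<le> (\<integral>z. v z * (bump (z / s))\<^sup>2 \<partial>lebesgue)) at_top"
    by blast
qed

text \<open>On |z| <= s / 2, an interval of length s, the squared bump is at least exp (-8) and the
  bracket is at most s.\<close>

lemma vertical_integral_power:
  fixes C \<gamma> s :: real
  assumes "0 < C" "0 < \<gamma>" "4 \<le> s"
  defines "w \<equiv> (\<lambda>z :: real. C * japanese_bracket z powr (- \<gamma>))"
  shows "integrable lebesgue (\<lambda>z. w z * (bump (z / s))\<^sup>2)"
    and "C * exp (- 8) * s powr (1 - \<gamma>) \<le> (\<integral>z. w z * (bump (z / s))\<^sup>2 \<partial>lebesgue)"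
proof -
  have s: "0 < s" using assms by simp
  have jb: "1 \<le> japanese_bracket z" for z :: real
    by (simp add: japanese_bracket_def)
  have [measurable]: "(\<lambda>z :: real. japanese_bracket z) \<in> borel_measurable borel"
    unfolding japanese_bracket_def by (intro borel_measurable_continuous_onI continuous_intros)
  have meas [measurable]: "(\<lambda>z. w z * (bump (z / s))\<^sup>2) \<in> borel_measurable borel"
    unfolding w_def by measurable
  have nonneg: "0 \<le> w z * (bump (z / s))\<^sup>2" for z
    using assms(1) by (simp add: w_def)
  have int: "integrable lborel (\<lambda>z. w z * (bump (z / s))\<^sup>2)"
  proof (rule Bochner_Integration.integrable_bound)
    show "integrable lborel (\<lambda>z. C * B\<^sup>2 * indicat_real {- s..s} z)"
      by (auto intro!: integrable_mult_right integrable_real_indicator simp: emeasure_lborel_Icc_eq)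
    show "AE z in lborel. norm (w z * (bump (z / s))\<^sup>2) \<le> norm (C * B\<^sup>2 * indicat_real {- s..s} z)"
    proof (intro AE_I2)
      fix z :: real
      show "norm (w z * (bump (z / s))\<^sup>2) \<le> norm (C * B\<^sup>2 * indicat_real {- s..s} z)"
      proof (cases "z \<in> {- s..s}")
        case True
        have "japanese_bracket z powr (- \<gamma>) \<le> 1"
          using powr_mono[of "- \<gamma>" 0 "japanese_bracket z"] jb[of z] assms(2) by simp
        moreover have "\<bar>bump (z / s)\<bar>\<^sup>2 \<le> B\<^sup>2" by (intro power_mono bump_le) auto
        ultimately have "w z * (bump (z / s))\<^sup>2 \<le> C * 1 * B\<^sup>2"
          unfolding w_def using assms(1) by (intro mult_mono) auto
        then show ?thesis using True nonneg[of z] by simp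
      next
        case False
        then have "s < \<bar>z\<bar>" by auto
        then have "1 < \<bar>z / s\<bar>" using s by (simp add: abs_divide)
        then show ?thesis using False by (simp add: bump_outside)
      qed
    qed
  qed simp
  then show "integrable lebesgue (\<lambda>z. w z * (bump (z / s))\<^sup>2)"
    by (simp add: integrable_completion)
  define c where "c = C * s powr (- \<gamma>) * exp (- 8)"
  have i: "integrable lborel (indicat_real {- s / 2..s / 2})"
    by (auto intro!: integrable_real_indicator simp: emeasure_lborel_Icc_eq)
  have "C * exp (- 8) * s powr (1 - \<gamma>) = c * s"
    using s by (simp add: c_def powr_diff powr_minus field_simps)
  also have "\<dots> = (\<integral>z. c * indicat_real {- s / 2..s / 2} z \<partial>lborel)"
    using s by simp
  also have "\<dots> \<le> (\<integral>z. w z * (bump (z / s))\<^sup>2 \<partial>lborel)"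
  proof (rule integral_mono)
    show "c * indicat_real {- s / 2..s / 2} z \<le> w z * (bump (z / s))\<^sup>2" for z
    proof (cases "z \<in> {- s / 2..s / 2}")
      case True
      then have z: "\<bar>z\<bar> \<le> s / 2" unfolding atLeastAtMost_iff by linarith
      then have "\<bar>z / s\<bar> \<le> 1 / 2" using s by (simp add: abs_divide field_simps)
      then have "(exp (- 4))\<^sup>2 \<le> (bump (z / s))\<^sup>2"
        by (intro power_mono bump_ge) auto
      then have 1: "exp (- 8) \<le> (bump (z / s))\<^sup>2"
        by (simp add: power2_eq_square flip: exp_add)
      have "japanese_bracket z \<le> s"
        unfolding japanese_bracket_def
      proof (rule real_le_lsqrt)
        have "\<bar>z\<bar>\<^sup>2 \<le> (s / 2)\<^sup>2" using z by (intro power_mono) auto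
        moreover have "1 + (s / 2)\<^sup>2 \<le> s\<^sup>2"
        proof -
          have "4 * 4 \<le> s * s" using assms(3) by (intro mult_mono) auto
          then show ?thesis by (simp add: power2_eq_square)
        qed
        ultimately show "1 + (norm z)\<^sup>2 \<le> s\<^sup>2" by simp
      qed (use s in simp)
      then have "s powr (- \<gamma>) \<le> japanese_bracket z powr (- \<gamma>)"
        using jb[of z] assms(2) by (intro powr_mono2') auto
      then have "c \<le> w z * (bump (z / s))\<^sup>2"
        unfolding c_def w_def using 1 assms(1) by (intro mult_mono) auto
      then show ?thesis using True by simp
    next
      case False
      then show ?thesis using nonneg[of z] by simp
    qed
  qed (use i int in auto)
  also have "\<dots> = (\<integral>z. w z * (bump (z / s))\<^sup>2 \<partial>lebesgue)"
    by (simp add: integral_completion)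
  finally show "C * exp (- 8) * s powr (1 - \<gamma>) \<le> (\<integral>z. w z * (bump (z / s))\<^sup>2 \<partial>lebesgue)" .
qed

section \<open>Disjoint supports and the final assembly\<close>

text \<open>The first coordinates already separate the boxes: t >= 2 s gives t^2 - t >= 4 s^2 - 2 s,
  which exceeds s^2 + s as soon as s > 1.\<close>

lemma trial_box_disjoint:
  assumes "1 < s" "2 * s \<le> t" "p \<in> trial_box s" "p \<in> trial_box t"
  shows False
proof -
  have "p $ 1 \<le> s\<^sup>2 + s" "t\<^sup>2 - t \<le> p $ 1"
    using assms(3,4) by (auto simp: trial_box_def abs_le_iff)
  moreover have "(2 * s) * (2 * s - 1) \<le> t * (t - 1)"
    using assms(1,2) by (intro mult_mono) auto
  moreover have "s * 1 < s * s" using assms(1) by (intro mult_strict_left_mono) auto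
  ultimately show False
    using assms(1) by (simp add: power2_eq_square algebra_simps)
qed

text \<open>The differential operator and the multiplication are both local, so with disjoint
  supports all cross terms vanish pointwise. The form of H - V becomes diagonal in the coefficients,
  with negative diagonal entries.\<close>

lemma trial_family:
  fixes V :: "real ^ 3 \<Rightarrow> real" and s :: "nat \<Rightarrow> real" and n :: nat
  assumes s: "\<And>i. 4 \<le> s i" "\<And>i j. i < j \<Longrightarrow> 2 * s i \<le> s j"
    and L: "\<And>i. integrable lebesgue (L i)" "\<And>i p. L i p \<le> V p * (amplitude (s i) p)\<^sup>2"
      "\<And>i. (\<integral>p. energy_re (s i) p * amplitude (s i) p \<partial>lebesgue) < (\<integral>p. L i p \<partial>lebesgue)"
  shows "\<exists>F G. (\<forall>i\<le>n. (F i, G i) \<in> H_A) \<and>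
      (\<forall>a W. (\<exists>i\<le>n. a i \<noteq> 0) \<longrightarrow> (\<Sum>i\<le>n. a i *\<^sub>R F i, W) \<in> mult_op V \<longrightarrow>
        ((\<Sum>i\<le>n. a i *\<^sub>R G i) - W) \<bullet> (\<Sum>i\<le>n. a i *\<^sub>R F i) < 0)"
proof -
  define u where "u i = trial (s i)" for i
  define m where "m i = magnetic_laplacian A_pot (trial (s i))" for i
  define F where "F i = abs_L2 (u i)" for i
  define G where "G i = abs_L2 (m i)" for i
  have s0: "0 < s i" for i using s(1)[of i] by linarith
  have rep: "represents (u i) (F i)" "represents (m i) (G i)" for i
    unfolding F_def G_def u_def m_def by (intro represents_abs trial_square_integrable s(1))+
  have "(F i, G i) \<in> H_A" for i
  proof -
    have "(F i, G i) \<in> H_min"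
      unfolding H_min_def using rep[of i] test_function_trial[OF s0] by (auto simp: u_def m_def)
    then show ?thesis unfolding H_A_closure using closure_subset by blast
  qed
  moreover have "((\<Sum>i\<le>n. a i *\<^sub>R G i) - W) \<bullet> (\<Sum>i\<le>n. a i *\<^sub>R F i) < 0"
    if a: "\<exists>i\<le>n. a i \<noteq> 0" and W: "(\<Sum>i\<le>n. a i *\<^sub>R F i, W) \<in> mult_op V" for a W
  proof -
    define U where "U p = (\<Sum>i\<le>n. a i *\<^sub>R u i p)" for p
    define M where "M p = (\<Sum>i\<le>n. a i *\<^sub>R m i p)" for p
    have U: "represents U (\<Sum>i\<le>n. a i *\<^sub>R F i)"
      unfolding U_def by (intro represents_sum represents_scaleR rep)
    have M: "represents M (\<Sum>i\<le>n. a i *\<^sub>R G i)"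
      unfolding M_def by (intro represents_sum represents_scaleR rep)
    have "AE p in lebesgue. V p *\<^sub>R rep_L2 (\<Sum>i\<le>n. a i *\<^sub>R F i) p = V p *\<^sub>R U p"
      using U unfolding represents_def by eventually_elim simp
    \<comment> \<open>\<open>mult_op\<close> is stated for the representative chosen by
      \<open>rep_L2\<close>; almost everywhere agreement moves \<open>W\<close> to the explicit
      function \<open>U\<close>.\<close>
    then have VU: "represents (\<lambda>p. V p *\<^sub>R U p) W"
      using W represents_cong_AE by (fastforce simp: mult_op_def scaleR_conv_of_real)
    define E where "E i p = energy_re (s i) p * amplitude (s i) p" for i p
    have pointwise: "(M p - V p *\<^sub>R U p) \<bullet> U p \<le> (\<Sum>i\<le>n. (a i)\<^sup>2 * (E i p - L i p))" for p
    proof -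
      have zero: "u i p = 0 \<and> m i p = 0" if "p \<notin> trial_box (s i)" for i
        using outside_trial_box[OF s0 that]
        by (simp add: u_def m_def trial_amplitude trial_laplacian_eq[OF s0])
      have disj: "p \<notin> trial_box (s i) \<or> p \<notin> trial_box (s j)" if "i \<noteq> j" for i j
        using that s(1)[of i] s(1)[of j] s(2)[of i j] s(2)[of j i] trial_box_disjoint[of "s i" "s j" p]
          trial_box_disjoint[of "s j" "s i" p] by (cases "i < j") auto
      define x where "x i = m i p - V p *\<^sub>R u i p" for i
      have off: "x i \<bullet> u j p = 0" if "i \<noteq> j" for i j
        using disj[OF that] zero by (auto simp: x_def)
      have MVU_eq: "M p - V p *\<^sub>R U p = (\<Sum>i\<le>n. a i *\<^sub>R x i)"
        by (simp add: M_def U_def x_def scaleR_diff_right sum_subtractf scaleR_sum_right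
            mult.commute del: scaleR_conv_of_real)
      have "(M p - V p *\<^sub>R U p) \<bullet> U p = (\<Sum>i\<le>n. \<Sum>j\<le>n. a i * (a j * (x i \<bullet> u j p)))"
        unfolding MVU_eq unfolding U_def inner_sum_left unfolding inner_sum_right
        by (simp add: mult.left_commute)
      also have "\<dots> = (\<Sum>i\<le>n. \<Sum>j\<le>n. if j = i then (a i)\<^sup>2 * (x i \<bullet> u i p) else 0)"
        by (intro sum.cong refl) (auto simp: off power2_eq_square)
      also have "\<dots> = (\<Sum>i\<le>n. (a i)\<^sup>2 * (x i \<bullet> u i p))"
        by (intro sum.cong refl) (simp add: sum.delta)
      also have "\<dots> \<le> (\<Sum>i\<le>n. (a i)\<^sup>2 * (E i p - L i p))"
      proof (intro sum_mono mult_left_mono)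
        fix i
        have "x i \<bullet> u i p = E i p - V p * (amplitude (s i) p)\<^sup>2"
          unfolding x_def u_def m_def E_def inner_diff_left inner_scaleR_left
          by (simp only: inner_trial[OF s0])
        then show "x i \<bullet> u i p \<le> E i p - L i p" using L(2)[of i p] by simp
      qed simp
      finally show ?thesis .
    qed
    have E: "integrable lebesgue (E i)" for i
      unfolding E_def by (rule energy_integral(1)[OF s(1)])
    have MVU: "represents (\<lambda>p. M p - V p *\<^sub>R U p) ((\<Sum>i\<le>n. a i *\<^sub>R G i) - W)"
      by (intro represents_diff M VU)
    have "((\<Sum>i\<le>n. a i *\<^sub>R G i) - W) \<bullet> (\<Sum>i\<le>n. a i *\<^sub>R F i)
        = (\<integral>p. (M p - V p *\<^sub>R U p) \<bullet> U p \<partial>lebesgue)"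
      by (rule inner_represents[OF MVU U])
    \<comment> \<open>The left integrand is integrable as an inner product of two L^2 functions, so
      V may be bounded by the minorants after summation.\<close>
    also have "\<dots> \<le> (\<integral>p. (\<Sum>i\<le>n. (a i)\<^sup>2 * (E i p - L i p)) \<partial>lebesgue)"
      using represents_inner_integrable[OF MVU U] E L(1) pointwise
      by (intro integral_mono) auto
    also have "\<dots> = (\<Sum>i\<le>n. (a i)\<^sup>2 * ((\<integral>p. E i p \<partial>lebesgue) - (\<integral>p. L i p \<partial>lebesgue)))"
      using E L(1) by simp
    also have "\<dots> < (\<Sum>i\<le>n. 0)"
    proof (rule sum_strict_mono_ex1)
      have neg: "(\<integral>p. E i p \<partial>lebesgue) - (\<integral>p. L i p \<partial>lebesgue) < 0" for i
        using L(3)[of i] by (simp add: E_def)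
      show "\<forall>i\<in>{..n}. (a i)\<^sup>2 * ((\<integral>p. E i p \<partial>lebesgue) - (\<integral>p. L i p \<partial>lebesgue)) \<le> 0"
        by (intro ballI mult_nonneg_nonpos zero_le_power2 less_imp_le[OF neg])
      show "\<exists>i\<in>{..n}. (a i)\<^sup>2 * ((\<integral>p. E i p \<partial>lebesgue) - (\<integral>p. L i p \<partial>lebesgue)) < 0"
        using a neg by (auto intro!: mult_pos_neg bexI)
    qed simp
    finally show ?thesis by simp
  qed
  ultimately show ?thesis by blast
qed

end

theorem theorem1p2:
  fixes V :: "real ^ 3 \<Rightarrow> real" and v :: "real \<Rightarrow> real" and \<alpha> :: real
  assumes V_compact: "compact_op ((op_shift H_A 1)\<inverse> O mult_op V)"
    and alpha_pos: "\<alpha> > 0"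
    and lower_bound: "\<And>x y z. V (vector [x, y, z]) \<ge> japanese_bracket (x, y) powr (- \<alpha>) * v z"
    and decay:
      "(\<alpha> < 1 / 2 \<and> integrable lebesgue v \<and> (\<integral>z. v z \<partial>lebesgue) > 0) \<or>
       (\<exists>C \<gamma>. C > 0 \<and> \<gamma> > 0 \<and> (\<forall>z. v z \<ge> C * japanese_bracket z powr (- \<gamma>)) \<and>
              \<alpha> + \<gamma> / 2 < 1)"
  shows "infinite {\<mu>. \<mu> < 0 \<and> eigenvalue (op_diff H_A (mult_op V)) \<mu>} \<and>
         0 islimpt {\<mu>. \<mu> < 0 \<and> eigenvalue (op_diff H_A (mult_op V)) \<mu>}"
proof -
  obtain b1 b2 B where "bump_bounds b1 b2 B"
    using bump_derivatives unfolding bump_bounds_def by metis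
  then interpret bump_bounds b1 b2 B .
  define I where "I w s = (\<integral>z. w z * (bump (z / s))\<^sup>2 \<partial>lebesgue)" for w :: "real \<Rightarrow> real" and s
  \<comment> \<open>Both assumptions are reduced to one statement: a minorant \<open>w\<close> of
    \<open>v\<close> whose integral over scale s grows at least like s to the power \<beta>. In case
    (ii) passing to \<open>w\<close> avoids any measurability question about
    \<open>v\<close>.\<close>
  have "\<exists>w c \<beta>. (\<forall>z. w z \<le> v z) \<and> 0 < c \<and> 0 < 1 - 2 * \<alpha> + \<beta> \<and>
      eventually (\<lambda>s. integrable lebesgue (\<lambda>z. w z * (bump (z / s))\<^sup>2)) at_top \<and>
      eventually (\<lambda>s. c * s powr \<beta> \<le> I w s) at_top"
    using decay
  proof
    assume *: "\<alpha> < 1 / 2 \<and> integrable lebesgue v \<and> (\<integral>z. v z \<partial>lebesgue) > 0"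
    then obtain c where "0 < c" "eventually (\<lambda>s. c * s powr 0 \<le> I v s) at_top"
      using vertical_integral_integrable(2)[of v] by (auto simp: I_def)
    with * vertical_integral_integrable(1)[of v] show ?thesis
      by (intro exI[of _ v] exI[of _ c] exI[of _ 0]) auto
  next
    assume "\<exists>C \<gamma>. C > 0 \<and> \<gamma> > 0 \<and> (\<forall>z. v z \<ge> C * japanese_bracket z powr (- \<gamma>)) \<and> \<alpha> + \<gamma> / 2 < 1"
    then obtain C \<gamma> where C: "C > 0" "\<gamma> > 0" "\<And>z. v z \<ge> C * japanese_bracket z powr (- \<gamma>)"
        "\<alpha> + \<gamma> / 2 < 1"
      by blast
    define w where "w z = C * japanese_bracket z powr (- \<gamma>)" for z :: real
    have "eventually (\<lambda>s. integrable lebesgue (\<lambda>z. w z * (bump (z / s))\<^sup>2)) at_top"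
      using eventually_ge_at_top[of 4] unfolding w_def
      by eventually_elim (rule vertical_integral_power(1)[OF C(1,2)])
    moreover have "eventually (\<lambda>s. C * exp (- 8) * s powr (1 - \<gamma>) \<le> I w s) at_top"
      using eventually_ge_at_top[of 4] unfolding w_def I_def
      by eventually_elim (rule vertical_integral_power(2)[OF C(1,2)])
    ultimately show ?thesis
      using C by (intro exI[of _ w] exI[of _ "C * exp (- 8)"] exI[of _ "1 - \<gamma>"]) (auto simp: w_def)
  qed
  then obtain w c \<beta> where w: "\<And>z. w z \<le> v z" and c: "0 < c" "0 < 1 - 2 * \<alpha> + \<beta>"
    and int: "eventually (\<lambda>s. integrable lebesgue (\<lambda>z. w z * (bump (z / s))\<^sup>2)) at_top"
    and I: "eventually (\<lambda>s. c * s powr \<beta> \<le> I w s) at_top"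
    by blast
  have low: "V (vector [x, y, z]) \<ge> japanese_bracket (x, y) powr (- \<alpha>) * w z" for x y z
    by (rule order_trans[OF mult_left_mono[OF w] lower_bound]) simp
  have "eventually (\<lambda>s. \<exists>L. integrable lebesgue L \<and> (\<forall>p. L p \<le> V p * (amplitude s p)\<^sup>2) \<and>
      (\<integral>p. energy_re s p * amplitude s p \<partial>lebesgue) < (\<integral>p. L p \<partial>lebesgue)) at_top"
    using eventually_ge_at_top[of 4] int eventually_large[OF c I]
  proof eventually_elim
    case (elim s)
    obtain L where "integrable lebesgue L" "\<And>p. L p \<le> V p * (amplitude s p)\<^sup>2"
      "(\<integral>p. energy_re s p * amplitude s p \<partial>lebesgue) < (\<integral>p. L p \<partial>lebesgue)"
      using potential_dominates[OF elim(1) alpha_pos low elim(2) elim(3)[unfolded I_def]] by blast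
    then show ?case by blast
  qed
  then obtain N where N: "\<And>s. N \<le> s \<Longrightarrow> \<exists>L. integrable lebesgue L \<and> (\<forall>p. L p \<le> V p * (amplitude s p)\<^sup>2) \<and>
      (\<integral>p. energy_re s p * amplitude s p \<partial>lebesgue) < (\<integral>p. L p \<partial>lebesgue)"
    by (auto simp: eventually_at_top_linorder)
  \<comment> \<open>Doubling the scale at each index makes the boxes disjoint; the factor
    \<open>max N 4\<close> starts where all estimates hold.\<close>
  define s where "s i = max N 4 * 2 ^ i" for i :: nat
  have s_ge: "max N 4 \<le> s i" for i
    unfolding s_def using mult_left_mono[of 1 "2 ^ i" "max N 4"] by simp
  have s: "4 \<le> s i" "N \<le> s i" for i
    using s_ge[of i] by auto
  have s2: "2 * s i \<le> s j" if "i < j" for i j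
  proof -
    have "(2::real) ^ Suc i \<le> 2 ^ j" using that by (intro power_increasing) auto
    from mult_left_mono[OF this, of "max N 4"] show ?thesis by (simp add: s_def mult_ac)
  qed
  obtain L where L: "\<And>i. integrable lebesgue (L i)" "\<And>i p. L i p \<le> V p * (amplitude (s i) p)\<^sup>2"
      "\<And>i. (\<integral>p. energy_re (s i) p * amplitude (s i) p \<partial>lebesgue) < (\<integral>p. L i p \<partial>lebesgue)"
    using N[OF s(2)] by metis
  have lim: "0 islimpt {\<mu>. \<mu> < 0 \<and> eigenvalue (op_diff H_A (mult_op V)) \<mu>}"
    by (rule H_A_negative_eigenvalues[OF V_compact trial_family[OF s(1) s2 L]])
  \<comment> \<open>A finite set has no limit points, so accumulation at 0 already contains
    infinitude.\<close>
  moreover have "infinite {\<mu>. \<mu> < 0 \<and> eigenvalue (op_diff H_A (mult_op V)) \<mu>}"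
    using lim islimpt_finite by blast
  ultimately show ?thesis by blast
qed

end
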